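(* There exists a deterministic algorithm that solves the problem CONJUGACY in time polynomial in $\log|A|$, where CONJUGACY is the following problem. Input: an abelian $p$-group $A$ (for some prime $p$) and two matrices $U_1$ and $U_2$ in the group $R(A)$ such that the orders of $U_1$ and $U_2$ are coprime with $p$. Output: an element $U\in R(A)$ such that $U\ast U_1=U_2\ast U$, if such an element exists.
   Context: Let $p$ be a prime and let $A$ be a finite abelian $p$-group isomorphic to $\mathbb{Z}_{p^{e_1}}\times\cdots\times\mathbb{Z}_{p^{e_s}}$ for positive integers $s$ and $e_1\le e_2\le\cdots\le e_s$. Define $$M(A)=\{(u_{ij})\in\mathbb{Z}^{s\times s}\mid 0\le u_{ij}<p^{e_i}\text{ and }p^{e_i-e_{\min(i,j)}}\text{ divides }u_{ij}\text{ for all }i,j\in\{1,\ldots,s\}\}.$$ For $U=(u_{ij})$ and $U'=(u'_{ij})$ in $M(A)$, the product $U\ast U'$ is the integer matrix $W=(w_{ij})$ of size $s\times s$ with $w_{ij}=\left(\sum_{k=1}^s u_{ik}u'_{kj}\bmod p^{e_i}\right)$ for $i,j\in\{1,\ldots,s\}$. Define $R(A)=\{U\in M(A)\mid\det(U)\not\equiv 0\bmod p\}$. The set $R(A)$ with the operation $\ast$ is a group (isomorphic to the automorphism group of $A$), and orders of elements of $R(A)$ are taken in this group. Solving CONJUGACY means deciding whether $U_1$ and $U_2$ are conjugate in $R(A)$ and, if they are, outputting such a $U$. *)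

theory Defs
  imports
    "HOL-Algebra.Multiplicative_Group"
    "HOL-Algebra.Product_Groups"
    "HOL-Library.Log_Nat"
    "Jordan_Normal_Form.Determinant"
begin

section \<open>Model of computation\<close>

text \<open>
  Algorithms are programs of a deterministic while language over finitely many arrays of natural
  numbers, i.e. structured programs for a random access machine with the operations
  addition, truncated subtraction, multiplication, division and remainder.
  Time is the logarithmic cost of Aho, Hopcroft and Ullman: every operation is charged the bit
  lengths of the numbers and of the array indices it handles.  Running times in this model and on
  multitape Turing machines are polynomially related.  The arrays play the role of
  segments of the memory; a scalar variable is an array used at index 0 only.
\<close>

type_synonym memory = "string \<Rightarrow> nat \<Rightarrow> nat"

definition bit_length :: "nat \<Rightarrow> nat" where
  "bit_length n = max 1 (floorlog 2 n)"

datatype aexp =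
    Lit nat
  | Read string aexp
  | AddE aexp aexp
  | SubE aexp aexp
  | MulE aexp aexp
  | DivE aexp aexp
  | ModE aexp aexp

datatype bexp =
    EqE aexp aexp
  | LessE aexp aexp
  | NegE bexp
  | ConjE bexp bexp

datatype com =
    Skip
  | Assign string aexp aexp  \<comment> \<open>array name, index, value\<close>
  | Seq com com
  | Cond bexp com com
  | While bexp com

fun aval :: "aexp \<Rightarrow> memory \<Rightarrow> nat" where
  "aval (Lit n) m = n"
| "aval (Read x a) m = m x (aval a m)"
| "aval (AddE a b) m = aval a m + aval b m"
| "aval (SubE a b) m = aval a m - aval b m"
| "aval (MulE a b) m = aval a m * aval b m"
| "aval (DivE a b) m = aval a m div aval b m"
| "aval (ModE a b) m = aval a m mod aval b m"

fun acost :: "aexp \<Rightarrow> memory \<Rightarrow> nat" where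
  "acost (Lit n) m = bit_length n"
| "acost (Read x a) m = acost a m + bit_length (aval a m) + bit_length (m x (aval a m))"
| "acost (AddE a b) m = acost a m + acost b m + bit_length (aval a m) + bit_length (aval b m)"
| "acost (SubE a b) m = acost a m + acost b m + bit_length (aval a m) + bit_length (aval b m)"
| "acost (MulE a b) m = acost a m + acost b m + bit_length (aval a m) + bit_length (aval b m)"
| "acost (DivE a b) m = acost a m + acost b m + bit_length (aval a m) + bit_length (aval b m)"
| "acost (ModE a b) m = acost a m + acost b m + bit_length (aval a m) + bit_length (aval b m)"

fun bval :: "bexp \<Rightarrow> memory \<Rightarrow> bool" where
  "bval (EqE a b) m \<longleftrightarrow> aval a m = aval b m"
| "bval (LessE a b) m \<longleftrightarrow> aval a m < aval b m"
| "bval (NegE c) m \<longleftrightarrow> \<not> bval c m"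
| "bval (ConjE c d) m \<longleftrightarrow> bval c m \<and> bval d m"

fun bcost :: "bexp \<Rightarrow> memory \<Rightarrow> nat" where
  "bcost (EqE a b) m = acost a m + acost b m + bit_length (aval a m) + bit_length (aval b m)"
| "bcost (LessE a b) m = acost a m + acost b m + bit_length (aval a m) + bit_length (aval b m)"
| "bcost (NegE c) m = bcost c m + 1"
| "bcost (ConjE c d) m = bcost c m + bcost d m + 1"

definition store :: "string \<Rightarrow> nat \<Rightarrow> nat \<Rightarrow> memory \<Rightarrow> memory" where
  "store x i v m = m(x := (m x)(i := v))"

text \<open>\<open>exec c m t m'\<close>: started in memory \<open>m\<close>, the program \<open>c\<close> halts in memory \<open>m'\<close> after time \<open>t\<close>.\<close>

inductive exec :: "com \<Rightarrow> memory \<Rightarrow> nat \<Rightarrow> memory \<Rightarrow> bool" where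
  exec_Skip: "exec Skip m 1 m"
| exec_Assign:
    "exec (Assign x i a) m
       (acost i m + acost a m + bit_length (aval i m) + bit_length (aval a m))
       (store x (aval i m) (aval a m) m)"
| exec_Seq: "exec c m t m' \<Longrightarrow> exec d m' t' m'' \<Longrightarrow> exec (Seq c d) m (t + t') m''"
| exec_CondTrue: "bval b m \<Longrightarrow> exec c m t m' \<Longrightarrow> exec (Cond b c d) m (bcost b m + t) m'"
| exec_CondFalse: "\<not> bval b m \<Longrightarrow> exec d m t m' \<Longrightarrow> exec (Cond b c d) m (bcost b m + t) m'"
| exec_WhileFalse: "\<not> bval b m \<Longrightarrow> exec (While b c) m (bcost b m) m"
| exec_WhileTrue:
    "bval b m \<Longrightarrow> exec c m t m' \<Longrightarrow> exec (While b c) m' t' m'' \<Longrightarrow>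
     exec (While b c) m (bcost b m + t + t') m''"

inductive_cases exec_SkipE: "exec Skip m t m'"
inductive_cases exec_AssignE: "exec (Assign x i a) m t m'"
inductive_cases exec_SeqE: "exec (Seq c d) m t m'"
inductive_cases exec_CondE: "exec (Cond b c d) m t m'"
inductive_cases exec_WhileE: "exec (While b c) m t m'"

lemma exec_deterministic:
  "exec c m t m' \<Longrightarrow> exec c m u m'' \<Longrightarrow> u = t \<and> m'' = m'"
proof (induction arbitrary: u m'' rule: exec.induct)
  case exec_Skip
  then show ?case by (auto elim: exec_SkipE)
next
  case exec_Assign
  then show ?case by (auto elim: exec_AssignE)
next
  case exec_Seq
  from exec_Seq.prems show ?case by (rule exec_SeqE) (use exec_Seq.IH in blast)
next
  case exec_CondTrue
  from exec_CondTrue.prems show ?case by (rule exec_CondE) (use exec_CondTrue in blast)+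
next
  case exec_CondFalse
  from exec_CondFalse.prems show ?case by (rule exec_CondE) (use exec_CondFalse in blast)+
next
  case exec_WhileFalse
  from exec_WhileFalse.prems show ?case by (rule exec_WhileE) (use exec_WhileFalse in blast)+
next
  case exec_WhileTrue
  from exec_WhileTrue.prems show ?case by (rule exec_WhileE) (use exec_WhileTrue in blast)+
qed


section \<open>The group $A$ and the group $R(A)$\<close>

text \<open>
  The list \<open>es\<close> holds the exponents $e_1 \le \dots \le e_s$.  Rows, columns and exponents are
  indexed from 0 throughout.
\<close>

definition valid_type :: "nat \<Rightarrow> nat list \<Rightarrow> bool" where
  "valid_type p es \<longleftrightarrow> prime p \<and> es \<noteq> [] \<and> sorted es \<and> (\<forall>e \<in> set es. 0 < e)"

definition abelian_p_group :: "nat \<Rightarrow> nat list \<Rightarrow> (nat \<Rightarrow> int) monoid" where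
  "abelian_p_group p es = product_group {..<length es} (\<lambda>i. integer_mod_group (p ^ (es ! i)))"

text \<open>
  The subtraction on exponents is exact because \<open>es\<close> is sorted.
\<close>

definition M_set :: "nat \<Rightarrow> nat list \<Rightarrow> int mat set" where
  "M_set p es =
     {U \<in> carrier_mat (length es) (length es).
        \<forall>i < length es. \<forall>j < length es.
          0 \<le> U $$ (i, j) \<and> U $$ (i, j) < int p ^ (es ! i) \<and>
          int p ^ (es ! i - es ! (min i j)) dvd U $$ (i, j)}"

definition M_mult :: "nat \<Rightarrow> nat list \<Rightarrow> int mat \<Rightarrow> int mat \<Rightarrow> int mat" where
  "M_mult p es U V =
     mat (length es) (length es)
       (\<lambda>(i, j). (\<Sum>k < length es. U $$ (i, k) * V $$ (k, j)) mod int p ^ (es ! i))"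

definition R_group :: "nat \<Rightarrow> nat list \<Rightarrow> int mat monoid" where
  "R_group p es =
     \<lparr>carrier = {U \<in> M_set p es. det U mod int p \<noteq> 0},
      monoid.mult = M_mult p es,
      one = 1\<^sub>m (length es)\<rparr>"


section \<open>The problem CONJUGACY\<close>

definition conjugacy_instance :: "nat \<Rightarrow> nat list \<Rightarrow> int mat \<Rightarrow> int mat \<Rightarrow> bool" where
  "conjugacy_instance p es U1 U2 \<longleftrightarrow>
     valid_type p es \<and>
     U1 \<in> carrier (R_group p es) \<and> U2 \<in> carrier (R_group p es) \<and>
     coprime (group.ord (R_group p es) U1) p \<and> coprime (group.ord (R_group p es) U2) p"

definition conjugators :: "nat \<Rightarrow> nat list \<Rightarrow> int mat \<Rightarrow> int mat \<Rightarrow> int mat set" where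
  "conjugators p es U1 U2 =
     {U \<in> carrier (R_group p es). U \<otimes>\<^bsub>R_group p es\<^esub> U1 = U2 \<otimes>\<^bsub>R_group p es\<^esub> U}"

text \<open>
  The group $A$ is given to the program by $p$, $s$ and the exponents, a matrix by its entries in
  row-major order.  The bit length of the input is polynomial in $\log |A|$.
\<close>

definition mat_array :: "int mat \<Rightarrow> nat \<Rightarrow> nat" where
  "mat_array U n =
     (if n < dim_row U * dim_col U
      then nat (U $$ (n div dim_col U, n mod dim_col U)) else 0)"

definition conjugacy_input :: "nat \<Rightarrow> nat list \<Rightarrow> int mat \<Rightarrow> int mat \<Rightarrow> memory" where
  "conjugacy_input p es U1 U2 =
     (\<lambda>x n. 0)
       (''p'' := (\<lambda>n. if n = 0 then p else 0),
        ''s'' := (\<lambda>n. if n = 0 then length es else 0),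
        ''e'' := (\<lambda>n. if n < length es then es ! n else 0),
        ''U1'' := mat_array U1,
        ''U2'' := mat_array U2)"

text \<open>
  The program answers ``not conjugate'' by leaving 0 in \<open>''found''\<close>; otherwise its answer is the
  $s \times s$ matrix stored in \<open>''U''\<close>.
\<close>

definition conjugacy_output :: "nat \<Rightarrow> memory \<Rightarrow> int mat option" where
  "conjugacy_output s m =
     (if m ''found'' 0 = 0 then None
      else Some (mat s s (\<lambda>(i, j). int (m ''U'' (i * s + j)))))"

definition correct_answer ::
    "nat \<Rightarrow> nat list \<Rightarrow> int mat \<Rightarrow> int mat \<Rightarrow> int mat option \<Rightarrow> bool" where
  "correct_answer p es U1 U2 ans \<longleftrightarrow>
     (case ans of
        Some U \<Rightarrow> U \<in> conjugators p es U1 U2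
      | None \<Rightarrow> conjugators p es U1 U2 = {})"

end

theory Submission
  imports Defs "HOL-Number_Theory.Residues"
begin

text \<open>
  Write \<open>End A\<close> for the ring of matrices in question and \<open>J\<close> for its radical; \<open>End A / J\<close> is a
  product of matrix rings over the field with \<open>p\<close> elements.  The matrices \<open>U1\<close> and \<open>U2\<close> have orders
  dividing \<open>N = (\<Prod>i\<in>{1..s}. p ^ i - 1)\<^sup>2\<close>, which is 1 modulo \<open>p\<close>, so the twisted power sums
  \<open>\<Sum>k<N. U2 ^ (N - 1 - k) * W * U1 ^ k\<close>, computed by repeated doubling, turn arbitrary matrices into
  intertwiners; the same averaging turns plain generalised inverses into intertwining ones.

  The algorithm keeps intertwiners \<open>X\<close> (from \<open>U1\<close> to \<open>U2\<close>) and \<open>Z\<close> (back) with \<open>X * Z * X = X\<close>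
  modulo \<open>J\<close>.  For each elementary matrix it takes the averaged intertwiner \<open>T\<close>, forms
  \<open>Y = (1 - X * Z) * T * (1 - Z * X)\<close>, and adds \<open>Y\<close> to \<open>X\<close> and a generalised inverse of \<open>Y\<close> to \<open>Z\<close>.
  Afterwards \<open>(1 - X * Z) * T * (1 - Z * X)\<close> lies in \<open>J\<close> for all intertwiners \<open>T\<close>.  If a conjugator
  exists, it identifies \<open>X\<close> and \<open>Z\<close> with endomorphisms such that \<open>e = 1 - Z * X\<close> satisfies
  \<open>e = X ^ j * Z ^ j * e\<close> for all \<open>j\<close>; since \<open>X ^ a = X ^ b\<close> for some \<open>a < b\<close> and \<open>X * e = 0\<close>, this
  forces \<open>e = 0\<close>, and \<open>X\<close> itself is a conjugator.  No lifting from \<open>End A / J\<close> is needed.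
\<close>

section \<open>Counting loops with total semantics\<close>

text \<open>The obstacle is determinism in time polynomial in \<open>log p\<close>. Splitting the
  modules given by \<open>U1\<close> and \<open>U2\<close> into simple parts leads to factoring
  polynomials over the field with \<open>p\<close> elements, for which no deterministic method of
  that speed is known, and a random intertwiner may not be drawn. Averages avoid both: they take
  ring operations only, and \<open>N\<close> depends on \<open>p\<close> and \<open>s\<close> alone,
  so the orders of \<open>U1\<close> and \<open>U2\<close> are never computed. \<open>N\<close> is
  the square of the part of the order of GL_s over that field that is prime to \<open>p\<close>; the
  kernel of reduction modulo \<open>p\<close> only contributes a power of \<open>p\<close> to the
  exponent of \<open>R(A)\<close>. Two congruences run side by side. Intertwining is kept modulo
  \<open>null_ideal\<close>, so it is exact in \<open>End A\<close>, whereas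
  \<open>X * Z * X = X\<close> is kept modulo \<open>rad_ideal\<close> only. Since a unit modulo the
  radical is a unit, the final \<open>X\<close> still conjugates exactly.\<close>

datatype prog =
    PAssign string aexp aexp
  | PSeq prog prog
  | PIf bexp prog
  | PFor string aexp prog

abbreviation var :: "string \<Rightarrow> aexp" where
  "var x \<equiv> Read x (Lit 0)"

text \<open>The sublanguage has no open-ended loop, so its programs denote total functions and their
  cost is bounded by structural recursion. The compiled loop evaluates its bound anew in every
  round; \<open>wf_prog\<close> makes this agree with \<open>sem\<close>, which evaluates it
  once.\<close>

primrec compile :: "prog \<Rightarrow> com" where
  "compile (PAssign x i a) = Assign x i a"
| "compile (PSeq P Q) = Seq (compile P) (compile Q)"
| "compile (PIf b P) = Cond b (compile P) Skip"
| "compile (PFor x a P) =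
     Seq (Assign x (Lit 0) (Lit 0))
       (While (LessE (var x) a) (Seq (compile P) (Assign x (Lit 0) (AddE (var x) (Lit 1)))))"

primrec count_loop :: "string \<Rightarrow> (memory \<Rightarrow> memory) \<Rightarrow> nat \<Rightarrow> memory \<Rightarrow> memory" where
  "count_loop x f 0 m = store x 0 0 m"
| "count_loop x f (Suc k) m = store x 0 (Suc k) (f (count_loop x f k m))"

primrec sem :: "prog \<Rightarrow> memory \<Rightarrow> memory" where
  "sem (PAssign x i a) m = store x (aval i m) (aval a m) m"
| "sem (PSeq P Q) m = sem Q (sem P m)"
| "sem (PIf b P) m = (if bval b m then sem P m else m)"
| "sem (PFor x a P) m = count_loop x (sem P) (aval a m) m"

primrec writes :: "prog \<Rightarrow> string set" where
  "writes (PAssign x i a) = {x}"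
| "writes (PSeq P Q) = writes P \<union> writes Q"
| "writes (PIf b P) = writes P"
| "writes (PFor x a P) = insert x (writes P)"

primrec avars :: "aexp \<Rightarrow> string set" where
  "avars (Lit n) = {}"
| "avars (Read x a) = insert x (avars a)"
| "avars (AddE a b) = avars a \<union> avars b"
| "avars (SubE a b) = avars a \<union> avars b"
| "avars (MulE a b) = avars a \<union> avars b"
| "avars (DivE a b) = avars a \<union> avars b"
| "avars (ModE a b) = avars a \<union> avars b"

primrec wf_prog :: "prog \<Rightarrow> bool" where
  "wf_prog (PAssign x i a) \<longleftrightarrow> True"
| "wf_prog (PSeq P Q) \<longleftrightarrow> wf_prog P \<and> wf_prog Q"
| "wf_prog (PIf b P) \<longleftrightarrow> wf_prog P"
| "wf_prog (PFor x a P) \<longleftrightarrow> wf_prog P \<and> x \<notin> writes P \<and> avars a \<inter> insert x (writes P) = {}"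

definition bounded :: "nat \<Rightarrow> memory \<Rightarrow> bool" where
  "bounded B m \<longleftrightarrow> (\<forall>x i. m x i \<le> B)"

text \<open>\<open>B\<close> bounds the stored values and thereby the logarithmic cost of single
  operations; \<open>M\<close> bounds the rounds of every loop. Loop counters are not tested against
  \<open>B\<close>: the assumption \<open>M <= B\<close> covers them.\<close>

primrec safe :: "nat \<Rightarrow> nat \<Rightarrow> prog \<Rightarrow> memory \<Rightarrow> bool" where
  "safe B M (PAssign x i a) m \<longleftrightarrow> aval a m \<le> B"
| "safe B M (PSeq P Q) m \<longleftrightarrow> safe B M P m \<and> safe B M Q (sem P m)"
| "safe B M (PIf b P) m \<longleftrightarrow> (bval b m \<longrightarrow> safe B M P m)"
| "safe B M (PFor x a P) m \<longleftrightarrow>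
     aval a m \<le> M \<and> (\<forall>k < aval a m. safe B M P (count_loop x (sem P) k m))"

lemma aval_cong: "(\<And>x. x \<in> avars a \<Longrightarrow> m' x = m x) \<Longrightarrow> aval a m' = aval a m"
  by (induction a) auto

lemma store_other [simp]: "y \<noteq> x \<Longrightarrow> store x i v m y = m y"
  by (simp add: store_def)

lemma store_same [simp]: "store x i v m x = (m x)(i := v)"
  by (simp add: store_def)

lemma count_loop_other:
  assumes "\<And>m y. y \<notin> W \<Longrightarrow> f m y = m y" "y \<notin> insert x W"
  shows "count_loop x f k m y = m y"
  using assms by (induction k) auto

lemma sem_other: "y \<notin> writes P \<Longrightarrow> sem P m y = m y"
proof (induction P arbitrary: m y)
  case (PFor x a P)
  then have "count_loop x (sem P) (aval a m) m y = m y"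
    by (intro count_loop_other[where W = "writes P"]) auto
  then show ?case by simp
qed auto

lemma count_loop_counter: "count_loop x f k m x 0 = k"
  by (cases k) auto

lemma bounded_store: "bounded B m \<Longrightarrow> v \<le> B \<Longrightarrow> bounded B (store x i v m)"
  by (auto simp: bounded_def store_def)

lemma safe_bounded:
  assumes "M \<le> B" "safe B M P m" "bounded B m"
  shows "bounded B (sem P m)"
  using assms(2,3)
proof (induction P arbitrary: m)
  case (PFor x a P)
  have "k \<le> aval a m \<Longrightarrow> bounded B (count_loop x (sem P) k m)" for k
  proof (induction k)
    case 0
    show ?case using PFor.prems by (auto intro: bounded_store)
  next
    case (Suc k)
    then show ?case using PFor assms(1) by (auto intro!: bounded_store)
  qed
  then show ?case by simp
qed (auto intro: bounded_store)


section \<open>Cost of compiled programs\<close>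

text \<open>Bit length of a value in multiples of the bit length of the memory cells; products add
  up. The generous entry for a literal is harmless because the program is fixed.\<close>

primrec asize :: "aexp \<Rightarrow> nat" where
  "asize (Lit n) = Suc n"
| "asize (Read x a) = Suc (asize a)"
| "asize (AddE a b) = asize a + asize b"
| "asize (SubE a b) = asize a + asize b"
| "asize (MulE a b) = asize a + asize b"
| "asize (DivE a b) = asize a + asize b"
| "asize (ModE a b) = asize a + asize b"

primrec aweight :: "aexp \<Rightarrow> nat" where
  "aweight (Lit n) = Suc n"
| "aweight (Read x a) = aweight a + asize a + 1"
| "aweight (AddE a b) = aweight a + aweight b + asize a + asize b"
| "aweight (SubE a b) = aweight a + aweight b + asize a + asize b"
| "aweight (MulE a b) = aweight a + aweight b + asize a + asize b"
| "aweight (DivE a b) = aweight a + aweight b + asize a + asize b"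
| "aweight (ModE a b) = aweight a + aweight b + asize a + asize b"

primrec bweight :: "bexp \<Rightarrow> nat" where
  "bweight (EqE a b) = aweight a + aweight b + asize a + asize b"
| "bweight (LessE a b) = aweight a + aweight b + asize a + asize b"
| "bweight (NegE c) = bweight c + 1"
| "bweight (ConjE c d) = bweight c + bweight d + 1"

definition assign_weight :: "aexp \<Rightarrow> aexp \<Rightarrow> nat" where
  "assign_weight i a = aweight i + aweight a + asize i + asize a"

text \<open>The factor \<open>bit_length B\<close> is split off, so that only the loop bound
  \<open>M\<close> is left. This matters because \<open>B\<close> will be as large as
  \<open>2 ^ M\<close>.\<close>

primrec weight :: "prog \<Rightarrow> nat \<Rightarrow> nat" where
  "weight (PAssign x i a) M = assign_weight i a"
| "weight (PSeq P Q) M = weight P M + weight Q M"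
| "weight (PIf b P) M = bweight b + weight P M + 1"
| "weight (PFor x a P) M =
     assign_weight (Lit 0) (Lit 0) + bweight (LessE (var x) a)
     + M * (bweight (LessE (var x) a) + weight P M + assign_weight (Lit 0) (AddE (var x) (Lit 1)))"

lemma bit_length_pos: "1 \<le> bit_length n"
  by (simp add: bit_length_def)

lemma less_power_bit_length: "n < 2 ^ bit_length n"
proof -
  have "n < 2 ^ floorlog 2 n"
    by (rule floorlog_leD) auto
  also have "\<dots> \<le> 2 ^ bit_length n"
    by (rule power_increasing) (auto simp: bit_length_def)
  finally show ?thesis .
qed

lemma bit_length_le: "n < 2 ^ k \<Longrightarrow> 1 \<le> k \<Longrightarrow> bit_length n \<le> k"
  by (auto simp: bit_length_def intro: floorlog_leI)

lemma asize_pos: "1 \<le> asize a"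
  by (induction a) auto

lemma aval_less:
  assumes "bounded B m" "1 \<le> l" "B < 2 ^ l"
  shows "aval a m < 2 ^ (asize a * l)"
proof (induction a)
  case (Lit n)
  have "n < 2 ^ n" by simp
  also have "\<dots> \<le> 2 ^ (Suc n * l)" using assms(2)
    by (intro power_increasing) (auto simp: add_increasing trans_le_add2)
  finally show ?case by simp
next
  case (Read x a)
  have "m x (aval a m) < 2 ^ l" using assms by (auto simp: bounded_def intro: le_less_trans)
  also have "\<dots> \<le> 2 ^ (Suc (asize a) * l)" by (intro power_increasing) auto
  finally show ?case by simp
next
  case (AddE a b)
  define u v where "u = asize a * l" "v = asize b * l"
  have uv: "1 \<le> u" "1 \<le> v" using asize_pos[of a] asize_pos[of b] assms(2) by (auto simp: u_v_def Suc_le_eq)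
  \<comment> \<open>Two numbers that are at least 2 have a sum of at most their product; this is
    where the exponents have to be positive.\<close>
  have "(2::nat) ^ u + 2 ^ v \<le> 2 ^ (u + v)"
  proof -
    have "(2::nat) \<le> 2 ^ u" "(2::nat) \<le> 2 ^ v"
      using uv power_increasing[of 1 u "2::nat"] power_increasing[of 1 v "2::nat"] by auto
    moreover obtain c where "(2::nat) ^ u = 2 + c" using le_Suc_ex calculation(1) by blast
    moreover obtain d where "(2::nat) ^ v = 2 + d" using le_Suc_ex calculation(2) by blast
    ultimately show ?thesis by (simp add: power_add)
  qed
  then show ?case using AddE by (simp add: algebra_simps u_v_def)
next
  case (SubE a b)
  have "aval (SubE a b) m \<le> aval a m" by simp
  also have "\<dots> < 2 ^ (asize a * l)" by fact
  also have "\<dots> \<le> 2 ^ (asize (SubE a b) * l)" by (intro power_increasing) auto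
  finally show ?case .
next
  case (MulE a b)
  then have "aval a m * aval b m < 2 ^ (asize a * l) * 2 ^ (asize b * l)"
    by (intro mult_strict_mono) auto
  then show ?case by (simp add: power_add algebra_simps)
next
  case (DivE a b)
  have "aval (DivE a b) m \<le> aval a m" by simp
  also have "\<dots> < 2 ^ (asize a * l)" by fact
  also have "\<dots> \<le> 2 ^ (asize (DivE a b) * l)" by (intro power_increasing) auto
  finally show ?case .
next
  case (ModE a b)
  have "aval (ModE a b) m \<le> aval a m" by (simp add: mod_less_eq_dividend)
  also have "\<dots> < 2 ^ (asize a * l)" by fact
  also have "\<dots> \<le> 2 ^ (asize (ModE a b) * l)" by (intro power_increasing) auto
  finally show ?case .
qed

lemma bit_length_aval:
  assumes "bounded B m"
  shows "bit_length (aval a m) \<le> asize a * bit_length B"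
  using asize_pos[of a] bit_length_pos[of B]
  by (intro bit_length_le aval_less[OF assms] less_power_bit_length) (auto simp: Suc_le_eq)

lemma acost_le:
  assumes "bounded B m"
  shows "acost a m \<le> aweight a * bit_length B"
proof (induction a)
  case (Lit n)
  show ?case using bit_length_aval[OF assms, of "Lit n"] by simp
next
  case (Read x a)
  have "bit_length (aval (Read x a) m) \<le> bit_length B"
    using assms less_power_bit_length[of B] bit_length_pos[of B]
    by (intro bit_length_le) (auto simp: bounded_def intro: le_less_trans)
  then show ?case using Read bit_length_aval[OF assms, of a] by (simp add: algebra_simps)
qed (unfold acost.simps aweight.simps add_mult_distrib, intro add_mono bit_length_aval assms; assumption)+

lemma bcost_le:
  assumes "bounded B m"
  shows "bcost b m \<le> bweight b * bit_length B"
proof (induction b)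
  case (NegE b)
  then show ?case using bit_length_pos[of B] by (simp add: algebra_simps)
next
  case (ConjE b c)
  then show ?case using bit_length_pos[of B] by (simp add: algebra_simps)
next
  case (EqE x y)
  then show ?case unfolding bcost.simps bweight.simps add_mult_distrib
    by (intro add_mono bit_length_aval acost_le assms)
next
  case (LessE x y)
  then show ?case unfolding bcost.simps bweight.simps add_mult_distrib
    by (intro add_mono bit_length_aval acost_le assms)
qed

definition runs :: "com \<Rightarrow> memory \<Rightarrow> nat \<Rightarrow> memory \<Rightarrow> bool" where
  "runs c m T m' \<longleftrightarrow> (\<exists>t \<le> T. exec c m t m')"

lemma runs_mono: "runs c m T m' \<Longrightarrow> T \<le> T' \<Longrightarrow> runs c m T' m'"
  by (auto simp: runs_def intro: le_trans)

lemma runs_Assign: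
  assumes "bounded B m"
  shows "runs (Assign x i a) m (assign_weight i a * bit_length B) (store x (aval i m) (aval a m) m)"
proof -
  have "acost i m + acost a m + bit_length (aval i m) + bit_length (aval a m)
        \<le> assign_weight i a * bit_length B"
    unfolding assign_weight_def add_mult_distrib
    by (intro add_mono acost_le bit_length_aval assms)
  then show ?thesis unfolding runs_def by (blast intro: exec_Assign)
qed

lemma runs_Seq: "runs c m T m' \<Longrightarrow> runs d m' T' m'' \<Longrightarrow> runs (Seq c d) m (T + T') m''"
  unfolding runs_def by (meson add_mono exec_Seq)

lemma runs_compile:
  assumes "M \<le> B" "wf_prog P" "safe B M P m" "bounded B m"
  shows "runs (compile P) m (weight P M * bit_length B) (sem P m)"
  using assms(2-4)
proof (induction P arbitrary: m)
  case (PAssign x i a)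
  then show ?case using runs_Assign[OF PAssign(3)] by simp
next
  case (PSeq P Q)
  then show ?case
    using safe_bounded[OF assms(1), of P m] unfolding compile.simps sem.simps weight.simps add_mult_distrib
    by (intro runs_Seq) auto
next
  case (PIf b P)
  show ?case
  proof (cases "bval b m")
    case True
    then obtain t where t: "t \<le> weight P M * bit_length B" "exec (compile P) m t (sem P m)"
      using PIf unfolding runs_def by auto
    have "bcost b m + t \<le> weight (PIf b P) M * bit_length B"
      using t(1) bcost_le[OF PIf.prems(3), of b] by (simp add: algebra_simps)
    then show ?thesis using t True exec_CondTrue unfolding runs_def by fastforce
  next
    case False
    have "bcost b m + 1 \<le> weight (PIf b P) M * bit_length B"
      using bcost_le[OF PIf.prems(3), of b] bit_length_pos[of B] by (simp add: algebra_simps)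
    then show ?thesis using False exec_CondFalse[OF _ exec_Skip] unfolding runs_def by fastforce
  qed
next
  case (PFor x a P)
  let ?F = "\<lambda>k. count_loop x (sem P) k m"
  let ?l = "bit_length B"
  let ?b = "LessE (var x) a"
  let ?inc = "Assign x (Lit 0) (AddE (var x) (Lit 1))"
  let ?W = "While ?b (Seq (compile P) ?inc)"
  let ?n = "aval a m"
  define w where "w = bweight ?b + weight P M + assign_weight (Lit 0) (AddE (var x) (Lit 1))"
  have x: "x \<notin> writes P" "avars a \<inter> insert x (writes P) = {}" "wf_prog P" using PFor.prems by auto
  have n: "?n \<le> M" using PFor.prems by simp
  have av: "aval a (?F k) = ?n" for k
    using x by (intro aval_cong count_loop_other[where W = "writes P"] sem_other) auto
  have bnd: "k \<le> ?n \<Longrightarrow> bounded B (?F k)" for k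
    using safe_bounded[OF assms(1), of "PFor x a P" m] PFor.prems
  proof (induction k)
    case (Suc k)
    then show ?case using safe_bounded[OF assms(1), of P "?F k"] n assms(1)
      by (auto intro!: bounded_store)
  qed (auto intro!: bounded_store)
  \<comment> \<open>Induction on the number of rounds left, since \<open>exec\<close> builds a while
    execution backwards from its last test.\<close>
  have loop: "k \<le> ?n \<Longrightarrow> runs ?W (?F (?n - k)) ((bweight ?b + k * w) * ?l) (?F ?n)" for k
  proof (induction k)
    case 0
    have "\<not> bval ?b (?F ?n)" by (simp add: av count_loop_counter)
    then have "exec ?W (?F ?n) (bcost ?b (?F ?n)) (?F ?n)" by (rule exec_WhileFalse)
    moreover have "bcost ?b (?F ?n) \<le> bweight ?b * ?l" by (rule bcost_le[OF bnd]) simp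
    ultimately show ?case unfolding runs_def diff_zero mult_0 add_0_right by blast
  next
    case (Suc k)
    let ?j = "?n - Suc k"
    have j: "Suc ?j = ?n - k" "?j < ?n" using Suc.prems by auto
    have tr: "bval ?b (?F ?j)" using j by (simp add: av count_loop_counter)
    have sf: "safe B M P (?F ?j)" using PFor.prems j by simp
    have cnt: "sem P (?F ?j) x 0 = ?j"
      using x(1) by (simp add: sem_other count_loop_counter)
    have "runs (compile P) (?F ?j) (weight P M * ?l) (sem P (?F ?j))"
      using PFor.IH x(3) sf bnd j by simp
    moreover have "runs ?inc (sem P (?F ?j)) (assign_weight (Lit 0) (AddE (var x) (Lit 1)) * ?l)
        (store x 0 (Suc ?j) (sem P (?F ?j)))"
      using runs_Assign[OF safe_bounded[OF assms(1) sf bnd], of x "Lit 0" "AddE (var x) (Lit 1)"] j cnt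
      by simp
    ultimately have "runs (Seq (compile P) ?inc) (?F ?j)
        (weight P M * ?l + assign_weight (Lit 0) (AddE (var x) (Lit 1)) * ?l) (?F (Suc ?j))"
      unfolding count_loop.simps by (rule runs_Seq)
    then obtain t1 where t1: "exec (Seq (compile P) ?inc) (?F ?j) t1 (?F (?n - k))"
        "t1 \<le> (weight P M + assign_weight (Lit 0) (AddE (var x) (Lit 1))) * ?l"
      unfolding runs_def add_mult_distrib j(1) by blast
    obtain t2 where t2: "exec ?W (?F (?n - k)) t2 (?F ?n)" "t2 \<le> (bweight ?b + k * w) * ?l"
      using Suc unfolding runs_def by auto
    have "exec ?W (?F ?j) (bcost ?b (?F ?j) + t1 + t2) (?F ?n)"
      by (rule exec_WhileTrue[OF tr t1(1) t2(1)])
    moreover have "bcost ?b (?F ?j) + t1 + t2 \<le> (bweight ?b + Suc k * w) * ?l"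
      using t1(2) t2(2) bcost_le[OF bnd, of ?j ?b] j unfolding w_def by (simp add: algebra_simps)
    ultimately show ?case unfolding runs_def by blast
  qed
  have "runs (Assign x (Lit 0) (Lit 0)) m (assign_weight (Lit 0) (Lit 0) * ?l) (?F 0)"
    using runs_Assign[OF PFor.prems(3), of x "Lit 0" "Lit 0"] by simp
  moreover have "runs ?W (?F 0) ((bweight ?b + M * w) * ?l) (?F ?n)"
    using loop[of ?n] n by (auto elim!: runs_mono)
  ultimately have R: "runs (compile (PFor x a P)) m
      (assign_weight (Lit 0) (Lit 0) * ?l + (bweight ?b + M * w) * ?l) (?F ?n)"
    unfolding compile.simps by (rule runs_Seq)
  have W: "weight (PFor x a P) M * ?l
      = assign_weight (Lit 0) (Lit 0) * ?l + (bweight ?b + M * w) * ?l"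
    unfolding w_def weight.simps by (simp only: add_mult_distrib add.assoc)
  show ?case unfolding sem.simps W by (rule R)
qed

text \<open>A loop raises the degree by one, and nothing in the weight depends on the input except
  \<open>M\<close>.\<close>

lemma weight_poly: "\<exists>c d. \<forall>M \<ge> 1. weight P M \<le> c * M ^ d"
proof (induction P)
  case (PAssign x i a)
  show ?case by (rule exI[of _ "assign_weight i a"], rule exI[of _ 0]) simp
next
  case (PSeq P Q)
  then obtain c d c' d' where
    cd: "\<And>M. M \<ge> 1 \<Longrightarrow> weight P M \<le> c * M ^ d" "\<And>M. M \<ge> 1 \<Longrightarrow> weight Q M \<le> c' * M ^ d'" by blast
  have "weight (PSeq P Q) M \<le> (c + c') * M ^ (d + d')" if "M \<ge> 1" for M
  proof -
    have "c * M ^ d \<le> c * M ^ (d + d')" "c' * M ^ d' \<le> c' * M ^ (d + d')"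
      using that by (intro mult_left_mono power_increasing; simp)+
    then have "weight P M + weight Q M \<le> c * M ^ (d + d') + c' * M ^ (d + d')"
      using cd(1,2)[OF that] by linarith
    then show ?thesis by (simp only: weight.simps add_mult_distrib)
  qed
  then show ?case by blast
next
  case (PIf b P)
  then obtain c d where cd: "\<And>M. M \<ge> 1 \<Longrightarrow> weight P M \<le> c * M ^ d" by blast
  have "weight (PIf b P) M \<le> (bweight b + 1 + c) * M ^ d" if "M \<ge> 1" for M
  proof -
    have "(bweight b + 1) * 1 \<le> (bweight b + 1) * M ^ d"
      using that by (intro mult_left_mono) auto
    then show ?thesis using cd[OF that] by (simp add: algebra_simps)
  qed
  then show ?case by blast
next
  case (PFor x a P)
  then obtain c d where cd: "\<And>M. M \<ge> 1 \<Longrightarrow> weight P M \<le> c * M ^ d" by blast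
  define u v where "u = assign_weight (Lit 0) (Lit 0) + bweight (LessE (var x) a)"
    and "v = bweight (LessE (var x) a) + assign_weight (Lit 0) (AddE (var x) (Lit 1))"
  have "weight (PFor x a P) M \<le> (u + v + c) * M ^ Suc d" if "M \<ge> 1" for M
  proof -
    have "weight (PFor x a P) M = u + M * v + M * weight P M"
      unfolding u_def v_def weight.simps by (simp only: add_mult_distrib2 ac_simps)
    also have "\<dots> \<le> u * M ^ Suc d + M * v * M ^ d + M * (c * M ^ d)"
    proof (intro add_mono)
      have M: "1 \<le> M ^ k" for k using that by simp
      show "u \<le> u * M ^ Suc d" using mult_le_mono2[OF M, of u "Suc d"] by simp
      show "M * v \<le> M * v * M ^ d" using mult_le_mono2[OF M, of "M * v" d] by simp
      show "M * weight P M \<le> M * (c * M ^ d)" using cd[OF that] by (rule mult_le_mono2)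
    qed
    also have "\<dots> = (u + v + c) * M ^ Suc d" by (simp add: algebra_simps)
    finally show ?thesis .
  qed
  then show ?case by blast
qed

section \<open>Generalised inverses modulo an ideal\<close>

text \<open>\<open>gsum P W Q n\<close> is the sum of \<open>P ^ (n - 1 - k) * W * Q ^ k\<close> over \<open>k < n\<close>: if \<open>P ^ n = Q ^ n = 1\<close>, it is
  \<open>P ^ (n - 1)\<close> times the sum of the conjugates of \<open>W\<close>, but needs no inverses.\<close>

primrec gsum :: "'a::ring_1 \<Rightarrow> 'a \<Rightarrow> 'a \<Rightarrow> nat \<Rightarrow> 'a" where
  "gsum P W Q 0 = 0"
| "gsum P W Q (Suc n) = P * gsum P W Q n + W * Q ^ n"

text \<open>The basis of repeated doubling: for \<open>m = n\<close> it produces the sum of length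
  \<open>2 * n\<close> from the one of length \<open>n\<close> and two powers.\<close>

lemma gsum_add: "gsum P W Q (m + n) = P ^ n * gsum P W Q m + gsum P W Q n * Q ^ m"
  by (induction n) (simp_all add: algebra_simps power_add power_commutes)

text \<open>The sum telescopes: multiplying by \<open>P\<close> on the left or by \<open>Q\<close>
  on the right gives the same terms except at the two ends, and the ends cancel once
  \<open>P ^ n\<close> and \<open>Q ^ n\<close> are 1.\<close>

lemma gsum_commutator: "P * gsum P W Q n - gsum P W Q n * Q = P ^ n * W - W * Q ^ n"
proof (induction n)
  case (Suc n)
  have "P * gsum P W Q (Suc n) - gsum P W Q (Suc n) * Q
      = P * (P * gsum P W Q n - gsum P W Q n * Q) + P * W * Q ^ n - W * Q ^ Suc n"
    by (simp add: algebra_simps power_commutes)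
  also have "\<dots> = P ^ Suc n * W - W * Q ^ Suc n"
    unfolding Suc by (simp add: algebra_simps)
  finally show ?case .
qed simp

lemma gsum_sum: "gsum P (\<Sum>i\<in>A. W i) Q n = (\<Sum>i\<in>A. gsum P (W i) Q n)"
  by (induction n) (simp_all add: sum_distrib_left sum_distrib_right sum.distrib)

lemma gsum_of_int_mult: "gsum P (of_int c * W) Q n = of_int c * gsum P W Q n"
proof (induction n)
  case (Suc n)
  have "P * (of_int c * gsum P W Q n) = of_int c * (P * gsum P W Q n)"
    by (metis mult.assoc mult_of_int_commute)
  then show ?case by (simp add: Suc distrib_left mult.assoc)
qed simp

text \<open>The ambient type is a ring, so ring identities hold unconditionally and only membership
  in \<open>S\<close> has to be tracked. The two instances below share \<open>S\<close> and differ
  in the ideal.\<close>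

locale subring_ideal =
  fixes S I :: "'a::ring_1 set"
  assumes one_closed [simp, intro]: "1 \<in> S"
    and diff_closed [intro]: "a \<in> S \<Longrightarrow> b \<in> S \<Longrightarrow> a - b \<in> S"
    and mult_closed [intro]: "a \<in> S \<Longrightarrow> b \<in> S \<Longrightarrow> a * b \<in> S"
    and ideal_subset: "I \<subseteq> S"
    and ideal_zero [simp, intro]: "0 \<in> I"
    and ideal_diff [intro]: "a \<in> I \<Longrightarrow> b \<in> I \<Longrightarrow> a - b \<in> I"
    and ideal_left [intro]: "s \<in> S \<Longrightarrow> a \<in> I \<Longrightarrow> s * a \<in> I"
    and ideal_right [intro]: "a \<in> I \<Longrightarrow> s \<in> S \<Longrightarrow> a * s \<in> I"
begin

lemma zero_closed [simp, intro]: "0 \<in> S"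
  using diff_closed[OF one_closed one_closed] by simp

lemma uminus_closed [intro]: "a \<in> S \<Longrightarrow> - a \<in> S"
  using diff_closed[OF zero_closed] by fastforce

lemma add_closed [intro]: "a \<in> S \<Longrightarrow> b \<in> S \<Longrightarrow> a + b \<in> S"
  using diff_closed[OF _ uminus_closed] by fastforce

lemma power_closed [intro]: "a \<in> S \<Longrightarrow> a ^ n \<in> S"
  by (induction n) auto

lemma gsum_closed [intro]: "P \<in> S \<Longrightarrow> W \<in> S \<Longrightarrow> Q \<in> S \<Longrightarrow> gsum P W Q n \<in> S"
  by (induction n) auto

lemma of_nat_closed [intro]: "of_nat n \<in> S"
  by (induction n) auto

lemma of_int_closed [intro]: "of_int n \<in> S"
  by (cases n) (auto simp del: of_nat_Suc)

lemma ideal_uminus [intro]: "a \<in> I \<Longrightarrow> - a \<in> I"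
  using ideal_diff[OF ideal_zero] by fastforce

lemma ideal_add [intro]: "a \<in> I \<Longrightarrow> b \<in> I \<Longrightarrow> a + b \<in> I"
  using ideal_diff[OF _ ideal_uminus] by fastforce

lemma ideal_sum: "(\<And>i. i \<in> A \<Longrightarrow> f i \<in> I) \<Longrightarrow> sum f A \<in> I"
  by (induction A rule: infinite_finite_induct) auto

lemma sum_closed: "(\<And>i. i \<in> A \<Longrightarrow> f i \<in> S) \<Longrightarrow> sum f A \<in> S"
  by (induction A rule: infinite_finite_induct) auto

lemma ideal_closed: "a \<in> I \<Longrightarrow> a \<in> S"
  using ideal_subset by blast

definition cong :: "'a \<Rightarrow> 'a \<Rightarrow> bool" (infix "\<simeq>" 50) where
  "a \<simeq> b \<longleftrightarrow> a - b \<in> I"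

lemma cong_refl [simp, intro]: "a \<simeq> a"
  by (simp add: cong_def)

lemma cong_sym: "a \<simeq> b \<Longrightarrow> b \<simeq> a"
  unfolding cong_def using ideal_uminus by fastforce

lemma cong_trans [trans]: "a \<simeq> b \<Longrightarrow> b \<simeq> c \<Longrightarrow> a \<simeq> c"
  unfolding cong_def using ideal_add[of "a - b" "b - c"] by simp

lemma cong_add: "a \<simeq> a' \<Longrightarrow> b \<simeq> b' \<Longrightarrow> a + b \<simeq> a' + b'"
  unfolding cong_def using ideal_add[of "a - a'" "b - b'"] by (simp add: algebra_simps)

lemma cong_diff: "a \<simeq> a' \<Longrightarrow> b \<simeq> b' \<Longrightarrow> a - b \<simeq> a' - b'"
  unfolding cong_def using ideal_diff[of "a - a'" "b - b'"] by (simp add: algebra_simps)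

lemma cong_left: "a \<simeq> b \<Longrightarrow> s \<in> S \<Longrightarrow> s * a \<simeq> s * b"
  unfolding cong_def using ideal_left[of s "a - b"] by (simp add: algebra_simps)

lemma cong_right: "a \<simeq> b \<Longrightarrow> s \<in> S \<Longrightarrow> a * s \<simeq> b * s"
  unfolding cong_def using ideal_right[of "a - b" s] by (simp add: algebra_simps)

lemma cong_mult: "a \<simeq> a' \<Longrightarrow> b \<simeq> b' \<Longrightarrow> a' \<in> S \<Longrightarrow> b \<in> S \<Longrightarrow> a * b \<simeq> a' * b'"
  by (rule cong_trans[OF cong_right cong_left])

lemma cong_closed: "a \<simeq> b \<Longrightarrow> b \<in> S \<Longrightarrow> a \<in> S"
  unfolding cong_def using add_closed[OF ideal_closed, of "a - b" b] by simp

lemma cong_ideal: "a \<simeq> b \<Longrightarrow> b \<in> I \<Longrightarrow> a \<in> I"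
  unfolding cong_def using ideal_add[of "a - b" b] by simp

lemma commute_power:
  assumes "P \<in> S" "Q \<in> S" "W \<in> S" "P * W \<simeq> W * Q"
  shows "P ^ n * W \<simeq> W * Q ^ n"
proof (induction n)
  case (Suc n)
  have "P ^ Suc n * W = P * (P ^ n * W)" by (simp add: mult.assoc)
  also have "\<dots> \<simeq> P * (W * Q ^ n)" using Suc assms by (intro cong_left)
  also have "P * (W * Q ^ n) = P * W * Q ^ n" by (simp add: mult.assoc)
  also have "\<dots> \<simeq> W * Q * Q ^ n" using assms by (intro cong_right power_closed)
  finally show ?case by (simp add: mult.assoc)
qed simp

lemma gsum_commute:
  assumes "P \<in> S" "Q \<in> S" "W \<in> S" "P ^ N \<simeq> 1" "Q ^ N \<simeq> 1"
  shows "P * gsum P W Q N \<simeq> gsum P W Q N * Q"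
proof -
  have "P ^ N * W - W * Q ^ N = (P ^ N - 1) * W - W * (Q ^ N - 1)" by (simp add: algebra_simps)
  then show ?thesis using assms unfolding cong_def gsum_commutator by auto
qed

text \<open>In every summand the powers of \<open>Q\<close> can be moved to the left of
  \<open>W\<close>, which leaves \<open>P ^ (n - 1) * W\<close> each time. The extra
  \<open>P\<close> completes the exponent to \<open>n\<close>; with \<open>P ^ n = 1\<close> and
  \<open>n\<close> congruent to 1 modulo \<open>p\<close>, averaging therefore gives back
  \<open>W\<close> modulo the radical.\<close>

lemma gsum_intertwiner:
  assumes "P \<in> S" "Q \<in> S" "W \<in> S" "P * W \<simeq> W * Q"
  shows "P * gsum P W Q n \<simeq> of_nat n * (P ^ n * W)"
proof (induction n)
  case (Suc n)
  have "P * gsum P W Q (Suc n) = P * (P * gsum P W Q n) + P * (W * Q ^ n)"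
    by (simp add: algebra_simps)
  also have "\<dots> \<simeq> P * (of_nat n * (P ^ n * W)) + P * (P ^ n * W)"
    using Suc assms commute_power[THEN cong_sym] by (intro cong_add cong_left)
  also have "P * (of_nat n * (P ^ n * W)) + P * (P ^ n * W) = of_nat (Suc n) * (P ^ Suc n * W)"
    using mult_of_nat_commute[of n P] by (simp add: algebra_simps flip: mult.assoc)
  finally show ?case .
qed simp

lemma gsum_cong:
  assumes "P \<in> S" "Q \<in> S" "W \<simeq> W'"
  shows "gsum P W Q n \<simeq> gsum P W' Q n"
  using assms by (induction n) (auto intro!: cong_add cong_left cong_right)

text \<open>An intertwiner \<open>y\<close> can be pulled through the powers on both sides. Hence
  averaging a generalised inverse \<open>v\<close> of \<open>y\<close> and multiplying by
  \<open>y\<close> on both sides is the same as averaging \<open>y * v * y\<close>, that is,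
  \<open>y\<close> itself.\<close>

lemma gsum_sandwich:
  assumes "y \<in> S" "v \<in> S" "P \<in> S" "Q \<in> S" "P * y \<simeq> y * Q"
  shows "y * gsum Q v P n * y \<simeq> gsum P (y * v * y) Q n"
proof (induction n)
  case (Suc n)
  have "y * gsum Q v P (Suc n) * y = (y * Q) * (gsum Q v P n * y) + y * v * (P ^ n * y)"
    by (simp add: algebra_simps)
  also have "\<dots> \<simeq> (P * y) * (gsum Q v P n * y) + y * v * (y * Q ^ n)"
    using assms by (intro cong_add cong_left cong_right cong_sym[OF assms(5)] commute_power) auto
  also have "\<dots> = P * (y * gsum Q v P n * y) + (y * v * y) * Q ^ n"
    by (simp add: algebra_simps)
  also have "\<dots> \<simeq> gsum P (y * v * y) Q (Suc n)"
    unfolding gsum.simps using assms Suc by (intro cong_add cong_left cong_refl)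
  finally show ?case .
qed simp

text \<open>Since \<open>f * x\<close> and \<open>x * e\<close> vanish modulo the ideal, \<open>y\<close> lives on the kernel and the
  cokernel of \<open>x\<close>, so that the generalised inverses of \<open>x\<close> and \<open>y\<close> add up.\<close>

lemma geninv_extend:
  assumes S: "x \<in> S" "z \<in> S" "y0 \<in> S" "w0 \<in> S"
    and x: "x * z * x - x \<in> I"
    and e: "e = 1 - z * x" and f: "f = 1 - x * z"
    and y: "y = f * y0 * e" and w: "w = e * w0 * f" and yw: "y * w * y - y \<in> I"
    and x': "x' = x + y" and z': "z' = z * x * z + w"
    and e': "e' = 1 - z' * x'" and f': "f' = 1 - x' * z'"
  shows "x' * z' * x' - x' \<in> I"
    and "\<And>v. v \<in> S \<Longrightarrow> f * v * e \<in> I \<Longrightarrow> f' * v * e' \<in> I"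
    and "f' * y0 * e' \<in> I"
proof -
  define d where "d = x * z * x - x"
  have d: "d \<in> I" "d \<in> S" using x ideal_closed unfolding d_def by auto
  have ef: "e \<in> S" "f \<in> S" using S e f by auto
  have yS: "y \<in> S" "w \<in> S" using S ef y w by auto
  have xzx: "x * z * x = x + d" by (simp add: d_def)
  have fx: "f * x = - d" by (simp add: f d_def algebra_simps)
  have xe: "x * e = - d" by (simp add: e d_def algebra_simps)
  have zf: "x * z * f = - (d * z)" by (simp add: f d_def algebra_simps)
  \<comment> \<open>This and \<open>ezxz\<close> are the reason for starting \<open>z'\<close> with
    \<open>z * x * z\<close> instead of \<open>z\<close>: its products with \<open>f\<close> on the
    right and \<open>e\<close> on the left vanish modulo the ideal, so that no cross terms between
    the old and the new pair survive.\<close>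
  have zxzf: "z * x * z * f = - (z * d * z)" by (simp add: f d_def algebra_simps)
  have ezxz: "e * z * x * z = - (z * d * z)" by (simp add: e d_def algebra_simps)
  have A: "z * x * z * y = - (z * d * z * y0 * e)"
    unfolding y by (metis zxzf mult.assoc minus_mult_left)
  have B: "w * x = - (e * w0 * d)"
    unfolding w by (metis fx mult.assoc minus_mult_right)
  have C: "w * y = e * w0 * f * y" by (simp add: w)
  have D: "z * x * z * x = z * x + z * d"
    by (metis xzx mult.assoc distrib_left)
  have "e' = 1 - (z * x * z * x + z * x * z * y + w * x + w * y)"
    by (simp add: e' x' z' algebra_simps)
  then have "e' - e * (1 - w0 * f * y) = z * d * z * y0 * e + e * w0 * d - z * d"
    unfolding A B C D by (simp add: e algebra_simps)
  \<comment> \<open>The new \<open>e'\<close> begins with \<open>e\<close> and the new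
    \<open>f'\<close> will end with \<open>f\<close>; so \<open>f' * v * e'\<close> inherits the
    vanishing of \<open>f * v * e\<close>.\<close>
  then have e'c: "e' \<simeq> e * (1 - w0 * f * y)" using S ef d
    by (simp add: cong_def mult.assoc ideal_left ideal_right ideal_add ideal_diff mult_closed)
  have A': "y * (z * x * z) = - (f * y0 * (z * d * z))"
    unfolding y using ezxz by (metis mult.assoc minus_mult_right)
  have B': "x * w = - (d * w0 * f)"
    unfolding w by (metis xe mult.assoc minus_mult_left)
  have C': "y * w = y * e * w0 * f" by (simp add: w mult.assoc)
  have D': "x * (z * x * z) = x * z + d * z"
    by (metis xzx mult.assoc distrib_right)
  have "f' = 1 - (x * (z * x * z) + x * w + y * (z * x * z) + y * w)"
    by (simp add: f' x' z' algebra_simps)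
  then have "f' - (1 - y * e * w0) * f = f * y0 * (z * d * z) + d * w0 * f - d * z"
    unfolding A' B' C' D' by (simp add: f algebra_simps)
  then have f'c: "f' \<simeq> (1 - y * e * w0) * f" using S ef d
    by (simp add: cong_def mult.assoc ideal_left ideal_right ideal_add ideal_diff mult_closed)
  have S': "1 - y * e * w0 \<in> S" "1 - w0 * f * y \<in> S" using S ef yS by auto
  have "f * y - y = - (x * z * f * y0 * e)" by (simp add: f y algebra_simps)
  also have "\<dots> = d * z * y0 * e" unfolding zf by simp
  finally have fy: "f * y \<simeq> y" using S ef d
    by (simp add: cong_def mult.assoc ideal_left ideal_right mult_closed)
  \<comment> \<open>Up to the small term \<open>f * y - y\<close> this is the defect of
    \<open>w\<close> as a generalised inverse of \<open>y\<close>. It yields both the generalised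
    inverse property of \<open>z'\<close> and the vanishing for \<open>y0\<close> itself.\<close>
  have "(1 - y * e * w0) * y = y - y * w * y + y * e * w0 * (f * y - y)"
    by (simp add: w algebra_simps)
  also have "\<dots> = y * e * w0 * (f * y - y) - (y * w * y - y)" by simp
  also have "\<dots> \<in> I" using yw fy S ef yS
    by (simp add: cong_def ideal_left ideal_diff mult_closed)
  finally have ann: "(1 - y * e * w0) * y \<in> I" .
  have e'S: "e' \<in> S" "f' \<in> S" "x' \<in> S" using S ef yS
    by (simp_all add: e' f' x' z' diff_closed add_closed mult_closed)
  have "f' * x' \<simeq> (1 - y * e * w0) * f * x'" using f'c e'S by (intro cong_right)
  also have "(1 - y * e * w0) * f * x' = (1 - y * e * w0) * (f * y) - (1 - y * e * w0) * d"
    using fx by (simp add: x' mult.assoc distrib_left)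
  also have "\<dots> \<simeq> (1 - y * e * w0) * y - 0"
    using S' d fy by (intro cong_diff cong_left) (auto simp: cong_def)
  finally have "f' * x' \<in> I" using ann by (auto intro: cong_ideal)
  then show "x' * z' * x' - x' \<in> I" using ideal_uminus[of "f' * x'"] by (simp add: f' algebra_simps)
  have fve: "f' * v * e' \<simeq> (1 - y * e * w0) * (f * v * e) * (1 - w0 * f * y)" if "v \<in> S" for v
  proof -
    have "f' * v * e' \<simeq> ((1 - y * e * w0) * f) * v * (e * (1 - w0 * f * y))"
      using f'c e'c e'S S' ef that by (intro cong_mult cong_refl) auto
    then show ?thesis by (simp add: mult.assoc)
  qed
  show "f' * v * e' \<in> I" if "v \<in> S" "f * v * e \<in> I" for v
    using fve[OF that(1)] that(2) S' by (blast intro: cong_ideal)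
  show "f' * y0 * e' \<in> I"
    using fve[OF S(3)] ann S' unfolding y[symmetric] by (blast intro: cong_ideal)
qed

text \<open>Classically, \<open>e\<close> and \<open>f\<close> project onto kernel and cokernel of
  \<open>x\<close>; the vanishing says that these share no simple constituent, while the isomorphism
  \<open>Phi\<close> forces them to have the same ones, so both are zero. A pigeonhole argument on
  powers replaces the counting of constituents and asks for the vanishing only on the composites
  \<open>Phi * (z * Phi) ^ j\<close>.\<close>

lemma geninv_complete:
  assumes S: "x \<in> S" "z \<in> S" "Phi \<in> S" "Psi \<in> S"
    and x: "x * z * x - x \<in> I" and Psi: "Psi * Phi \<simeq> 1"
    and e: "e = 1 - z * x" and f: "f = 1 - x * z"
    and vanish: "\<And>j. f * (Phi * (z * Phi) ^ j) * e \<in> I"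
    and finite_quotient: "\<And>g :: nat \<Rightarrow> 'a. (\<And>i. g i \<in> S) \<Longrightarrow> \<exists>i j. i < j \<and> g i \<simeq> g j"
  shows "e \<in> I"
proof -
  define X Z where "X = Psi * x" and "Z = z * Phi"
  have XZ: "X \<in> S" "Z \<in> S" using S by (auto simp: X_def Z_def)
  have ef: "e \<in> S" "f \<in> S" using S e f by auto
  have unit: "e \<simeq> X ^ j * Z ^ j * e" for j
  proof (induction j)
    case (Suc j)
    \<comment> \<open>Carried over by \<open>Phi\<close>, the defect \<open>f\<close> becomes
      \<open>1 - X * Z\<close>. So the vanishing hypothesis for \<open>j\<close> lets
      \<open>X * Z\<close> be inserted in front of \<open>Z ^ j * e\<close>.\<close>
    have "Psi * f * Phi \<simeq> 1 - X * Z"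
    proof -
      have "Psi * f * Phi - (1 - X * Z) = Psi * Phi - 1" by (simp add: f X_def Z_def algebra_simps)
      then show ?thesis using Psi unfolding cong_def by (simp only:)
    qed
    then have "(1 - X * Z) * (Z ^ j * e) \<simeq> Psi * f * Phi * (Z ^ j * e)"
      by (rule cong_right[OF cong_sym]) (use XZ ef in auto)
    moreover have "Psi * f * Phi * (Z ^ j * e) = Psi * (f * (Phi * Z ^ j) * e)" by (simp add: mult.assoc)
    ultimately have "(1 - X * Z) * (Z ^ j * e) \<in> I"
      using vanish[of j] S unfolding Z_def by (auto intro: cong_ideal)
    then have "Z ^ j * e \<simeq> X * Z * (Z ^ j * e)" by (simp add: cong_def algebra_simps)
    then have "X ^ j * (Z ^ j * e) \<simeq> X ^ j * (X * Z * (Z ^ j * e))" using XZ by (intro cong_left power_closed)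
    moreover have "X ^ j * (X * Z * (Z ^ j * e)) = X ^ Suc j * (Z ^ Suc j * e)"
      unfolding power_Suc2[of X] by (simp add: mult.assoc)
    ultimately have "X ^ j * (Z ^ j * e) \<simeq> X ^ Suc j * (Z ^ Suc j * e)" by (simp only:)
    with Suc[unfolded mult.assoc] have "e \<simeq> X ^ Suc j * (Z ^ Suc j * e)" by (rule cong_trans)
    then show ?case by (simp only: mult.assoc)
  qed simp
  \<comment> \<open>Replace the outer \<open>X ^ a\<close> by \<open>X ^ b\<close> with
    \<open>b > a\<close> and fold \<open>X ^ a * Z ^ a * e\<close> back to \<open>e\<close>: at
    least one factor \<open>X\<close> is left over, and \<open>X * e\<close> is in the
    ideal.\<close>
  obtain a b where ab: "a < b" "X ^ a \<simeq> X ^ b"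
    using finite_quotient[of "\<lambda>i. X ^ i"] XZ by auto
  obtain c where c: "b = Suc c + a" using ab(1) less_imp_Suc_add by (metis add.commute add_Suc_right)
  have "e \<simeq> X ^ a * (Z ^ a * e)" using unit[of a] by (simp add: mult.assoc)
  also have "\<dots> \<simeq> X ^ b * (Z ^ a * e)" using ab(2) XZ ef by (intro cong_right) auto
  also have "X ^ b * (Z ^ a * e) = X ^ Suc c * (X ^ a * Z ^ a * e)"
    unfolding c power_add by (simp add: mult.assoc)
  also have "\<dots> \<simeq> X ^ Suc c * e" 
    by (rule cong_left[OF cong_sym[OF unit[of a]]]) (use XZ in auto)
  also have "X ^ Suc c * e = X ^ c * Psi * (x * e)" by (simp add: X_def power_Suc2 mult.assoc del: power_Suc)
  finally have "e \<simeq> X ^ c * Psi * (x * e)" .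
  moreover have "x * e \<in> I" using ideal_uminus[OF x] by (simp add: e algebra_simps)
  ultimately show ?thesis using XZ S by (blast intro: cong_ideal)
qed

end

section \<open>Row-finite integer matrices\<close>

text \<open>With an infinite index set the matrices of all sizes live in one type of class
  \<open>ring_1\<close>. Finite rows keep the sums in a product finite, and the identity is among
  these matrices.\<close>

typedef rfmat = "{f :: nat \<Rightarrow> nat \<Rightarrow> int. \<forall>i. finite {j. f i j \<noteq> 0}}"
  morphisms ent Rfmat
  by (rule exI[of _ "\<lambda>_ _. 0"]) simp

lemma finite_row: "finite {j. ent f i j \<noteq> 0}"
  using ent[of f] by simp

lemma rfmat_eqI: "(\<And>i j. ent f i j = ent g i j) \<Longrightarrow> f = g"
  by (metis ent_inject ext)

lemma ent_Rfmat: "(\<And>i. finite {j. f i j \<noteq> 0}) \<Longrightarrow> ent (Rfmat f) = f"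
  by (simp add: Rfmat_inverse)

instantiation rfmat :: ring_1
begin

definition "0 = Rfmat (\<lambda>_ _. 0)"
definition "1 = Rfmat (\<lambda>i j. if i = j then 1 else 0)"
definition "f + g = Rfmat (\<lambda>i j. ent f i j + ent g i j)"
definition "f - g = Rfmat (\<lambda>i j. ent f i j - ent g i j)"
definition "- f = Rfmat (\<lambda>i j. - ent f i j)"
definition "f * g = Rfmat (\<lambda>i j. \<Sum>k | ent f i k \<noteq> 0. ent f i k * ent g k j)"

lemma ent_zero [simp]: "ent 0 i j = 0"
  unfolding zero_rfmat_def by (subst ent_Rfmat) auto

lemma ent_one [simp]: "ent 1 i j = (if i = j then 1 else 0)"
  unfolding one_rfmat_def by (subst ent_Rfmat) auto

lemma ent_add [simp]: "ent (f + g) i j = ent f i j + ent g i j"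
  unfolding plus_rfmat_def
proof (subst ent_Rfmat)
  show "finite {j. ent f i j + ent g i j \<noteq> 0}" for i
    by (rule finite_subset[OF _ finite_UnI[OF finite_row finite_row], of _ f i g i]) auto
qed simp

lemma ent_diff [simp]: "ent (f - g) i j = ent f i j - ent g i j"
  unfolding minus_rfmat_def
proof (subst ent_Rfmat)
  show "finite {j. ent f i j - ent g i j \<noteq> 0}" for i
    by (rule finite_subset[OF _ finite_UnI[OF finite_row finite_row], of _ f i g i]) auto
qed simp

lemma ent_uminus [simp]: "ent (- f) i j = - ent f i j"
  unfolding uminus_rfmat_def by (subst ent_Rfmat) (use finite_row in auto)

lemma ent_times: "ent (f * g) i j = (\<Sum>k | ent f i k \<noteq> 0. ent f i k * ent g k j)"
  unfolding times_rfmat_def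
proof (subst ent_Rfmat)
  fix i
  have "{j. (\<Sum>k | ent f i k \<noteq> 0. ent f i k * ent g k j) \<noteq> 0}
      \<subseteq> (\<Union>k \<in> {k. ent f i k \<noteq> 0}. {j. ent g k j \<noteq> 0})"
    by (auto elim!: sum.not_neutral_contains_not_neutral)
  then show "finite {j. (\<Sum>k | ent f i k \<noteq> 0. ent f i k * ent g k j) \<noteq> 0}"
    by (rule finite_subset) (use finite_row in auto)
qed simp

lemma ent_times_superset:
  assumes "finite A" "{k. ent f i k \<noteq> 0} \<subseteq> A"
  shows "ent (f * g) i j = (\<Sum>k\<in>A. ent f i k * ent g k j)"
  unfolding ent_times using assms by (intro sum.mono_neutral_left) auto

instance
proof
  fix f g h :: rfmat
  show "f * g * h = f * (g * h)"
  proof (rule rfmat_eqI)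
    fix i l
    let ?F = "{j. ent f i j \<noteq> 0}"
    define A where "A = (\<Union>j \<in> ?F. {k. ent g j k \<noteq> 0})"
    have A: "finite A" unfolding A_def using finite_row by auto
    have "{k. ent (f * g) i k \<noteq> 0} \<subseteq> A"
      unfolding ent_times A_def by (auto elim!: sum.not_neutral_contains_not_neutral)
    then have "ent (f * g * h) i l = (\<Sum>k\<in>A. \<Sum>j\<in>?F. ent f i j * ent g j k * ent h k l)"
      by (simp add: ent_times_superset[OF A] ent_times[of f g] sum_distrib_right)
    also have "\<dots> = (\<Sum>j\<in>?F. \<Sum>k\<in>A. ent f i j * (ent g j k * ent h k l))"
      by (subst sum.swap) (simp add: mult.assoc)
    also have "\<dots> = (\<Sum>j\<in>?F. ent f i j * ent (g * h) j l)"
    proof (rule sum.cong[OF refl])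
      fix j assume "j \<in> ?F"
      then have "{k. ent g j k \<noteq> 0} \<subseteq> A" by (auto simp: A_def)
      then show "(\<Sum>k\<in>A. ent f i j * (ent g j k * ent h k l)) = ent f i j * ent (g * h) j l"
        by (simp add: ent_times_superset[OF A] sum_distrib_left)
    qed
    finally show "ent (f * g * h) i l = ent (f * (g * h)) i l" by (simp add: ent_times)
  qed
  show "1 * f = f" by (rule rfmat_eqI, subst ent_times_superset[of "{i}" for i]) auto
  show "f * 1 = f"
    by (rule rfmat_eqI) (simp add: ent_times if_distrib finite_row cong: if_cong)
  show "(f + g) * h = f * h + g * h"
  proof (rule rfmat_eqI)
    fix i j
    define A where "A = {k. ent f i k \<noteq> 0} \<union> {k. ent g i k \<noteq> 0}"
    have "finite A" unfolding A_def using finite_row by auto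
    then show "ent ((f + g) * h) i j = ent (f * h + g * h) i j"
      by (simp add: ent_times_superset[of A] A_def subset_eq distrib_right sum.distrib)
  qed
  show "f * (g + h) = f * g + f * h"
    by (rule rfmat_eqI) (simp add: ent_times distrib_left sum.distrib)
  show "(0::rfmat) \<noteq> 1"
  proof
    assume "(0::rfmat) = 1"
    then have "ent 0 0 0 = ent 1 0 0" by simp
    then show False by simp
  qed
qed (auto intro: rfmat_eqI)

end

lemma ent_sum: "ent (\<Sum>a\<in>A. f a) i j = (\<Sum>a\<in>A. ent (f a) i j)"
  by (induction A rule: infinite_finite_induct) auto

lemma ent_of_nat: "ent (of_nat n) i j = (if i = j then int n else 0)"
  by (induction n) auto

lemma ent_of_int: "ent (of_int n) i j = (if i = j then n else 0)"
  by (cases n) (auto simp: ent_of_nat simp del: of_nat_Suc)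

lemma ent_of_int_times: "ent (of_int n * f) i j = n * ent f i j"
  by (subst ent_times_superset[of "{i}"]) (auto simp: ent_of_int)

definition elem_mat :: "nat \<Rightarrow> nat \<Rightarrow> rfmat" where
  "elem_mat a b = Rfmat (\<lambda>i j. if i = a \<and> j = b then 1 else 0)"

lemma ent_elem_mat: "ent (elem_mat a b) i j = (if i = a \<and> j = b then 1 else 0)"
  unfolding elem_mat_def by (subst ent_Rfmat) auto

lemma ent_times_elem_mat: "ent (f * elem_mat a b) i j = (if j = b then ent f i a else 0)"
  by (simp add: ent_times ent_elem_mat if_distrib finite_row cong: if_cong)

definition corner :: "nat \<Rightarrow> int mat \<Rightarrow> rfmat" where
  "corner s U = Rfmat (\<lambda>i j. if i < s \<and> j < s then U $$ (i, j) else 0)"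

lemma ent_corner: "ent (corner s U) i j = (if i < s \<and> j < s then U $$ (i, j) else 0)"
  unfolding corner_def
proof (subst ent_Rfmat)
  show "finite {j. (if i < s \<and> j < s then U $$ (i, j) else 0) \<noteq> 0}" for i
    by (rule finite_subset[of _ "{..<s}"]) auto
qed simp

section \<open>The endomorphism ring and its radical\<close>

text \<open>The family of exponents is extended by zeros, so that \<open>A\<close> becomes an infinite product
  with trivial factors from \<open>s\<close> on.  Then \<open>End A\<close> is the quotient \<open>hom_ring / null_ideal\<close>, and
  \<open>rad_ideal / null_ideal\<close> is its Jacobson radical.\<close>

locale prime_exponents =
  fixes p :: nat and es :: "nat list"
  assumes valid: "valid_type p es"
begin

definition s :: nat where "s = length es"

definition ex :: "nat \<Rightarrow> nat" where "ex i = (if i < s then es ! i else 0)"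

abbreviation pp :: "nat \<Rightarrow> int" where "pp k \<equiv> int p ^ k"

text \<open>The divisibility is exactly what makes multiplication by the entry a well-defined
  homomorphism from the factor of order \<open>p ^ ex j\<close> to the one of order
  \<open>p ^ ex i\<close>. The subtraction is truncated: nothing is required when
  \<open>ex i <= ex j\<close>.\<close>

definition hom_ring :: "rfmat set" where
  "hom_ring = {f. \<forall>i j. pp (ex i - ex j) dvd ent f i j}"

definition null_ideal :: "rfmat set" where
  "null_ideal = {f. \<forall>i j. pp (ex i) dvd ent f i j}"

text \<open>Entries between different exponents are left free: for \<open>ex j < ex i\<close> they
  are divisible by \<open>p\<close> anyway, and the others lie strictly on one side of the diagonal
  blocks. \<open>0 < ex i\<close> exempts the padding from \<open>s\<close> on.\<close>

definition rad_ideal :: "rfmat set" where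
  "rad_ideal = {f \<in> hom_ring. \<forall>i j. ex i = ex j \<longrightarrow> 0 < ex i \<longrightarrow> int p dvd ent f i j}"

lemma prime_p: "prime p" and p_gt_1: "1 < p" and s_pos: "0 < s"
  using valid prime_gt_1_nat unfolding valid_type_def s_def by auto

lemma ex_pos: "i < s \<Longrightarrow> 0 < ex i"
  using valid unfolding valid_type_def s_def ex_def by auto

lemma ex_zero: "s \<le> i \<Longrightarrow> ex i = 0"
  by (simp add: ex_def)

lemma ex_pos_iff: "0 < ex i \<longleftrightarrow> i < s"
  using ex_pos ex_zero by (metis not_le less_numeral_extra(3))

lemma ex_mono: "i \<le> j \<Longrightarrow> j < s \<Longrightarrow> ex i \<le> ex j"
  using valid unfolding valid_type_def s_def ex_def by (auto simp: sorted_iff_nth_mono)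

lemma pp_dvd_mono: "k \<le> l \<Longrightarrow> pp k dvd pp l"
  by (rule le_imp_power_dvd)

lemma pp_dvd_mult:
  assumes "k \<le> l + m" "pp l dvd a" "pp m dvd b"
  shows "pp k dvd a * b"
proof -
  from assms have "pp k dvd pp l * pp m" "pp l * pp m dvd a * b"
    using pp_dvd_mono[of k "l + m"] by (simp_all add: power_add mult_dvd_mono)
  then show ?thesis by (rule dvd_trans)
qed

lemma p_dvd_pp: "0 < k \<Longrightarrow> pp k dvd a \<Longrightarrow> int p dvd a"
  by (rule dvd_trans[OF dvd_power]) auto

lemma hom_ringD: "f \<in> hom_ring \<Longrightarrow> pp (ex i - ex j) dvd ent f i j"
  by (simp add: hom_ring_def)

lemma hom_ring_less: "f \<in> hom_ring \<Longrightarrow> ex j < ex i \<Longrightarrow> int p dvd ent f i j"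
  using p_dvd_pp[of "ex i - ex j"] hom_ringD by simp

lemma null_subset_hom: "null_ideal \<subseteq> hom_ring"
  unfolding null_ideal_def hom_ring_def
  by (intro Collect_mono impI allI) (erule allE, erule allE, erule dvd_trans[OF pp_dvd_mono[OF diff_le_self]])

lemma hom_times:
  assumes "f \<in> hom_ring" "g \<in> hom_ring"
  shows "f * g \<in> hom_ring"
  unfolding hom_ring_def mem_Collect_eq ent_times
proof (intro allI dvd_sum)
  fix i j k
  show "pp (ex i - ex j) dvd ent f i k * ent g k j"
    using pp_dvd_mult[OF _ hom_ringD[OF assms(1)] hom_ringD[OF assms(2)], of "ex i - ex j" i k k j]
    by simp
qed

sublocale null: subring_ideal hom_ring null_ideal
proof
  show "1 \<in> hom_ring" by (auto simp: hom_ring_def)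
  show "a - b \<in> hom_ring" if "a \<in> hom_ring" "b \<in> hom_ring" for a b
    using that by (simp add: hom_ring_def)
  show "null_ideal \<subseteq> hom_ring" by (rule null_subset_hom)
  show "a - b \<in> null_ideal" if "a \<in> null_ideal" "b \<in> null_ideal" for a b
    using that by (simp add: null_ideal_def)
  show "f * a \<in> null_ideal" if f: "f \<in> hom_ring" and a: "a \<in> null_ideal" for f a
    unfolding null_ideal_def mem_Collect_eq ent_times
  proof (intro allI dvd_sum)
    fix i j k
    have "pp (ex k) dvd ent a k j" using a by (simp add: null_ideal_def)
    then show "pp (ex i) dvd ent f i k * ent a k j"
      using pp_dvd_mult[OF _ hom_ringD[OF f, of i k], of "ex i" "ex k"] by simp
  qed
  show "a * f \<in> null_ideal" if a: "a \<in> null_ideal" and f: "f \<in> hom_ring" for f a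
    unfolding null_ideal_def mem_Collect_eq ent_times
    using a by (intro allI dvd_sum dvd_mult2) (simp add: null_ideal_def)
qed (use hom_times in \<open>auto simp: null_ideal_def\<close>)

text \<open>Between indices of equal exponent, a summand that passes through an index
  \<open>k\<close> of another exponent has a step from a smaller to a larger exponent, and the entry
  of that step is divisible by \<open>p\<close>. Only the diagonal blocks remain, where the
  assumption applies.\<close>

lemma rad_times:
  assumes f: "f \<in> hom_ring" and g: "g \<in> hom_ring" and fg: "f \<in> rad_ideal \<or> g \<in> rad_ideal"
  shows "f * g \<in> rad_ideal"
  unfolding rad_ideal_def
proof (intro CollectI conjI allI impI)
  show "f * g \<in> hom_ring" by (rule hom_times[OF f g])
  fix i j assume ij: "ex i = ex j" "0 < ex i"
  show "int p dvd ent (f * g) i j" unfolding ent_times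
  proof (rule dvd_sum)
    fix k
    consider "ex k < ex i" | "ex j < ex k" | "ex k = ex i" "ex k = ex j" using ij by linarith
    then show "int p dvd ent f i k * ent g k j"
    proof cases
      case 3
      then have "int p dvd ent f i k \<or> int p dvd ent g k j"
        using fg ij(2) unfolding rad_ideal_def by auto
      then show ?thesis by (metis dvd_mult dvd_mult2)
    qed (use hom_ring_less f g in \<open>auto intro: dvd_mult dvd_mult2\<close>)
  qed
qed

sublocale rad: subring_ideal hom_ring rad_ideal
proof
  show "a - b \<in> rad_ideal" if "a \<in> rad_ideal" "b \<in> rad_ideal" for a b
    using that null.diff_closed[of a b] by (simp add: rad_ideal_def)
  show "0 \<in> rad_ideal" using null.zero_closed by (simp add: rad_ideal_def)
  show sub: "rad_ideal \<subseteq> hom_ring" by (auto simp: rad_ideal_def)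
  show "f * a \<in> rad_ideal" if "f \<in> hom_ring" "a \<in> rad_ideal" for f a
    using that sub by (auto intro: rad_times)
  show "a * f \<in> rad_ideal" if "a \<in> rad_ideal" "f \<in> hom_ring" for f a
    using that sub by (auto intro: rad_times)
qed auto

lemma null_subset_rad: "null_ideal \<subseteq> rad_ideal"
proof
  fix f assume f: "f \<in> null_ideal"
  then show "f \<in> rad_ideal"
    unfolding rad_ideal_def using null_subset_hom p_dvd_pp[of "ex i" "ent f i j" for i j]
    by (simp add: null_ideal_def subset_eq)
qed

lemma null_rad_cong: "null.cong a b \<Longrightarrow> rad.cong a b"
  unfolding null.cong_def rad.cong_def using null_subset_rad by blast

lemma null_cong_iff: "null.cong f g \<longleftrightarrow> (\<forall>i < s. \<forall>j. pp (ex i) dvd ent f i j - ent g i j)"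
proof
  assume "null.cong f g"
  then show "\<forall>i < s. \<forall>j. pp (ex i) dvd ent f i j - ent g i j"
    unfolding null.cong_def by (simp add: null_ideal_def)
next
  assume d: "\<forall>i < s. \<forall>j. pp (ex i) dvd ent f i j - ent g i j"
  have "pp (ex i) dvd ent f i j - ent g i j" for i j
    using d ex_zero[of i] by (cases "i < s") auto
  then show "null.cong f g" unfolding null.cong_def by (simp add: null_ideal_def)
qed

lemma multiple_p_rad: "f \<in> hom_ring \<Longrightarrow> int p dvd c \<Longrightarrow> of_int c * f \<in> rad_ideal"
  unfolding rad_ideal_def using null.mult_closed[OF null.of_int_closed]
  by (auto simp: ent_of_int_times)

text \<open>Modulo the radical an element is determined by the residues of \<open>s * s\<close>
  entries modulo \<open>p\<close>, so two members of any sequence coincide.\<close>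

lemma rad_finite_quotient:
  fixes g :: "nat \<Rightarrow> rfmat"
  assumes g: "\<And>i. g i \<in> hom_ring"
  shows "\<exists>i j. i < j \<and> rad.cong (g i) (g j)"
proof -
  let ?r = "\<lambda>n. \<lambda>a \<in> {..<s} \<times> {..<s}. ent (g n) (fst a) (snd a) mod int p"
  let ?X = "PiE ({..<s} \<times> {..<s}) (\<lambda>_. {0..<int p})"
  have fin: "finite ?X" by (intro finite_PiE) auto
  have "range ?r \<subseteq> ?X" using p_gt_1 by (intro image_subsetI restrict_PiE_iff[THEN iffD2]) auto
  then have "finite (range ?r)" using fin finite_subset by blast
  then have "\<not> inj ?r" using finite_imageD[of ?r UNIV] by auto
  then obtain i j where ij: "?r i = ?r j" "i \<noteq> j" unfolding inj_def by blast
  have "rad.cong (g i) (g j)" if ij: "?r i = ?r j" for i j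
  proof -
    have "int p dvd ent (g i) a b - ent (g j) a b" if "a < s" "b < s" for a b
      using fun_cong[OF ij, of "(a, b)"] that by (simp add: mod_eq_dvd_iff)
    moreover have "i' < s \<and> j' < s" if "ex i' = ex j'" "0 < ex i'" for i' j'
      using that ex_pos_iff by metis
    ultimately show ?thesis unfolding rad.cong_def
      using null.diff_closed[OF g g] by (simp add: rad_ideal_def)
  qed
  from this[OF ij(1)] this[OF ij(1)[symmetric]] show ?thesis
    using ij(2) by (cases "i < j") (auto dest: linorder_neqE_nat)
qed

end

section \<open>Exponents of general linear groups\<close>

lemma funpow_inj_on_closed:
  assumes "f ` C \<subseteq> C" "inj_on f C"
  shows "(f ^^ j) ` C \<subseteq> C" "inj_on (f ^^ j) C"
proof (induction j)
  case (Suc j)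
  {
    case 1
    show ?case using Suc(1) assms(1) by auto
  next
    case 2
    show ?case unfolding funpow.simps
      by (rule comp_inj_on[OF Suc(2) inj_on_subset[OF assms(2) Suc(1)]])
  }
qed auto

lemma funpow_cancel:
  assumes "f ` C \<subseteq> C" "inj_on f C" "x \<in> C" "(f ^^ i) x = (f ^^ j) x" "i \<le> j"
  shows "(f ^^ (j - i)) x = x"
proof -
  have "(f ^^ i) ((f ^^ (j - i)) x) = (f ^^ i) x"
    using assms(4,5) by (metis comp_apply funpow_add le_add_diff_inverse)
  moreover have "(f ^^ (j - i)) x \<in> C"
    using funpow_inj_on_closed(1)[OF assms(1,2)] assms(3) by blast
  ultimately show ?thesis
    using funpow_inj_on_closed(2)[OF assms(1,2), of i] assms(3) by (auto dest: inj_onD)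
qed

text \<open>In a semiregular action of a cyclic group all orbits have the same length.\<close>

lemma semiregular_funpow_card:
  assumes C: "finite C" and f: "f ` C \<subseteq> C" "inj_on f C"
    and free: "\<And>j x y. x \<in> C \<Longrightarrow> y \<in> C \<Longrightarrow> (f ^^ j) x = x \<Longrightarrow> (f ^^ j) y = y"
    and x: "x \<in> C"
  shows "(f ^^ card C) x = x"
proof -
  let ?P = "\<lambda>m. 0 < m \<and> (f ^^ m) x = x"
  have "\<not> inj (\<lambda>j. (f ^^ j) x)"
  proof
    assume "inj (\<lambda>j. (f ^^ j) x)"
    moreover have "range (\<lambda>j. (f ^^ j) x) \<subseteq> C"
      using funpow_inj_on_closed(1)[OF f] x by blast
    ultimately show False using C finite_subset finite_imageD infinite_UNIV_nat by metis
  qed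
  then obtain i j where ij: "(f ^^ i) x = (f ^^ j) x" "i \<noteq> j" unfolding inj_def by blast
  have "\<exists>m. ?P m"
    using funpow_cancel[OF f x ij(1)] funpow_cancel[OF f x ij(1)[symmetric]] ij(2)
    by (cases "i \<le> j") (auto intro: exI[of _ "j - i"] exI[of _ "i - j"])
  define m where "m = (LEAST m. ?P m)"
  have m: "?P m" unfolding m_def using \<open>\<exists>m. ?P m\<close> by (rule LeastI_ex)
  have least: "(f ^^ k) y \<noteq> y" if "0 < k" "k < m" "y \<in> C" for k y
    using not_less_Least[of k ?P] that free[OF that(3) x] unfolding m_def by blast
  have period: "(f ^^ m) y = y" if "y \<in> C" for y using free[OF x that] m by blast
  \<comment> \<open>Induction over invariant subsets: taking away one orbit, which has exactly
    \<open>m\<close> elements, leaves a smaller invariant subset.\<close>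
  have "m dvd card D" if "D \<subseteq> C" "f ` D \<subseteq> D" for D
  proof -
    have "finite D" using that(1) C finite_subset by blast
    then show ?thesis using that
    proof (induction D rule: finite_psubset_induct)
      case (psubset D)
      show ?case
      proof (cases "D = {}")
        case False
        then obtain y where y: "y \<in> D" by blast
        have yC: "y \<in> C" using y psubset.prems by blast
        define orb where "orb = (\<lambda>j. (f ^^ j) y) ` {..<m}"
        have fD: "(f ^^ j) ` D \<subseteq> D" for j
          by (induction j) (use psubset.prems(2) in auto)
        have "inj_on (\<lambda>j. (f ^^ j) y) {..<m}"
        proof (rule linorder_inj_onI)
          fix i j assume "i < j" "i \<in> {..<m}" "j \<in> {..<m}"
          then show "(f ^^ i) y \<noteq> (f ^^ j) y"
            using funpow_cancel[OF f yC, of i j] least[of "j - i" y] yC by auto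
        qed auto
        then have card: "card orb = m" by (simp add: orb_def card_image)
        have sub: "orb \<subseteq> D" using fD y unfolding orb_def by blast
        have "f z \<in> D - orb" if z: "z \<in> D - orb" for z
        proof -
          have zC: "z \<in> C" using z psubset.prems by blast
          have "f z \<noteq> (f ^^ j) y" if "j < m" for j
          proof
            assume eq: "f z = (f ^^ j) y"
            \<comment> \<open>Every orbit element has its predecessor in the orbit; for
              \<open>j = 0\<close> this is the last element, by periodicity. With injectivity no
              outside point can be mapped into the orbit.\<close>
            obtain k where k: "k < m" "(f ^^ j) y = f ((f ^^ k) y)"
            proof (cases j)
              case 0
              have "f ((f ^^ (m - 1)) y) = (f ^^ Suc (m - 1)) y" by simp
              also have "\<dots> = y" using period[OF yC] m by (simp del: funpow.simps)
              finally show ?thesis using that[of "m - 1"] m 0 by simp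
            next
              case (Suc i)
              then show ?thesis using that[of i] \<open>j < m\<close> by simp
            qed
            have "(f ^^ k) y \<in> C" using fD y psubset.prems by blast
            then have "z = (f ^^ k) y" using eq k(2) zC f(2) by (auto dest: inj_onD)
            then show False using z k(1) by (auto simp: orb_def)
          qed
          then show ?thesis using z psubset.prems by (auto simp: orb_def)
        qed
        moreover have "D - orb \<subset> D" using sub card m by (auto simp: orb_def)
        ultimately have "m dvd card (D - orb)"
          using psubset.IH[of "D - orb"] psubset.prems by blast
        moreover have "card D = card (D - orb) + m"
          using card sub psubset.hyps card_Diff_subset[of orb D] card_mono[of D orb]
          by (simp add: finite_subset)
        ultimately show ?thesis by simp
      qed simp
    qed
  qed
  then have "m dvd card C" using f(1) by simp
  then obtain k where "card C = m * k" by (rule dvdE)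
  moreover have "(f ^^ (m * k)) x = x" for k
    by (induction k) (use m in \<open>simp_all add: funpow_add\<close>)
  ultimately show ?thesis by simp
qed

section \<open>Ordered bases over the field with \<open>p\<close> elements, and their number\<close>

locale prime_vectors =
  fixes p s :: nat
  assumes p: "prime p"
begin

definition vecs :: "nat \<Rightarrow> (nat \<Rightarrow> int) set" where
  "vecs n = PiE {..<n} (\<lambda>_. {0..<int p})"

definition reduce :: "nat \<Rightarrow> (nat \<Rightarrow> int) \<Rightarrow> nat \<Rightarrow> int" where
  "reduce n v = (\<lambda>i \<in> {..<n}. v i mod int p)"

definition comb :: "(nat \<Rightarrow> int) \<Rightarrow> (nat \<Rightarrow> int) list \<Rightarrow> nat \<Rightarrow> int" where
  "comb c vs i = (\<Sum>l < length vs. c l * (vs ! l) i)"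

definition indep :: "(nat \<Rightarrow> int) list \<Rightarrow> bool" where
  "indep vs \<longleftrightarrow> (\<forall>c. (\<forall>i < s. int p dvd comb c vs i) \<longrightarrow> (\<forall>l < length vs. int p dvd c l))"

definition span :: "(nat \<Rightarrow> int) list \<Rightarrow> (nat \<Rightarrow> int) set" where
  "span vs = (\<lambda>c. reduce s (comb c vs)) ` vecs (length vs)"

text \<open>For \<open>k = s\<close> these are the ordered bases. They stand in for the group GL_s,
  whose order is their number, so the group itself need not be constructed.\<close>

definition frames :: "nat \<Rightarrow> (nat \<Rightarrow> int) list set" where
  "frames k = {vs. length vs = k \<and> set vs \<subseteq> vecs s \<and> indep vs}"

lemma p1: "1 < p" using p prime_gt_1_nat by blast

lemma card_vecs: "card (vecs n) = p ^ n" and finite_vecs: "finite (vecs n)"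
  unfolding vecs_def by (simp_all add: card_PiE finite_PiE)

lemma reduce_in_vecs: "reduce n v \<in> vecs n"
  unfolding reduce_def vecs_def using p1 by (intro restrict_PiE_iff[THEN iffD2]) auto

lemma reduce_eq_iff: "reduce n v = reduce n w \<longleftrightarrow> (\<forall>i < n. int p dvd v i - w i)"
proof
  assume eq: "reduce n v = reduce n w"
  show "\<forall>i < n. int p dvd v i - w i"
  proof (intro allI impI)
    fix i assume "i < n"
    then show "int p dvd v i - w i"
      using fun_cong[OF eq, of i] by (simp add: reduce_def mod_eq_dvd_iff)
  qed
next
  assume "\<forall>i < n. int p dvd v i - w i"
  then show "reduce n v = reduce n w"
    unfolding reduce_def by (intro restrict_ext) (simp add: mod_eq_dvd_iff)
qed

lemma reduce_vecs: "v \<in> vecs n \<Longrightarrow> reduce n v = v"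
  unfolding vecs_def reduce_def
  by (rule extensionalityI[of _ "{..<n}"]) (auto simp: PiE_iff Pi_iff)

lemma vecs_eqI:
  assumes "v \<in> vecs n" "w \<in> vecs n" "\<And>i. i < n \<Longrightarrow> int p dvd v i - w i"
  shows "v = w"
  using reduce_eq_iff[of n v w] reduce_vecs assms by metis

lemma comb_Cons: "comb c (v # vs) i = c 0 * v i + comb (\<lambda>l. c (Suc l)) vs i"
  unfolding comb_def by (simp add: sum.lessThan_Suc_shift del: sum.lessThan_Suc)

lemma comb_diff: "comb (\<lambda>l. c l - d l) vs i = comb c vs i - comb d vs i"
  unfolding comb_def by (simp add: left_diff_distrib sum_subtractf)

lemma comb_scale: "comb (\<lambda>l. a * c l) vs i = a * comb c vs i"
  unfolding comb_def by (simp add: sum_distrib_left mult.assoc)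

lemma comb_reduce: "int p dvd comb (reduce (length vs) c) vs i - comb c vs i"
  unfolding comb_diff[symmetric] unfolding comb_def
proof (intro dvd_sum dvd_mult2)
  fix l assume "l \<in> {..<length vs}"
  then show "int p dvd reduce (length vs) c l - c l"
    by (simp add: reduce_def mod_eq_dvd_iff[symmetric])
qed

lemma comb_in_span: "reduce s (comb c vs) \<in> span vs"
proof -
  have "reduce s (comb c vs) = reduce s (comb (reduce (length vs) c) vs)"
    unfolding reduce_eq_iff using comb_reduce[of vs c] dvd_diff_commute by blast
  then show ?thesis unfolding span_def using reduce_in_vecs by blast
qed

lemma span_subset: "span vs \<subseteq> vecs s"
  unfolding span_def using reduce_in_vecs by blast

lemma card_span:
  assumes "indep vs"
  shows "card (span vs) = p ^ length vs"
proof -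
  have "inj_on (\<lambda>c. reduce s (comb c vs)) (vecs (length vs))"
  proof (rule inj_onI)
    fix c d assume cd: "c \<in> vecs (length vs)" "d \<in> vecs (length vs)"
      and eq: "reduce s (comb c vs) = reduce s (comb d vs)"
    have "\<forall>l < length vs. int p dvd c l - d l"
      using eq assms unfolding reduce_eq_iff comb_diff[symmetric] indep_def by blast
    then show "c = d" using cd by (intro vecs_eqI) auto
  qed
  then show ?thesis unfolding span_def by (simp add: card_image card_vecs)
qed

lemma indep_Cons:
  assumes v: "v \<in> vecs s"
  shows "indep (v # vs) \<longleftrightarrow> indep vs \<and> v \<notin> span vs"
proof
  assume ind: "indep (v # vs)"
  have "indep vs" unfolding indep_def
  proof (intro allI impI)
    fix c l assume c: "\<forall>i < s. int p dvd comb c vs i" and l: "l < length vs"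
    have "\<forall>i < s. int p dvd comb (case_nat 0 c) (v # vs) i" using c by (simp add: comb_Cons)
    then have "\<forall>l < length (v # vs). int p dvd case_nat 0 c l"
      using ind unfolding indep_def by blast
    then show "int p dvd c l" using l by auto
  qed
  moreover have "v \<notin> span vs"
  proof
    assume "v \<in> span vs"
    then obtain c where c: "v = reduce s (comb c vs)" unfolding span_def by blast
    then have "\<forall>i < s. int p dvd v i - comb c vs i"
      using reduce_eq_iff[of s v "comb c vs"] reduce_vecs[OF v] by simp
    moreover have "comb (case_nat 1 (\<lambda>l. (-1) * c l)) (v # vs) i = v i - comb c vs i" for i
      unfolding comb_Cons nat.case comb_scale by simp
    ultimately have "\<forall>i < s. int p dvd comb (case_nat 1 (\<lambda>l. (-1) * c l)) (v # vs) i" by simp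
    then have "\<forall>l < length (v # vs). int p dvd case_nat 1 (\<lambda>l. (-1) * c l) l"
      using ind unfolding indep_def by blast
    then show False using p1 by auto
  qed
  ultimately show "indep vs \<and> v \<notin> span vs" ..
next
  assume ind: "indep vs \<and> v \<notin> span vs"
  show "indep (v # vs)" unfolding indep_def
  proof (intro allI impI)
    fix c l assume c: "\<forall>i < s. int p dvd comb c (v # vs) i" and l: "l < length (v # vs)"
    \<comment> \<open>Were \<open>c 0\<close> a unit modulo \<open>p\<close>, its Bezout inverse
      \<open>a\<close> would solve the relation for \<open>v\<close> and put \<open>v\<close> into
      the span.\<close>
    have c0: "int p dvd c 0"
    proof (rule ccontr)
      assume "\<not> int p dvd c 0"
      then have "coprime (c 0) (int p)"
        using p by (simp add: coprime_commute prime_imp_coprime)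
      then obtain a b where ab: "a * c 0 + b * int p = 1"
        using bezout_int[of "c 0" "int p"] by (auto simp: coprime_iff_gcd_eq_1)
      have "int p dvd v i - comb (\<lambda>l. (- a) * c (Suc l)) vs i" if "i < s" for i
      proof -
        have "v i - comb (\<lambda>l. (- a) * c (Suc l)) vs i
            = a * comb c (v # vs) i - (c 0 * a - 1) * v i"
          unfolding comb_Cons comb_scale by (simp add: algebra_simps)
        moreover have "c 0 * a - 1 = - b * int p" using ab by (simp add: algebra_simps)
        ultimately show ?thesis using c that by simp
      qed
      then have "v = reduce s (comb (\<lambda>l. (- a) * c (Suc l)) vs)"
        using reduce_eq_iff[of s v] reduce_vecs[OF v] by simp
      then show False using ind comb_in_span by metis
    qed
    then have "\<forall>i < s. int p dvd comb (\<lambda>l. c (Suc l)) vs i"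
      using c unfolding comb_Cons by (simp add: dvd_add_right_iff)
    then have "\<forall>l < length vs. int p dvd c (Suc l)" using ind unfolding indep_def by blast
    then show "int p dvd c l" using c0 l by (cases l) auto
  qed
qed

lemma frames_Suc:
  "frames (Suc k) = (\<lambda>(vs, v). v # vs) ` (SIGMA vs : frames k. vecs s - span vs)" (is "?L = ?R")
proof
  show "?L \<subseteq> ?R"
  proof
    fix us assume us: "us \<in> ?L"
    then obtain v vs where "us = v # vs" unfolding frames_def by (cases us) auto
    then show "us \<in> ?R" using us indep_Cons[of v vs] unfolding frames_def by force
  qed
  show "?R \<subseteq> ?L" using indep_Cons unfolding frames_def by auto
qed

text \<open>A frame of length \<open>k\<close> spans \<open>p ^ k\<close> vectors, which leaves
  \<open>p ^ s - p ^ k\<close> choices for the next vector.\<close>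

lemma card_frames: "finite (frames k) \<and> card (frames k) = (\<Prod>i < k. p ^ s - p ^ i)"
proof (induction k)
  case 0
  have "frames 0 = {[]}" by (auto simp: frames_def indep_def)
  then show ?case by simp
next
  case (Suc k)
  have "card (vecs s - span vs) = p ^ s - p ^ k" if "vs \<in> frames k" for vs
    using that card_span[of vs] card_Diff_subset[OF finite_subset[OF span_subset finite_vecs] span_subset]
    by (simp add: frames_def card_vecs)
  then have "card (SIGMA vs : frames k. vecs s - span vs) = (\<Prod>i < Suc k. p ^ s - p ^ i)"
    using Suc finite_vecs by (simp add: card_SigmaI)
  moreover have "inj_on (\<lambda>(vs, v). v # vs) (SIGMA vs : frames k. vecs s - span vs)"
    by (auto simp: inj_on_def)
  ultimately show ?case
    unfolding frames_Suc using Suc finite_vecs by (simp add: card_image)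
qed

lemma frame_spans:
  assumes "vs \<in> frames s"
  shows "span vs = vecs s"
  using assms card_span[of vs] span_subset card_vecs finite_vecs
  by (intro card_subset_eq) (auto simp: frames_def)

definition act :: "(nat \<Rightarrow> nat \<Rightarrow> int) \<Rightarrow> (nat \<Rightarrow> int) \<Rightarrow> nat \<Rightarrow> int" where
  "act t v = reduce s (\<lambda>i. \<Sum>k < s. t i k * v k)"

text \<open>The map \<open>g\<close> is kept apart from \<open>act t\<close> because it will also be
  an iterate of an action, which is known to agree with the action of a matrix only on
  \<open>vecs s\<close>.\<close>

lemma act_comb:
  assumes "\<And>v. v \<in> set vs \<Longrightarrow> g v = act t v" and that: "i < s"
  shows "int p dvd comb c (map g vs) i - (\<Sum>k < s. t i k * comb c vs k)"
proof -
  have "(\<Sum>k < s. t i k * comb c vs k) = (\<Sum>l < length vs. c l * (\<Sum>k < s. t i k * (vs ! l) k))"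
    unfolding comb_def sum_distrib_left by (subst sum.swap) (simp add: ac_simps)
  then have "comb c (map g vs) i - (\<Sum>k < s. t i k * comb c vs k)
      = (\<Sum>l < length vs. c l * (act t (vs ! l) i - (\<Sum>k < s. t i k * (vs ! l) k)))"
    unfolding comb_def using assms by (simp add: right_diff_distrib sum_subtractf)
  moreover have "int p dvd act t v i - (\<Sum>k < s. t i k * v k)" for v
    using that by (simp add: act_def reduce_def mod_eq_dvd_iff[symmetric])
  ultimately show ?thesis by (simp add: dvd_sum dvd_mult)
qed

text \<open>An iterate that fixes one ordered basis fixes all vectors by linearity, so the action on
  ordered bases is semiregular and its common cycle length divides their number. Linearity of the
  iterates is supplied by \<open>powers\<close>.\<close>

lemma act_exponent:
  assumes inj: "\<And>d. (\<And>i. i < s \<Longrightarrow> int p dvd (\<Sum>k < s. t i k * d k)) \<Longrightarrow> (\<And>k. k < s \<Longrightarrow> int p dvd d k)"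
    and powers: "\<And>j v. v \<in> vecs s \<Longrightarrow> (act t ^^ j) v = act (t' j) v"
    and v: "v \<in> vecs s"
  shows "(act t ^^ (\<Prod>i < s. p ^ s - p ^ i)) v = v"
proof -
  let ?f = "map (act t)"
  have act_closed: "act t w \<in> vecs s" for t w unfolding act_def by (rule reduce_in_vecs)
  have f_pow: "(?f ^^ j) vs = map (act t ^^ j) vs" for j vs by (induction j) auto
  have closed: "?f ` frames s \<subseteq> frames s"
  proof (intro image_subsetI)
    fix vs assume vs: "vs \<in> frames s"
    have "indep (?f vs)" unfolding indep_def
    proof (intro allI impI)
      fix c l assume c: "\<forall>i < s. int p dvd comb c (?f vs) i" and l: "l < length (?f vs)"
      have "int p dvd (\<Sum>k < s. t i k * comb c vs k)" if "i < s" for i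
        using act_comb[of vs "act t" t i c] c that by (simp add: dvd_diff_right_iff)
      then have "\<forall>k < s. int p dvd comb c vs k" using inj by blast
      then show "int p dvd c l" using vs l unfolding frames_def indep_def by simp
    qed
    then show "?f vs \<in> frames s" using vs act_closed unfolding frames_def by auto
  qed
  have "inj_on (act t) (vecs s)"
  proof (rule inj_onI)
    fix v w assume vw: "v \<in> vecs s" "w \<in> vecs s" "act t v = act t w"
    have "int p dvd (\<Sum>k < s. t i k * (v k - w k))" if "i < s" for i
      using vw(3) that unfolding act_def reduce_eq_iff by (simp add: right_diff_distrib sum_subtractf)
    then have "\<And>k. k < s \<Longrightarrow> int p dvd v k - w k" by (rule inj)
    then show "v = w" using vw by (intro vecs_eqI)
  qed
  then have "inj_on (act t) (set vs \<union> set us)" if "vs \<in> frames s" "us \<in> frames s" for vs us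
    by (rule inj_on_subset) (use that in \<open>auto simp: frames_def\<close>)
  then have inj_f: "inj_on ?f (frames s)" by (meson inj_onI map_inj_on)
  have fix_all: "(act t ^^ j) w = w"
    if vs: "vs \<in> frames s" "(?f ^^ j) vs = vs" and w: "w \<in> vecs s" for j vs w
  proof -
    obtain c where c: "w = reduce s (comb c vs)"
      using frame_spans[OF vs(1)] w unfolding span_def by blast
    have "map (act t ^^ j) vs = vs" using vs(2) f_pow by simp
    moreover have "\<And>u. u \<in> set vs \<Longrightarrow> (act t ^^ j) u = act (t' j) u"
      using powers vs(1) unfolding frames_def by blast
    ultimately have d: "int p dvd comb c vs i - (\<Sum>k < s. t' j i k * comb c vs k)" if "i < s" for i
      using act_comb[of vs "act t ^^ j" "t' j" i c] that by simp
    have "act (t' j) w = w"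
      unfolding c act_def reduce_eq_iff
    proof (intro allI impI)
      fix i assume i: "i < s"
      have eq: "(\<Sum>k < s. t' j i k * reduce s (comb c vs) k) - comb c vs i
          = (\<Sum>k < s. t' j i k * (reduce s (comb c vs) k - comb c vs k))
            - (comb c vs i - (\<Sum>k < s. t' j i k * comb c vs k))"
        by (simp add: right_diff_distrib sum_subtractf)
      have "int p dvd reduce s (comb c vs) k - comb c vs k" if "k < s" for k
        using that by (simp add: reduce_def mod_eq_dvd_iff[symmetric])
      then have "int p dvd (\<Sum>k < s. t' j i k * (reduce s (comb c vs) k - comb c vs k))"
        by (intro dvd_sum dvd_mult) simp
      then show "int p dvd (\<Sum>k < s. t' j i k * reduce s (comb c vs) k) - comb c vs i"
        unfolding eq using d[OF i] by (rule dvd_diff)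
    qed
    then show ?thesis using powers[OF w] by simp
  qed
  have "(?f ^^ j) us = us" if "vs \<in> frames s" "us \<in> frames s" "(?f ^^ j) vs = vs" for j vs us
    unfolding f_pow using fix_all[OF that(1,3)] that(2) by (intro map_idI) (auto simp: frames_def)
  then have cyc: "(?f ^^ card (frames s)) vs = vs" if "vs \<in> frames s" for vs
    using semiregular_funpow_card[OF _ closed inj_f] card_frames that by blast
  \<comment> \<open>The cycle statement is empty without a basis to apply it to; that one exists is
    read off from the count being nonzero.\<close>
  have "p ^ i < p ^ s" if "i < s" for i using that p1 by simp
  then have "card (frames s) \<noteq> 0" using card_frames[of s] by (simp add: not_le)
  then obtain vs where "vs \<in> frames s" by fastforce
  then show ?thesis using fix_all[OF _ cyc v] card_frames[of s] by simp
qed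

end

section \<open>The group of automorphisms\<close>

lemma dvd_diff_prod:
  fixes f g :: "'b \<Rightarrow> int"
  assumes "\<And>i. i \<in> A \<Longrightarrow> m dvd f i - g i"
  shows "m dvd prod f A - prod g A"
  using assms
proof (induction A rule: infinite_finite_induct)
  case (insert x A)
  have "prod f (insert x A) - prod g (insert x A)
      = (f x - g x) * prod f A + g x * (prod f A - prod g A)"
    using insert.hyps by (simp add: algebra_simps)
  moreover have "m dvd f x - g x" "m dvd prod f A - prod g A" using insert by auto
  ultimately show ?case by simp
qed auto

lemma dvd_diff_det:
  assumes "A \<in> carrier_mat n n" "B \<in> carrier_mat n n"
    and "\<And>i j. i < n \<Longrightarrow> j < n \<Longrightarrow> m dvd A $$ (i, j) - B $$ (i, j)"
  shows "(m::int) dvd det A - det B"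
proof -
  have "m dvd (\<Prod>i = 0..<n. A $$ (i, \<pi> i)) - (\<Prod>i = 0..<n. B $$ (i, \<pi> i))"
    if "\<pi> permutes {0..<n}" for \<pi>
    using assms(3) permutes_in_image[OF that] by (intro dvd_diff_prod) simp
  then have "m dvd (\<Sum>\<pi> | \<pi> permutes {0..<n}. signof \<pi> *
      ((\<Prod>i = 0..<n. A $$ (i, \<pi> i)) - (\<Prod>i = 0..<n. B $$ (i, \<pi> i))))"
    by (intro dvd_sum dvd_mult) simp
  then show ?thesis
    unfolding det_def'[OF assms(1)] det_def'[OF assms(2)]
    by (simp add: right_diff_distrib sum_subtractf)
qed

section \<open>Determinants modulo \<open>p\<close> and an exponent for the automorphism
  group\<close>

context prime_exponents
begin

sublocale vec: prime_vectors p s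
  by unfold_locales (rule prime_p)

definition block :: "rfmat \<Rightarrow> int mat" where
  "block f = mat s s (\<lambda>(i, j). ent f i j)"

lemma block_carrier [simp]: "block f \<in> carrier_mat s s" "dim_row (block f) = s" "dim_col (block f) = s"
  by (simp_all add: block_def)

lemma block_index [simp]: "i < s \<Longrightarrow> j < s \<Longrightarrow> block f $$ (i, j) = ent f i j"
  by (simp add: block_def)

text \<open>Columns from \<open>s\<close> on belong to trivial factors: there the entries of a
  homomorphism in row \<open>i\<close> are multiples of \<open>pp (ex i)\<close>, so the infinite
  matrices multiply like their leading blocks.\<close>

lemma ent_times_cong:
  assumes f: "f \<in> hom_ring"
  shows "pp (ex i) dvd ent (f * g) i j - (\<Sum>k < s. ent f i k * ent g k j)"
proof -
  let ?A = "{k. ent f i k \<noteq> 0} \<union> {..<s}"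
  have "ent (f * g) i j = (\<Sum>k \<in> ?A. ent f i k * ent g k j)"
    using finite_row by (intro ent_times_superset) auto
  also have "\<dots> = (\<Sum>k < s. ent f i k * ent g k j) + (\<Sum>k \<in> ?A - {..<s}. ent f i k * ent g k j)"
    using finite_row by (subst sum.subset_diff[of "{..<s}"]) auto
  finally have eq: "ent (f * g) i j - (\<Sum>k < s. ent f i k * ent g k j)
      = (\<Sum>k \<in> ?A - {..<s}. ent f i k * ent g k j)" by simp
  have "pp (ex i) dvd ent f i k" if "s \<le> k" for k
    using hom_ringD[OF f, of i k] ex_zero[OF that] by simp
  then show ?thesis unfolding eq by (intro dvd_sum dvd_mult2) auto
qed

lemma ent_times_cong_p:
  assumes "f \<in> hom_ring" "i < s"
  shows "int p dvd ent (f * g) i j - (\<Sum>k < s. ent f i k * ent g k j)"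
  using p_dvd_pp[OF ex_pos[OF assms(2)] ent_times_cong[OF assms(1)]] .

lemma det_block_times:
  assumes "f \<in> hom_ring"
  shows "int p dvd det (block (f * g)) - det (block f) * det (block g)"
proof -
  have "int p dvd det (block (f * g)) - det (block f * block g)"
    using ent_times_cong_p[OF assms]
    by (intro dvd_diff_det[of _ s]) (auto simp: scalar_prod_def atLeast0LessThan)
  then show ?thesis by (simp add: det_mult[of _ s])
qed

lemma det_block_cong: "null.cong f g \<Longrightarrow> int p dvd det (block f) - det (block g)"
  unfolding null_cong_iff by (intro dvd_diff_det[of _ s]) (auto intro: p_dvd_pp[OF ex_pos])

lemma det_block_one: "det (block 1) = 1"
proof -
  have "block 1 = 1\<^sub>m s" by (rule eq_matI) auto
  then show ?thesis by simp
qed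

text \<open>Cramer's rule: multiplication by the adjugate turns the hypothesis into divisibility of
  \<open>det (block f) * d k\<close>, and the determinant is prime to \<open>p\<close>.\<close>

lemma block_kernel:
  assumes det: "\<not> int p dvd det (block f)"
    and d: "\<And>i. i < s \<Longrightarrow> int p dvd (\<Sum>k < s. ent f i k * d k)"
    and k: "k < s"
  shows "int p dvd d k"
proof -
  let ?B = "adj_mat (block f)"
  have B: "?B \<in> carrier_mat s s" "?B * block f = det (block f) \<cdot>\<^sub>m 1\<^sub>m s"
    using adj_mat[OF block_carrier(1)] by auto
  have "(\<Sum>l < s. (\<Sum>i < s. ?B $$ (k, i) * ent f i l) * d l) = det (block f) * d k"
  proof -
    have "(\<Sum>i < s. ?B $$ (k, i) * ent f i l) = (if k = l then det (block f) else 0)" if "l < s" for l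
      using arg_cong[OF B(2), of "\<lambda>M. M $$ (k, l)"] B(1) k that
      by (auto simp: scalar_prod_def atLeast0LessThan)
    then have "(\<Sum>l < s. (\<Sum>i < s. ?B $$ (k, i) * ent f i l) * d l)
        = (\<Sum>l < s. if k = l then det (block f) * d l else 0)"
      by (intro sum.cong) auto
    then show ?thesis using k by simp
  qed
  moreover have "(\<Sum>l < s. (\<Sum>i < s. ?B $$ (k, i) * ent f i l) * d l)
      = (\<Sum>i < s. ?B $$ (k, i) * (\<Sum>l < s. ent f i l * d l))"
    unfolding sum_distrib_left sum_distrib_right by (subst sum.swap) (simp add: mult.assoc)
  moreover have "int p dvd (\<Sum>i < s. ?B $$ (k, i) * (\<Sum>l < s. ent f i l * d l))"
    by (rule dvd_sum, rule dvd_mult, rule d) simp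
  ultimately have "int p dvd det (block f) * d k" by simp
  then show ?thesis using det prime_p by (simp add: prime_dvd_mult_iff)
qed

lemma act_times:
  assumes "f \<in> hom_ring"
  shows "vec.act (ent f) (vec.act (ent g) v) = vec.act (ent (f * g)) v"
  unfolding vec.act_def[of "ent f"] vec.act_def[of "ent (f * g)"] vec.reduce_eq_iff
proof (intro allI impI)
  fix i assume i: "i < s"
  let ?w = "\<lambda>k. \<Sum>l < s. ent g k l * v l"
  have "(\<Sum>k < s. ent f i k * vec.act (ent g) v k) - (\<Sum>l < s. ent (f * g) i l * v l)
      = (\<Sum>k < s. ent f i k * (vec.act (ent g) v k - ?w k))
        - (\<Sum>l < s. (ent (f * g) i l - (\<Sum>k < s. ent f i k * ent g k l)) * v l)"
  proof -
    have "(\<Sum>k < s. ent f i k * ?w k) = (\<Sum>l < s. (\<Sum>k < s. ent f i k * ent g k l) * v l)"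
      unfolding sum_distrib_left sum_distrib_right by (subst sum.swap) (simp add: mult.assoc)
    then show ?thesis by (simp add: left_diff_distrib right_diff_distrib sum_subtractf)
  qed
  moreover have "int p dvd (\<Sum>k < s. ent f i k * (vec.act (ent g) v k - ?w k))"
    by (intro dvd_sum dvd_mult) (simp add: vec.act_def vec.reduce_def mod_eq_dvd_iff[symmetric])
  moreover have "int p dvd (\<Sum>l < s. (ent (f * g) i l - (\<Sum>k < s. ent f i k * ent g k l)) * v l)"
    using ent_times_cong_p[OF assms i] by (intro dvd_sum dvd_mult2)
  ultimately show "int p dvd (\<Sum>k < s. ent f i k * vec.act (ent g) v k) - (\<Sum>l < s. ent (f * g) i l * v l)"
    by (simp only: dvd_diff)
qed

lemma act_one: "v \<in> vec.vecs s \<Longrightarrow> vec.act (ent 1) v = v"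
proof -
  assume "v \<in> vec.vecs s"
  moreover have "(\<Sum>k < s. ent 1 i k * v k) = v i" if "i < s" for i
    using that by (simp add: if_distrib[of "\<lambda>x. x * _"] cong: if_cong)
  then have "vec.act (ent 1) v = vec.reduce s v"
    unfolding vec.act_def vec.reduce_eq_iff by simp
  ultimately show ?thesis by (simp add: vec.reduce_vecs)
qed

lemma act_power:
  assumes "f \<in> hom_ring" "v \<in> vec.vecs s"
  shows "(vec.act (ent f) ^^ j) v = vec.act (ent (f ^ j)) v"
proof (induction j)
  case 0
  show ?case using act_one[OF assms(2)] by (simp del: ent_one)
next
  case (Suc j)
  then show ?case using assms(1) by (simp add: act_times)
qed

text \<open>The order of GL_s over the field with \<open>p\<close> elements, in the form in which
  ordered bases are counted.\<close>

definition gl_order :: nat where "gl_order = (\<Prod>i < s. p ^ s - p ^ i)"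

lemma power_gl_order:
  assumes f: "f \<in> hom_ring" and det: "\<not> int p dvd det (block f)" and ij: "i < s" "j < s"
  shows "int p dvd ent (f ^ gl_order) i j - ent 1 i j"
proof -
  \<comment> \<open>A unit vector; its image under the power is column \<open>j\<close>.\<close>
  let ?u = "\<lambda>k \<in> {..<s}. if k = j then 1 else 0 :: int"
  have u: "?u \<in> vec.vecs s"
    unfolding vec.vecs_def using p_gt_1 by (intro restrict_PiE_iff[THEN iffD2]) auto
  have "vec.act (ent (f ^ gl_order)) ?u = ?u"
    unfolding act_power[OF f u, symmetric] gl_order_def
    by (rule vec.act_exponent[of "ent f" "\<lambda>j. ent (f ^ j)"])
      (use block_kernel[OF det] act_power[OF f] u in blast)+
  then have "vec.reduce s (\<lambda>i. \<Sum>k < s. ent (f ^ gl_order) i k * ?u k) = vec.reduce s ?u"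
    using u by (simp add: vec.act_def vec.reduce_vecs)
  then have "int p dvd (\<Sum>k < s. ent (f ^ gl_order) i k * ?u k) - ?u i"
    unfolding vec.reduce_eq_iff using ij by blast
  moreover have "(\<Sum>k < s. ent (f ^ gl_order) i k * ?u k)
      = (\<Sum>k < s. if k = j then ent (f ^ gl_order) i k else 0)"
    by (rule sum.cong) auto
  then have "(\<Sum>k < s. ent (f ^ gl_order) i k * ?u k) = ent (f ^ gl_order) i j"
    using ij by simp
  ultimately show ?thesis using ij by simp
qed

text \<open>The congruence filtration: \<open>1 + layer 1\<close> is the kernel of reduction modulo
  \<open>p\<close>, and capping at \<open>ex i\<close> puts \<open>layer k\<close> inside
  \<open>null_ideal\<close> once \<open>k\<close> reaches the largest exponent.\<close>

definition layer :: "nat \<Rightarrow> rfmat set" where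
  "layer k = {f \<in> hom_ring. \<forall>i j. pp (min k (ex i)) dvd ent f i j}"

lemma layer_mono: "l \<le> k \<Longrightarrow> layer k \<subseteq> layer l"
  unfolding layer_def
proof (intro subsetI CollectI conjI allI)
  fix f i j assume l: "l \<le> k" and f: "f \<in> {f \<in> hom_ring. \<forall>i j. pp (min k (ex i)) dvd ent f i j}"
  then show "f \<in> hom_ring" by simp
  have "pp (min l (ex i)) dvd pp (min k (ex i))" using l by (intro pp_dvd_mono) auto
  then show "pp (min l (ex i)) dvd ent f i j" using f by (auto intro: dvd_trans)
qed

lemma layer_right: "f \<in> layer k \<Longrightarrow> g \<in> hom_ring \<Longrightarrow> f * g \<in> layer k"
  unfolding layer_def using hom_times by (auto simp: ent_times intro!: dvd_sum)

lemma layer_add: "f \<in> layer k \<Longrightarrow> g \<in> layer k \<Longrightarrow> f + g \<in> layer k"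
  unfolding layer_def using null.add_closed by auto

lemma layer_mult:
  assumes f: "f \<in> layer k" and g: "g \<in> layer 1"
  shows "f * g \<in> layer (Suc k)"
  unfolding layer_def
proof (intro CollectI conjI allI)
  have fg: "f \<in> hom_ring" "g \<in> hom_ring" using f g by (auto simp: layer_def)
  then show "f * g \<in> hom_ring" by (rule hom_times)
  show "pp (min (Suc k) (ex i)) dvd ent (f * g) i j" for i j
    unfolding ent_times
  proof (rule dvd_sum)
    fix l
    show "pp (min (Suc k) (ex i)) dvd ent f i l * ent g l j"
    proof (cases "ex l = 0")
      case True
      then have "pp (ex i) dvd ent f i l" using hom_ringD[OF fg(1), of i l] by simp
      then show ?thesis by (intro dvd_mult2) (rule dvd_trans[OF pp_dvd_mono], auto)
    next
      case False
      have "pp (min k (ex i)) dvd ent f i l" "pp (min 1 (ex l)) dvd ent g l j"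
        using f g by (auto simp: layer_def)
      then show ?thesis using False by (intro pp_dvd_mult[of _ "min k (ex i)" "min 1 (ex l)"]) auto
    qed
  qed
qed

lemma geometric: "((a::'a::ring_1) - 1) * (\<Sum>i < n. a ^ i) = a ^ n - 1"
  by (induction n) (simp_all add: algebra_simps power_commutes)

text \<open>\<open>a ^ p - 1\<close> is \<open>a - 1\<close> times the sum of the powers
  \<open>a ^ i\<close>, and that sum is \<open>p\<close> plus the terms \<open>a ^ i - 1\<close>.
  Both parts contribute one more factor \<open>p\<close>.\<close>

lemma layer_lift:
  assumes a: "a \<in> hom_ring" "a - 1 \<in> layer k" and k: "1 \<le> k"
  shows "a ^ p - 1 \<in> layer (Suc k)"
proof -
  have pow: "a ^ i - 1 \<in> layer 1" for i
  proof -
    have sum: "(\<Sum>j < i. a ^ j) \<in> hom_ring"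
      using a by (induction i) (auto intro: null.add_closed null.power_closed)
    have "a ^ i - 1 \<in> layer k"
      unfolding geometric[symmetric] by (rule layer_right[OF a(2) sum])
    then show ?thesis using layer_mono[OF k] by blast
  qed
  have "(\<Sum>i < n. a ^ i - 1) \<in> layer 1" for n
  proof (induction n)
    case 0
    show ?case by (simp add: layer_def null.zero_closed)
  next
    case (Suc n)
    then show ?case using layer_add pow by simp
  qed
  then have "(a - 1) * (\<Sum>i < p. a ^ i - 1) \<in> layer (Suc k)"
    by (rule layer_mult[OF a(2)])
  moreover have "of_int (int p) * (a - 1) \<in> layer (Suc k)"
  proof -
    have "pp (min (Suc k) (ex i)) dvd int p * ent (a - 1) i j" for i j
    proof -
      have "pp (min k (ex i)) dvd ent (a - 1) i j" using a(2) by (simp add: layer_def)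
      then show ?thesis by (intro pp_dvd_mult[of _ 1 "min k (ex i)"]) auto
    qed
    moreover have "of_int (int p) * (a - 1) \<in> hom_ring"
      using a(1) by (intro null.mult_closed null.of_int_closed null.diff_closed) auto
    ultimately show ?thesis unfolding layer_def by (simp add: ent_of_int_times del: ent_diff of_int_of_nat_eq)
  qed
  moreover have "(a - 1) * (\<Sum>i < p. a ^ i - 1) + of_int (int p) * (a - 1) = a ^ p - 1"
  proof -
    have "(a - 1) * (\<Sum>i < p. a ^ i - 1) = a ^ p - 1 - (a - 1) * of_nat p"
      unfolding geometric[of a p, symmetric] by (simp add: sum_subtractf right_diff_distrib)
    then show ?thesis by (simp add: mult_of_nat_commute)
  qed
  ultimately show ?thesis using layer_add by metis
qed

lemma layer_power:
  assumes "a \<in> hom_ring" "a - 1 \<in> layer 1"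
  shows "a ^ (p ^ k) - 1 \<in> layer (Suc k)"
proof (induction k)
  case (Suc k)
  then have "(a ^ (p ^ k)) ^ p - 1 \<in> layer (Suc (Suc k))"
    using assms(1) by (intro layer_lift) auto
  then show ?case by (simp add: power_mult[symmetric] mult.commute)
qed (use assms in simp)

text \<open>The power of \<open>p\<close> disposes of the kernel of reduction modulo
  \<open>p\<close>: each \<open>p\<close>-th power climbs one layer, and \<open>ex (s - 1)\<close>
  is the largest exponent because \<open>es\<close> is sorted.\<close>

definition full_exponent :: nat where "full_exponent = gl_order * p ^ ex (s - 1)"

lemma power_full_exponent:
  assumes f: "f \<in> hom_ring" and det: "\<not> int p dvd det (block f)"
  shows "null.cong (f ^ full_exponent) 1"
proof -
  let ?a = "f ^ gl_order"
  have a: "?a \<in> hom_ring" using f by auto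
  have "pp (min 1 (ex i)) dvd ent (?a - 1) i j" for i j
  proof (cases "i < s \<and> j < s")
    case True
    then show ?thesis using power_gl_order[OF f det] ex_pos[of i] by (simp add: min_def Suc_le_eq)
  next
    case False
    then consider "ex i = 0" | "ex j = 0" using ex_zero by (meson not_le)
    then show ?thesis
    proof cases
      case 2
      have "pp (ex i - ex j) dvd ent (?a - 1) i j" using a by (intro hom_ringD) auto
      moreover have "pp (min 1 (ex i)) dvd pp (ex i)" by (rule pp_dvd_mono) simp
      ultimately show ?thesis using 2 by (metis diff_zero dvd_trans)
    qed auto
  qed
  then have "?a - 1 \<in> layer 1" unfolding layer_def using a null.diff_closed by blast
  then have l: "?a ^ (p ^ ex (s - 1)) - 1 \<in> layer (Suc (ex (s - 1)))" by (rule layer_power[OF a])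
  have "ex i \<le> ex (s - 1)" for i
    using ex_mono[of i "s - 1"] ex_zero[of i] s_pos by (cases "i < s") auto
  then have "min (Suc (ex (s - 1))) (ex i) = ex i" for i by (simp add: le_Suc_eq min_absorb2)
  then have "?a ^ (p ^ ex (s - 1)) - 1 \<in> null_ideal" using l by (simp add: layer_def null_ideal_def)
  then show ?thesis by (simp add: null.cong_def full_exponent_def power_mult)
qed

end

lemma dvd_diff_iff: "(m::int) dvd a - b \<Longrightarrow> m dvd a \<longleftrightarrow> m dvd b"
  using dvd_add_right_iff[of m "a - b" b] by simp

section \<open>The group \<open>R(A)\<close> inside the endomorphism ring\<close>

context prime_exponents
begin

abbreviation R :: "int mat monoid" where "R \<equiv> R_group p es"

abbreviation cor :: "int mat \<Rightarrow> rfmat" where "cor \<equiv> corner s"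

definition uncorner :: "rfmat \<Rightarrow> int mat" where
  "uncorner f = mat s s (\<lambda>(i, j). ent f i j mod pp (ex i))"

text \<open>For \<open>i <= j\<close> both forms of the exponent difference are 0, since the
  exponents are sorted and the subtraction is truncated; for \<open>i > j\<close> they
  coincide.\<close>

lemma M_set_iff:
  "U \<in> M_set p es \<longleftrightarrow>
     U \<in> carrier_mat s s \<and> (\<forall>i < s. \<forall>j < s. 0 \<le> U $$ (i, j) \<and> U $$ (i, j) < pp (ex i)) \<and> cor U \<in> hom_ring"
proof -
  have ee: "ex i - ex j = es ! i - es ! (min i j)" if "i < s" "j < s" for i j
    using that ex_mono[of i j] by (cases "i \<le> j") (auto simp: ex_def min_def)
  have "cor U \<in> hom_ring \<longleftrightarrow> (\<forall>i < s. \<forall>j < s. pp (ex i - ex j) dvd U $$ (i, j))"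
    unfolding hom_ring_def mem_Collect_eq ent_corner by (auto split: if_splits)
  also have "\<dots> \<longleftrightarrow> (\<forall>i < s. \<forall>j < s. pp (es ! i - es ! (min i j)) dvd U $$ (i, j))"
    using ee by simp
  finally have "cor U \<in> hom_ring \<longleftrightarrow>
      (\<forall>i < s. \<forall>j < s. pp (es ! i - es ! (min i j)) dvd U $$ (i, j))" .
  moreover have "i < s \<Longrightarrow> ex i = es ! i" for i by (simp add: ex_def)
  ultimately show ?thesis unfolding M_set_def s_def[symmetric] by auto
qed

lemma uncorner_cong:
  assumes "f \<in> hom_ring"
  shows "null.cong (cor (uncorner f)) f"
  unfolding null_cong_iff
proof (intro allI impI)
  fix i j assume i: "i < s"
  show "pp (ex i) dvd ent (cor (uncorner f)) i j - ent f i j"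
  proof (cases "j < s")
    case True
    then show ?thesis using i by (simp add: ent_corner uncorner_def mod_eq_dvd_iff[symmetric])
  next
    case False
    then show ?thesis using hom_ringD[OF assms, of i j] ex_zero[of j] by (simp add: ent_corner)
  qed
qed

lemma uncorner_M_set:
  assumes "f \<in> hom_ring"
  shows "uncorner f \<in> M_set p es"
  unfolding M_set_iff using null.cong_closed[OF uncorner_cong assms] assms p_gt_1
  by (auto simp: uncorner_def)

lemma M_set_eqI:
  assumes U: "U \<in> M_set p es" and V: "V \<in> M_set p es" and c: "null.cong (cor U) (cor V)"
  shows "U = V"
proof (rule eq_matI)
  show "dim_row U = dim_row V" "dim_col U = dim_col V" using U V by (auto simp: M_set_iff)
  fix i j assume "i < dim_row V" "j < dim_col V"
  then have ij: "i < s" "j < s" using V by (auto simp: M_set_iff)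
  have "pp (ex i) dvd U $$ (i, j) - V $$ (i, j)"
    using c ij unfolding null_cong_iff by (metis ent_corner)
  then have "U $$ (i, j) mod pp (ex i) = V $$ (i, j) mod pp (ex i)" by (simp add: mod_eq_dvd_iff)
  then show "U $$ (i, j) = V $$ (i, j)" using U V ij by (simp add: M_set_iff)
qed

lemma M_set_hom: "U \<in> M_set p es \<Longrightarrow> cor U \<in> hom_ring"
  by (simp add: M_set_iff)

lemma M_mult_cong:
  assumes U: "U \<in> M_set p es" and V: "V \<in> M_set p es"
  shows "null.cong (cor (M_mult p es U V)) (cor U * cor V)"
  unfolding null_cong_iff
proof (intro allI impI)
  fix i j assume i: "i < s"
  let ?w = "\<Sum>k < s. ent (cor U) i k * ent (cor V) k j"
  have a: "pp (ex i) dvd ent (cor (M_mult p es U V)) i j - ?w"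
    using i by (auto simp: ent_corner M_mult_def s_def[symmetric] mod_eq_dvd_iff[symmetric] ex_def)
  have b: "pp (ex i) dvd ent (cor U * cor V) i j - ?w"
    by (rule ent_times_cong[OF M_set_hom[OF U]])
  show "pp (ex i) dvd ent (cor (M_mult p es U V)) i j - ent (cor U * cor V) i j"
    using dvd_diff[OF a b] by simp
qed

lemma M_mult_closed:
  assumes U: "U \<in> M_set p es" and V: "V \<in> M_set p es"
  shows "M_mult p es U V \<in> M_set p es"
proof -
  have "cor (M_mult p es U V) \<in> hom_ring"
    by (rule null.cong_closed[OF M_mult_cong[OF U V] hom_times[OF M_set_hom[OF U] M_set_hom[OF V]]])
  then show ?thesis
    unfolding M_set_iff using p_gt_1 by (auto simp: M_mult_def s_def[symmetric] ex_def)
qed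

lemma block_cor: "U \<in> carrier_mat s s \<Longrightarrow> block (cor U) = U"
  by (rule eq_matI) (auto simp: ent_corner)

lemma carrier_R: "U \<in> carrier R \<longleftrightarrow> U \<in> M_set p es \<and> \<not> int p dvd det (block (cor U))"
  using block_cor[of U] by (auto simp: R_group_def M_set_iff dvd_eq_mod_eq_0)

lemma mult_R [simp]: "U \<otimes>\<^bsub>R\<^esub> V = M_mult p es U V"
  by (simp add: R_group_def)

lemma one_R: "\<one>\<^bsub>R\<^esub> = 1\<^sub>m s"
  by (simp add: R_group_def s_def)

lemma cor_one: "null.cong (cor (1\<^sub>m s)) 1"
  unfolding null_cong_iff by (auto simp: ent_corner ex_zero)

lemma det_block_nonzero_left:
  assumes "f \<in> hom_ring" "null.cong (f * g) 1"
  shows "\<not> int p dvd det (block f)"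
proof
  assume "int p dvd det (block f)"
  then have "int p dvd det (block f) * det (block g)" by simp
  then have "int p dvd det (block (f * g))"
    using dvd_diff_iff[OF det_block_times[OF assms(1)]] by blast
  then have "int p dvd 1"
    using dvd_diff_iff[OF det_block_cong[OF assms(2)]] unfolding det_block_one by blast
  then show False using p_gt_1 by simp
qed

text \<open>The laws are transported from the ring modulo \<open>null_ideal\<close>, where members
  of \<open>M_set p es\<close> are unique representatives.\<close>

lemma group_R: "group R"
proof (rule groupI)
  fix U V W assume U: "U \<in> carrier R" and V: "V \<in> carrier R" and W: "W \<in> carrier R"
  have M: "U \<in> M_set p es" "V \<in> M_set p es" "W \<in> M_set p es" using U V W by (auto simp: carrier_R)
  note h = M_set_hom[OF M(1)] M_set_hom[OF M(2)] M_set_hom[OF M(3)]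
  note cl = M_mult_closed[OF M(1,2)] M_mult_closed[OF M(2,3)]
  have d1: "int p dvd det (block (cor (M_mult p es U V))) - det (block (cor U)) * det (block (cor V))"
    using dvd_add[OF det_block_cong[OF M_mult_cong[OF M(1,2)]] det_block_times[OF h(1), of "cor V"]] by simp
  have d2: "\<not> int p dvd det (block (cor U)) * det (block (cor V))"
    using U V prime_p by (simp add: carrier_R prime_dvd_mult_iff)
  show "U \<otimes>\<^bsub>R\<^esub> V \<in> carrier R"
    using cl(1) dvd_diff_iff[OF d1] d2 by (simp add: carrier_R)
  have "null.cong (cor (M_mult p es (M_mult p es U V) W)) (cor (M_mult p es U V) * cor W)"
    by (rule M_mult_cong[OF cl(1) M(3)])
  also have "null.cong \<dots> (cor U * cor V * cor W)"
    by (rule null.cong_right[OF M_mult_cong[OF M(1,2)] h(3)])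
  also have "cor U * cor V * cor W = cor U * (cor V * cor W)" by (simp add: mult.assoc)
  also have "null.cong \<dots> (cor U * cor (M_mult p es V W))"
    by (rule null.cong_left[OF null.cong_sym[OF M_mult_cong[OF M(2,3)]] h(1)])
  also have "null.cong \<dots> (cor (M_mult p es U (M_mult p es V W)))"
    by (rule null.cong_sym[OF M_mult_cong[OF M(1) cl(2)]])
  finally show "U \<otimes>\<^bsub>R\<^esub> V \<otimes>\<^bsub>R\<^esub> W = U \<otimes>\<^bsub>R\<^esub> (V \<otimes>\<^bsub>R\<^esub> W)"
    using M_set_eqI[OF M_mult_closed[OF cl(1) M(3)] M_mult_closed[OF M(1) cl(2)]] by simp
next
  have "1\<^sub>m s \<in> M_set p es"
    unfolding M_set_iff using null.cong_closed[OF cor_one] p_gt_1 ex_pos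
    by (auto intro: one_less_power)
  then show one: "\<one>\<^bsub>R\<^esub> \<in> carrier R"
    using p_gt_1 block_cor[of "1\<^sub>m s"] by (auto simp: carrier_R one_R)
  fix U assume U: "U \<in> carrier R"
  have M: "U \<in> M_set p es" "1\<^sub>m s \<in> M_set p es" using U one by (auto simp: carrier_R one_R)
  note h = M_set_hom[OF M(1)]
  have "null.cong (cor (M_mult p es (1\<^sub>m s) U)) (cor (1\<^sub>m s) * cor U)"
    by (rule M_mult_cong[OF M(2,1)])
  also have "null.cong \<dots> (1 * cor U)" by (rule null.cong_right[OF cor_one h])
  finally show "\<one>\<^bsub>R\<^esub> \<otimes>\<^bsub>R\<^esub> U = U"
    using M_set_eqI[OF M_mult_closed[OF M(2,1)] M(1)] by (simp add: one_R)
  \<comment> \<open>The inverse is a power: \<open>power_full_exponent\<close> speaks of ring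
    elements with determinant prime to \<open>p\<close> and is available before there is a
    group.\<close>
  define f where "f = cor U ^ (full_exponent - 1)"
  have f: "f \<in> hom_ring" using h by (auto simp: f_def)
  have "0 < gl_order" unfolding gl_order_def using p_gt_1 by (intro prod_pos) simp
  then have "0 < full_exponent" using p_gt_1 by (simp add: full_exponent_def)
  then have "f * cor U = cor U ^ full_exponent" unfolding f_def by (simp add: power_Suc2[symmetric] del: power_Suc)
  then have fU: "null.cong (f * cor U) 1"
    using power_full_exponent[OF h] U by (simp add: carrier_R)
  have uM: "uncorner f \<in> M_set p es" by (rule uncorner_M_set[OF f])
  have u1: "null.cong (cor (uncorner f) * cor U) 1"
    by (rule null.cong_trans[OF null.cong_right[OF uncorner_cong[OF f] h] fU])
  have "null.cong (cor (M_mult p es (uncorner f) U)) (cor (1\<^sub>m s))"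
    by (rule null.cong_trans[OF null.cong_trans[OF M_mult_cong[OF uM M(1)] u1] null.cong_sym[OF cor_one]])
  then have "M_mult p es (uncorner f) U = 1\<^sub>m s"
    by (rule M_set_eqI[OF M_mult_closed[OF uM M(1)] M(2)])
  moreover have "uncorner f \<in> carrier R"
    using uM det_block_nonzero_left[OF M_set_hom[OF uM] u1] by (simp add: carrier_R)
  ultimately show "\<exists>V \<in> carrier R. V \<otimes>\<^bsub>R\<^esub> U = \<one>\<^bsub>R\<^esub>" by (auto simp: one_R)
qed

interpretation R: group R by (rule group_R)

lemma R_inverse:
  assumes "U \<in> carrier R"
  shows "\<exists>g \<in> hom_ring. null.cong (g * cor U) 1"
proof -
  let ?V = "inv\<^bsub>R\<^esub> U"
  have V: "?V \<in> M_set p es" "U \<in> M_set p es" "M_mult p es ?V U = 1\<^sub>m s"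
    using R.inv_closed[OF assms] R.l_inv[OF assms] assms by (auto simp: carrier_R one_R)
  have "null.cong (cor ?V * cor U) 1"
    using null.cong_trans[OF null.cong_sym[OF M_mult_cong[OF V(1,2)]]] cor_one V(3) by simp
  then show ?thesis using M_set_hom[OF V(1)] by blast
qed

lemma cor_power:
  assumes U: "U \<in> carrier R"
  shows "null.cong (cor (U [^]\<^bsub>R\<^esub> (n::nat))) (cor U ^ n)"
proof (induction n)
  case 0
  show ?case using cor_one by (simp add: one_R)
next
  case (Suc n)
  have M: "U [^]\<^bsub>R\<^esub> n \<in> M_set p es" "U \<in> M_set p es"
    using R.nat_pow_closed[OF U, of n] U by (auto simp: carrier_R)
  have "null.cong (cor (U [^]\<^bsub>R\<^esub> Suc n)) (cor (U [^]\<^bsub>R\<^esub> n) * cor U)"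
    using M_mult_cong[OF M] by simp
  also have "null.cong \<dots> (cor U ^ n * cor U)"
    by (rule null.cong_right[OF Suc M_set_hom[OF M(2)]])
  finally show ?case by (simp add: power_Suc2 del: power_Suc)
qed

text \<open>The squares make the exponent congruent to 1 modulo \<open>p\<close>, so that averages need not be divided by it.\<close>

definition unit_exponent :: nat where "unit_exponent = (\<Prod>i < s. (p ^ Suc i - 1) ^ 2)"

lemma gl_order_factor: "gl_order = (\<Prod>i < s. p ^ i) * (\<Prod>i < s. p ^ Suc i - 1)"
proof -
  have "gl_order = (\<Prod>i < s. p ^ i * (p ^ (s - i) - 1))"
    unfolding gl_order_def by (rule prod.cong) (auto simp: diff_mult_distrib2 simp flip: power_add)
  also have "(\<Prod>i < s. p ^ i * (p ^ (s - i) - 1)) = (\<Prod>i < s. p ^ i) * (\<Prod>i < s. p ^ Suc (s - Suc i) - 1)"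
    unfolding prod.distrib by (intro arg_cong2[where f = "(*)"] prod.cong) (auto simp: Suc_diff_Suc simp del: power_Suc)
  also have "(\<Prod>i < s. p ^ Suc (s - Suc i) - 1) = (\<Prod>i < s. p ^ Suc i - 1)"
    by (rule prod.nat_diff_reindex)
  finally show ?thesis .
qed

text \<open>The order of \<open>U\<close> divides \<open>full_exponent\<close>, a power of
  \<open>p\<close> times the product of the \<open>p ^ Suc i - 1\<close>. Being prime to
  \<open>p\<close>, it divides that product and hence its square.\<close>

lemma power_unit_exponent:
  assumes U: "U \<in> carrier R" and ord: "coprime (group.ord R U) p"
  shows "null.cong (cor U ^ unit_exponent) 1"
proof -
  have M: "U \<in> M_set p es" using U by (simp add: carrier_R)
  have "null.cong (cor (U [^]\<^bsub>R\<^esub> full_exponent)) (cor \<one>\<^bsub>R\<^esub>)"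
    using null.cong_trans[OF cor_power[OF U] power_full_exponent[OF M_set_hom[OF M]]] U
      null.cong_sym[OF cor_one] by (auto simp: carrier_R one_R intro: null.cong_trans)
  then have "U [^]\<^bsub>R\<^esub> full_exponent = \<one>\<^bsub>R\<^esub>"
    using R.nat_pow_closed[OF U] R.one_closed by (intro M_set_eqI) (auto simp: carrier_R)
  then have "group.ord R U dvd full_exponent" using R.pow_eq_id[OF U] by simp
  also have "full_exponent = (\<Prod>i < s. p ^ Suc i - 1) * ((\<Prod>i < s. p ^ i) * p ^ ex (s - 1))"
    by (simp add: full_exponent_def gl_order_factor)
  also have "(\<Prod>i < s. p ^ i) * p ^ ex (s - 1) = p ^ (sum (\<lambda>i. i) {..<s} + ex (s - 1))"
    by (simp add: power_add power_sum)
  finally have "group.ord R U dvd (\<Prod>i < s. p ^ Suc i - 1)"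
    using ord by (simp add: coprime_dvd_mult_left_iff del: power_Suc)
  then have "group.ord R U dvd unit_exponent"
    unfolding unit_exponent_def prod_power_distrib[symmetric] by (simp add: power2_eq_square del: power_Suc)
  then have "U [^]\<^bsub>R\<^esub> unit_exponent = \<one>\<^bsub>R\<^esub>" using R.pow_eq_id[OF U] by simp
  then show ?thesis
    using null.cong_trans[OF null.cong_sym[OF cor_power[OF U, of unit_exponent]]] cor_one
    by (simp add: one_R)
qed

lemma unit_exponent_mod_p: "int p dvd int unit_exponent - 1"
proof -
  have "int p dvd int ((p ^ Suc i - 1) ^ 2) - 1" for i
  proof -
    have "1 \<le> p ^ Suc i" using p_gt_1 by simp
    then have eq: "int (p ^ Suc i - 1) = int p * int p ^ i - 1" by (simp add: of_nat_diff)
    have "int ((p ^ Suc i - 1) ^ 2) - 1 = int p * int p ^ i * (int p * int p ^ i - 2)"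
      unfolding of_nat_power eq by (simp add: power2_eq_square algebra_simps)
    then show ?thesis by (simp add: mult.assoc)
  qed
  then have "int p dvd (\<Prod>i < s. int ((p ^ Suc i - 1) ^ 2)) - (\<Prod>i < s. 1)"
    by (intro dvd_diff_prod)
  then show ?thesis by (simp add: unit_exponent_def)
qed

text \<open>Here a unit modulo the radical becomes an automorphism. Modulo \<open>p\<close> the
  block of \<open>Z * X\<close> vanishes below its diagonal blocks, which are identity matrices; so
  it agrees with the unitriangular \<open>T\<close>, and \<open>det (block X)\<close> divides 1
  modulo \<open>p\<close>.\<close>

lemma det_block_unitriangular:
  assumes X: "X \<in> hom_ring" and Z: "Z \<in> hom_ring" and r: "1 - Z * X \<in> rad_ideal"
  shows "\<not> int p dvd det (block X)"
proof
  assume d: "int p dvd det (block X)"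
  define T where "T = mat s s (\<lambda>(i, j). if i = j then 1 else if i < j then ent (Z * X) i j else 0)"
  have T: "T \<in> carrier_mat s s" by (simp add: T_def)
  have "upper_triangular T" by (auto simp: T_def upper_triangular_def)
  then have "det T = (\<Prod>i = 0..<s. T $$ (i, i))"
    using det_upper_triangular[OF _ T] prod_list_diag_prod[of T] T by simp
  also have "\<dots> = 1" by (simp add: T_def)
  finally have T1: "det T = 1" .
  have dT: "int p dvd det (block (Z * X)) - det T"
  proof (rule dvd_diff_det[OF block_carrier(1) T])
    fix i j assume ij: "i < s" "j < s"
    have eq: "int p dvd (if i = j then 1 else 0) - ent (Z * X) i j" if "ex i = ex j"
      using r that ex_pos[OF ij(1)] unfolding rad_ideal_def by auto
    show "int p dvd block (Z * X) $$ (i, j) - T $$ (i, j)"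
    proof (cases "j < i")
      case True
      then consider "ex i = ex j" | "ex j < ex i" using ex_mono[of j i] ij by linarith
      then have "int p dvd ent (Z * X) i j"
      proof cases
        case 1
        then show ?thesis using eq True by simp
      next
        case 2
        then show ?thesis by (rule hom_ring_less[OF hom_times[OF Z X]])
      qed
      then show ?thesis using ij True by (simp add: T_def)
    next
      case False
      then show ?thesis using ij eq by (auto simp: T_def dvd_diff_commute)
    qed
  qed
  have "int p dvd det (block (Z * X))"
    using dvd_diff_iff[OF det_block_times[OF Z, of X]] dvd_mult[OF d] by blast
  then have "int p dvd 1" using dvd_diff_iff[OF dT] unfolding T1 by blast
  then show False using p_gt_1 by simp
qed

lemma order_abelian_p_group: "Coset.order (abelian_p_group p es) = p ^ sum_list es"
proof -
  have "carrier (integer_mod_group (p ^ k)) = {0..<int (p ^ k)}" for k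
    using p_gt_1 by (simp add: carrier_integer_mod_group)
  then have "Coset.order (abelian_p_group p es) = (\<Prod>i < length es. p ^ (es ! i))"
    by (simp add: Coset.order_def abelian_p_group_def card_PiE del: of_nat_power)
  also have "\<dots> = p ^ sum_list es"
    by (simp add: power_sum[symmetric] sum_list_sum_nth atLeast0LessThan)
  finally show ?thesis .
qed

end

section \<open>Invariants of the algorithm\<close>

lemma gsum_left: "gsum P (P * W) Q n = P * gsum P W Q n"
  by (induction n) (simp_all add: algebra_simps)

lemma ent_elem_mat_sandwich: "ent (f * elem_mat a b * g) i j = ent f i a * ent g b j"
  by (subst ent_times_superset[of "{b}"]) (auto simp: ent_times_elem_mat)

section \<open>Generalised inverses modulo the radical by clearing entries one after the
  other\<close>

context prime_exponents
begin

text \<open>A number \<open>t\<close> encodes a matrix position in row-major order. The positions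
  with equal exponents are those that count modulo the radical.\<close>

abbreviation "same_block t \<equiv> ex (t div s) = ex (t mod s)"

lemma index_less: "t < s * s \<Longrightarrow> t div s < s" "t < s * s \<Longrightarrow> t mod s < s"
  using s_pos by (auto simp: less_mult_imp_div_less)

lemma pair_less:
  assumes "i < s" "j < s"
  shows "i * s + j < s * s"
proof -
  have "i * s + j < Suc i * s" using assms by simp
  also have "\<dots> \<le> s * s" using assms by (intro mult_le_mono1) simp
  finally show ?thesis .
qed

lemma elem_mat_hom: "ex a = ex b \<Longrightarrow> elem_mat a b \<in> hom_ring"
  by (auto simp: hom_ring_def ent_elem_mat)

lemma radI:
  assumes "f \<in> hom_ring" "\<And>t. t < s * s \<Longrightarrow> same_block t \<Longrightarrow> int p dvd ent f (t div s) (t mod s)"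
  shows "f \<in> rad_ideal"
  unfolding rad_ideal_def
proof (intro CollectI conjI allI impI)
  fix i j assume ij: "ex i = ex j" "0 < ex i"
  then have "i < s" and "j < s" by (auto simp: ex_pos_iff[symmetric])
  then have "i * s + j < s * s" by (rule pair_less)
  then show "int p dvd ent f i j"
    using assms(2)[of "i * s + j"] ij(1) \<open>j < s\<close> by simp
qed (rule assms)

text \<open>Positions are cleared in row-major order, and only inside the blocks of equal exponents.
  At \<open>t = s * s\<close> the residue \<open>y - y * v * y\<close> lies in the radical.\<close>

definition geninv_inv :: "rfmat \<Rightarrow> rfmat \<Rightarrow> nat \<Rightarrow> bool" where
  "geninv_inv y v t \<longleftrightarrow> v \<in> hom_ring \<and>
     (\<forall>t' < t. t' < s * s \<longrightarrow> same_block t' \<longrightarrow> int p dvd ent (y - y * v * y) (t' div s) (t' mod s))"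

lemma geninv_init: "geninv_inv y 0 0"
  by (auto simp: geninv_inv_def)

lemma geninv_skip:
  assumes "geninv_inv y v t"
    and "same_block t \<Longrightarrow> int p dvd ent (y - y * v * y) (t div s) (t mod s)"
  shows "geninv_inv y v (Suc t)"
  using assms by (auto simp: geninv_inv_def less_Suc_eq simp del: ent_diff)

text \<open>Wedderburn's rank reduction: the residue loses a row and a column modulo the radical.\<close>

lemma geninv_step:
  assumes y: "y \<in> hom_ring" and inv: "geninv_inv y v t" and t: "t < s * s" "same_block t"
    and c: "int p dvd c * ent (y - y * v * y) (t div s) (t mod s) - 1"
    and v': "v' = v + (1 - v * y) * (of_int c * elem_mat (t mod s) (t div s) * (1 - y * v))"
  shows "geninv_inv y v' (Suc t)"
proof -
  let ?r = "y - y * v * y"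
  let ?a = "t div s" and ?b = "t mod s"
  have v: "v \<in> hom_ring" using inv by (simp add: geninv_inv_def)
  have r: "?r \<in> hom_ring" using y v by auto
  have "v' \<in> hom_ring"
    unfolding v' using y v t(2) elem_mat_hom[of ?b ?a]
    by (auto intro!: null.add_closed null.mult_closed null.diff_closed null.of_int_closed)
  \<comment> \<open>The factors \<open>1 - v * y\<close> and \<open>1 - y * v\<close> in
    \<open>v'\<close> are there to turn into the residue on both sides of the elementary matrix.
    Thus column \<open>?b\<close> times row \<open>?a\<close> is subtracted, with \<open>c\<close>
    inverting the pivot.\<close>
  have "y - y * v' * y = ?r - ?r * (of_int c * elem_mat ?b ?a) * ?r"
    by (simp add: v' algebra_simps)
  also have "?r * (of_int c * elem_mat ?b ?a) * ?r = of_int c * (?r * elem_mat ?b ?a * ?r)"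
    by (metis mult.assoc mult_of_int_commute)
  finally have "y - y * v' * y = ?r - of_int c * (?r * elem_mat ?b ?a * ?r)" .
  then have eq: "ent (y - y * v' * y) i j = ent ?r i j - c * (ent ?r i ?b * ent ?r ?a j)" for i j
    by (simp only: ent_diff[of ?r "of_int c * f" for f] ent_of_int_times ent_elem_mat_sandwich)
  have "int p dvd ent (y - y * v' * y) (t' div s) (t' mod s)"
    if t': "t' < Suc t" "t' < s * s" "same_block t'" for t'
  proof (cases "t' = t")
    case True
    have "ent ?r ?a ?b - c * (ent ?r ?a ?b * ent ?r ?a ?b) = - ((c * ent ?r ?a ?b - 1) * ent ?r ?a ?b)"
      by (simp add: algebra_simps)
    then show ?thesis using c True unfolding eq by (metis dvd_minus_iff dvd_mult2)
  next
    case False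
    then have less: "t' < t" using t' by simp
    let ?i = "t' div s" and ?j = "t' mod s"
    have old: "int p dvd ent ?r (t'' div s) (t'' mod s)" if "t'' < t" "same_block t''" for t''
      using inv that t(1) by (simp add: geninv_inv_def)
    \<comment> \<open>Positions cleared before stay cleared. In the row of the pivot the second
      factor was cleared earlier, in an earlier row of equal exponent the first one was; if the
      exponents differ, one of the factors is divisible by \<open>p\<close> anyway.\<close>
    have new: "int p dvd ent ?r ?i ?b * ent ?r ?a ?j"
    proof -
      consider "ex ?i < ex ?a" | "ex ?a < ex ?i" | "ex ?i = ex ?a" by linarith
      then show ?thesis
      proof cases
        case 1
        then show ?thesis using hom_ring_less[OF r, of ?j ?a] t'(3) by simp
      next
        case 2
        then show ?thesis using hom_ring_less[OF r, of ?b ?i] t(2) by simp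
      next
        case 3
        show ?thesis
        proof (cases "?i = ?a")
          case True
          then have "int p dvd ent ?r ?a ?j" using old[OF less t'(3)] by simp
          then show ?thesis by simp
        next
          case False
          moreover have "?i \<le> ?a" using less by (simp add: div_le_mono)
          ultimately have "?i < ?a" by simp
          then have "?i * s + ?b < t"
          proof -
            have "?i * s + ?b < Suc ?i * s" using s_pos by simp
            also have "\<dots> \<le> ?a * s" using \<open>?i < ?a\<close> by (intro mult_le_mono1) simp
            also have "\<dots> \<le> t" by simp
            finally show ?thesis .
          qed
          then have "int p dvd ent ?r ?i ?b"
            using old[of "?i * s + ?b"] 3 t(2) s_pos by simp
          then show ?thesis by simp
        qed
      qed
    qed
    show ?thesis unfolding eq by (rule dvd_diff[OF old[OF less t'(3)] dvd_mult[OF new]])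
  qed
  then show ?thesis using \<open>v' \<in> hom_ring\<close> by (auto simp: geninv_inv_def simp del: ent_diff)
qed

lemma geninv_final:
  assumes "y \<in> hom_ring" "geninv_inv y v (s * s)"
  shows "y * v * y - y \<in> rad_ideal" "v \<in> hom_ring"
proof -
  show v: "v \<in> hom_ring" using assms(2) by (simp add: geninv_inv_def)
  have "y - y * v * y \<in> rad_ideal"
    by (rule radI) (use assms v in \<open>auto simp: geninv_inv_def simp del: ent_diff\<close>)
  then show "y * v * y - y \<in> rad_ideal" using rad.ideal_uminus[of "y - y * v * y"] by simp
qed

end

section \<open>The invariant of the main loop and its completeness\<close>

locale semisimple_pair = prime_exponents +
  fixes u1 u2 :: rfmat
  assumes u1: "u1 \<in> hom_ring" and u2: "u2 \<in> hom_ring"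
    and u1_exp: "null.cong (u1 ^ unit_exponent) 1" and u2_exp: "null.cong (u2 ^ unit_exponent) 1"
begin

definition trace_elem :: "nat \<Rightarrow> rfmat" where
  "trace_elem t = gsum u2 (elem_mat (t div s) (t mod s)) u1 unit_exponent"

text \<open>The commutation relations are congruences modulo \<open>null_ideal\<close>, so
  \<open>x\<close> and \<open>z\<close> intertwine exactly in \<open>End A\<close>; the other
  conditions hold modulo the radical, which is all that inversion needs.\<close>

definition main_inv :: "rfmat \<Rightarrow> rfmat \<Rightarrow> nat \<Rightarrow> bool" where
  "main_inv x z t \<longleftrightarrow>
     x \<in> hom_ring \<and> z \<in> hom_ring \<and>
     null.cong (u2 * x) (x * u1) \<and> null.cong (u1 * z) (z * u2) \<and>
     x * z * x - x \<in> rad_ideal \<and>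
     (\<forall>t' < t. same_block t' \<longrightarrow> (1 - x * z) * trace_elem t' * (1 - z * x) \<in> rad_ideal)"

lemma main_init: "main_inv 0 0 0"
  by (auto simp: main_inv_def)

lemma main_skip: "main_inv x z t \<Longrightarrow> \<not> same_block t \<Longrightarrow> main_inv x z (Suc t)"
  by (auto simp: main_inv_def less_Suc_eq)

text \<open>Composition of intertwiners; \<open>k\<close> acts on the module in the middle, and its
  instances \<open>u1\<close> and \<open>u2\<close> record the direction of each factor.\<close>

lemma commute_mult:
  assumes "a \<in> hom_ring" "b \<in> hom_ring" "c \<in> hom_ring" "d \<in> hom_ring" "k \<in> hom_ring"
    and "null.cong (a * c) (c * k)" "null.cong (k * d) (d * b)"
  shows "null.cong (a * (c * d)) (c * d * b)"
proof -
  have "null.cong (a * c * d) (c * k * d)" using assms by (intro null.cong_right)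
  moreover have "null.cong (c * (k * d)) (c * (d * b))" using assms by (intro null.cong_left)
  ultimately show ?thesis by (simp only: mult.assoc) (rule null.cong_trans)
qed

lemma commute_diff:
  assumes "null.cong (a * c) (c * k)" "null.cong (a * d) (d * k)"
  shows "null.cong (a * (c - d)) ((c - d) * k)"
  using null.cong_diff[OF assms] by (simp add: algebra_simps)

lemma commute_add:
  assumes "null.cong (a * c) (c * k)" "null.cong (a * d) (d * k)"
  shows "null.cong (a * (c + d)) ((c + d) * k)"
  using null.cong_add[OF assms] by (simp add: algebra_simps)

text \<open>The point is that averaging \<open>v\<close> keeps it a generalised inverse of
  \<open>y\<close>. Since \<open>y * e\<close> and \<open>f * y\<close> are \<open>y\<close> modulo
  the radical, \<open>y * w * y\<close> becomes \<open>u2\<close> times the average of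
  \<open>y * v * y\<close>, thus of \<open>y\<close>, which is \<open>y\<close> because
  \<open>unit_exponent\<close> is 1 modulo \<open>p\<close>. The factor \<open>u1\<close> in
  \<open>w\<close> makes up for the power missing in \<open>gsum\<close>.\<close>

lemma main_step:
  assumes inv: "main_inv x z t" and t: "same_block t"
    and e: "e = 1 - z * x" and f: "f = 1 - x * z"
    and y: "y = f * trace_elem t * e"
    and v: "v \<in> hom_ring" and yv: "y * v * y - y \<in> rad_ideal"
    and w: "w = e * (u1 * gsum u1 v u2 unit_exponent) * f"
  shows "main_inv (x + y) (z * x * z + w) (Suc t)"
proof -
  let ?N = unit_exponent
  let ?g = "gsum u1 v u2 ?N"
  note xz = inv[unfolded main_inv_def]
  have S: "x \<in> hom_ring" "z \<in> hom_ring" using xz by auto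
  have ef: "e \<in> hom_ring" "f \<in> hom_ring" using S by (auto simp: e f)
  have tS: "trace_elem t \<in> hom_ring"
    unfolding trace_elem_def using elem_mat_hom[of "t div s" "t mod s"] t u1 u2 by auto
  have gS: "?g \<in> hom_ring" using v u1 u2 by auto
  have yS: "y \<in> hom_ring" using ef tS by (auto simp: y)
  have c_one: "null.cong (a * 1) (1 * a)" for a by simp
  have e_com: "null.cong (u1 * e) (e * u1)"
    unfolding e using xz S u1 u2 by (intro commute_diff c_one commute_mult[where k = u2]) auto
  have f_com: "null.cong (u2 * f) (f * u2)"
    unfolding f using xz S u1 u2 by (intro commute_diff c_one commute_mult[where k = u1]) auto
  have "null.cong (u2 * trace_elem t) (trace_elem t * u1)"
    unfolding trace_elem_def
    using u1 u2 u1_exp u2_exp elem_mat_hom[of "t div s" "t mod s"] t by (intro null.gsum_commute)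
  then have y_com: "null.cong (u2 * y) (y * u1)"
    unfolding y using e_com f_com u1 u2 ef tS
    by (intro commute_mult[where k = u1] commute_mult[where k = u2] null.mult_closed)
  have g_com: "null.cong (u1 * ?g) (?g * u2)"
    using u1 u2 u1_exp u2_exp v by (intro null.gsum_commute)
  have w_com: "null.cong (u1 * w) (w * u2)"
    unfolding w using e_com f_com g_com u1 u2 ef gS
    by (intro commute_mult[where k = u1] commute_mult[where k = u2] null.mult_closed null.cong_refl)
  have z_com: "null.cong (u1 * (z * x * z)) (z * x * z * u2)"
    using xz S u1 u2
    by (intro commute_mult[where k = u1] commute_mult[where k = u2] null.mult_closed) auto
  have "rad.cong (y * w * y) y"
  proof -
    have xr: "x * z * x - x \<in> rad_ideal" using xz by blast
    have y0: "y = f * trace_elem t * e" by (rule y)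
    have fy: "rad.cong (f * y) y"
    proof -
      have "f * y - y = (x * z * x - x) * (z * trace_elem t * e)"
        by (simp add: y f algebra_simps)
      then show ?thesis using xr S tS ef by (auto simp: rad.cong_def)
    qed
    have ye: "rad.cong (y * e) y"
    proof -
      have "y * e - y = f * trace_elem t * z * (x * z * x - x)"
        by (simp add: y e algebra_simps)
      then show ?thesis using xr S tS ef by (auto simp: rad.cong_def)
    qed
    have "y * w * y = (y * e) * (u1 * ?g) * (f * y)" by (simp add: w mult.assoc)
    also have "rad.cong \<dots> (y * (u1 * ?g) * y)"
      using ye fy u1 gS yS ef by (intro rad.cong_mult rad.cong_refl null.mult_closed)
    also have "y * (u1 * ?g) * y = (y * u1) * (?g * y)" by (simp add: mult.assoc)
    also have "rad.cong \<dots> ((u2 * y) * (?g * y))"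
      using null_rad_cong[OF null.cong_sym[OF y_com]] gS yS by (intro rad.cong_right null.mult_closed)
    also have "(u2 * y) * (?g * y) = u2 * (y * ?g * y)" by (simp add: mult.assoc)
    also have "rad.cong \<dots> (u2 * gsum u2 (y * v * y) u1 ?N)"
      using null_rad_cong[OF null.gsum_sandwich[OF yS v u2 u1 y_com]] u2 by (rule rad.cong_left)
    also have "rad.cong \<dots> (u2 * gsum u2 y u1 ?N)"
      using yv u1 u2 by (intro rad.cong_left rad.gsum_cong) (simp_all add: rad.cong_def)
    also have "rad.cong \<dots> (of_nat ?N * (u2 ^ ?N * y))"
      by (rule null_rad_cong[OF null.gsum_intertwiner[OF u2 u1 yS y_com]])
    also have "rad.cong \<dots> (of_nat ?N * (1 * y))"
      using null_rad_cong[OF u2_exp] yS by (intro rad.cong_left rad.cong_right null.of_nat_closed)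
    also have "rad.cong \<dots> y"
    proof -
      have "of_nat ?N * (1 * y) - y = of_int (int ?N - 1) * y" by (simp add: algebra_simps)
      then show ?thesis
        unfolding rad.cong_def using multiple_p_rad[OF yS unit_exponent_mod_p] by simp
    qed
    finally show ?thesis .
  qed
  then have yw: "y * w * y - y \<in> rad_ideal" by (simp add: rad.cong_def)
  have "u1 * ?g \<in> hom_ring" using u1 gS by auto
  note ext = rad.geninv_extend[OF S tS this _ e f y w yw refl refl refl refl]
  have xr: "x * z * x - x \<in> rad_ideal" using xz by blast
  have "(1 - (x + y) * (z * x * z + w)) * trace_elem t' * (1 - (z * x * z + w) * (x + y)) \<in> rad_ideal"
    if "t' < Suc t" "same_block t'" for t'
  proof (cases "t' = t")
    case True
    then show ?thesis using ext(3)[OF xr] by simp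
  next
    case False
    then have "f * trace_elem t' * e \<in> rad_ideal" using that xz by (simp add: e f)
    moreover have "trace_elem t' \<in> hom_ring"
      unfolding trace_elem_def using elem_mat_hom[of "t' div s" "t' mod s"] that u1 u2 by auto
    ultimately show ?thesis using ext(2)[OF xr] by blast
  qed
  moreover have "x + y \<in> hom_ring" "z * x * z + w \<in> hom_ring"
    using S ef yS gS u1 by (auto simp: w intro!: null.add_closed null.mult_closed)
  ultimately show ?thesis
    unfolding main_inv_def using ext(1)[OF xr] commute_add y_com z_com w_com xz by blast
qed

text \<open>An intertwiner is its own average up to one power of \<open>u2\<close>. Averaging the
  expansion of \<open>u2 * Y\<close> into elementary matrices therefore writes \<open>Y\<close> as a
  combination of the averaged ones, modulo the radical.\<close>

lemma trace_elems_span: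
  assumes Y: "Y \<in> hom_ring" "null.cong (u2 * Y) (Y * u1)" and f: "f \<in> hom_ring" and e: "e \<in> hom_ring"
    and van: "\<And>t. t < s * s \<Longrightarrow> same_block t \<Longrightarrow> f * trace_elem t * e \<in> rad_ideal"
  shows "f * Y * e \<in> rad_ideal"
proof -
  let ?N = unit_exponent
  define D where "D = u2 * Y"
  have D: "D \<in> hom_ring" using Y u2 by (auto simp: D_def)
  define T where "T = {t. t < s * s \<and> same_block t}"
  define c where "c t = ent D (t div s) (t mod s)" for t
  have T: "finite T" by (rule finite_subset[of _ "{..<s * s}"]) (auto simp: T_def)
  have em: "elem_mat (t div s) (t mod s) \<in> hom_ring" if "t \<in> T" for t
    using that by (intro elem_mat_hom) (auto simp: T_def)
  let ?D = "\<Sum>t\<in>T. of_int (c t) * elem_mat (t div s) (t mod s)"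
  have "?D \<in> hom_ring"
    using em by (intro null.sum_closed null.mult_closed null.of_int_closed)
  \<comment> \<open>The expansion leaves out all entries between different exponents; they do not
    count modulo the radical.\<close>
  have "D - ?D \<in> rad_ideal"
  proof (rule radI)
    show "D - ?D \<in> hom_ring" using D \<open>?D \<in> hom_ring\<close> by auto
    fix t assume t: "t < s * s" "same_block t"
    have "ent ?D (t div s) (t mod s) = (\<Sum>t'\<in>T. if t' = t then c t' else 0)"
      unfolding ent_sum ent_of_int_times ent_elem_mat
      by (rule sum.cong) (auto, metis div_mult_mod_eq)
    also have "\<dots> = ent D (t div s) (t mod s)" using t T by (simp add: T_def c_def)
    finally show "int p dvd ent (D - ?D) (t div s) (t mod s)" by simp
  qed
  then have "rad.cong (gsum u2 D u1 ?N) (gsum u2 ?D u1 ?N)"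
    using u1 u2 by (intro rad.gsum_cong) (simp_all add: rad.cong_def)
  moreover have "gsum u2 ?D u1 ?N = (\<Sum>t\<in>T. of_int (c t) * trace_elem t)"
    unfolding gsum_sum gsum_of_int_mult trace_elem_def ..
  moreover have "rad.cong (gsum u2 D u1 ?N) Y"
  proof -
    have "gsum u2 D u1 ?N = u2 * gsum u2 Y u1 ?N" by (simp add: D_def gsum_left)
    also have "rad.cong \<dots> (of_nat ?N * (u2 ^ ?N * Y))"
      by (rule null_rad_cong[OF null.gsum_intertwiner[OF u2 u1 Y]])
    also have "rad.cong \<dots> (of_nat ?N * (1 * Y))"
      using null_rad_cong[OF u2_exp] Y(1) by (intro rad.cong_left rad.cong_right null.of_nat_closed)
    also have "rad.cong \<dots> Y"
    proof -
      have "of_nat ?N * (1 * Y) - Y = of_int (int ?N - 1) * Y" by (simp add: algebra_simps)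
      then show ?thesis
        unfolding rad.cong_def using multiple_p_rad[OF Y(1) unit_exponent_mod_p] by simp
    qed
    finally show ?thesis .
  qed
  ultimately have "rad.cong Y (\<Sum>t\<in>T. of_int (c t) * trace_elem t)"
    using rad.cong_trans[OF rad.cong_sym] by metis
  then have "rad.cong (f * Y * e) (f * (\<Sum>t\<in>T. of_int (c t) * trace_elem t) * e)"
    using f e by (intro rad.cong_right rad.cong_left)
  also have "f * (\<Sum>t\<in>T. of_int (c t) * trace_elem t) * e = (\<Sum>t\<in>T. of_int (c t) * (f * trace_elem t * e))"
    unfolding sum_distrib_left sum_distrib_right
    by (rule sum.cong[OF refl]) (metis mult.assoc mult_of_int_commute)
  finally show ?thesis
    by (rule rad.cong_ideal, intro rad.ideal_sum rad.ideal_left[OF null.of_int_closed] van)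
      (auto simp: T_def)
qed

text \<open>As \<open>z\<close> intertwines backwards, every \<open>Phi * (z * Phi) ^ j\<close> is
  again an intertwiner from \<open>u1\<close> to \<open>u2\<close>, so the span of the averaged
  elementary matrices covers all instances required by \<open>geninv_complete\<close>.\<close>

lemma main_complete:
  assumes inv: "main_inv x z (s * s)"
    and Phi: "Phi \<in> hom_ring" "null.cong (u2 * Phi) (Phi * u1)"
    and Psi: "Psi \<in> hom_ring" "null.cong (Psi * Phi) 1"
  shows "1 - z * x \<in> rad_ideal"
proof -
  note xz = inv[unfolded main_inv_def]
  have S: "x \<in> hom_ring" "z \<in> hom_ring" using xz by auto
  have ef: "1 - z * x \<in> hom_ring" "1 - x * z \<in> hom_ring" using S by auto
  have cl: "Phi * (z * Phi) ^ j \<in> hom_ring" for j using S Phi by auto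
  have com: "null.cong (u2 * (Phi * (z * Phi) ^ j)) (Phi * (z * Phi) ^ j * u1)" for j
  proof (induction j)
    case (Suc j)
    have "Phi * (z * Phi) ^ Suc j = (Phi * (z * Phi) ^ j) * (z * Phi)"
      by (simp add: power_Suc2 mult.assoc del: power_Suc)
    moreover have "null.cong (u1 * (z * Phi)) (z * Phi * u1)"
      using S Phi xz u1 u2 by (intro commute_mult[where k = u2]) auto
    ultimately show ?case
      using Suc cl S Phi u1 u2 by (auto intro!: commute_mult[where k = u1])
  qed (use Phi in simp)
  have van: "(1 - x * z) * (Phi * (z * Phi) ^ j) * (1 - z * x) \<in> rad_ideal" for j
    by (rule trace_elems_span[OF cl com ef(2,1)]) (use xz in simp)
  have xr: "x * z * x - x \<in> rad_ideal" using xz by blast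
  show ?thesis
    by (rule rad.geninv_complete[OF S Phi(1) Psi(1) xr null_rad_cong[OF Psi(2)] refl refl van
          rad_finite_quotient])
qed

end

section \<open>Weakest preconditions\<close>

locale machine =
  fixes B M :: nat
  assumes MB: "M \<le> B"
begin

text \<open>Safety is included, so that one derivation yields both the correctness of a program and
  the bound on its running time.\<close>

definition wp :: "prog \<Rightarrow> (memory \<Rightarrow> bool) \<Rightarrow> memory \<Rightarrow> bool" where
  "wp P Q m \<longleftrightarrow> safe B M P m \<and> Q (sem P m)"

lemma wp_assign: "wp (PAssign x i a) Q m \<longleftrightarrow> aval a m \<le> B \<and> Q (store x (aval i m) (aval a m) m)"
  by (simp add: wp_def)

lemma wp_seq: "wp (PSeq P P') Q m \<longleftrightarrow> wp P (wp P' Q) m"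
  by (auto simp: wp_def)

lemma wp_if: "wp (PIf b P) Q m \<longleftrightarrow> (if bval b m then wp P Q m else Q m)"
  by (simp add: wp_def)

lemma wp_conseq:
  assumes "bounded B m" "wp P Q m"
    and "\<And>m'. bounded B m' \<Longrightarrow> (\<And>y. y \<notin> writes P \<Longrightarrow> m' y = m y) \<Longrightarrow> Q m' \<Longrightarrow> Q' m'"
  shows "wp P Q' m"
  using assms safe_bounded[OF MB _ assms(1)] sem_other unfolding wp_def by blast

text \<open>Bounded memory and untouched arrays come for free in each round. The invariant for
  \<open>Suc k\<close> is demanded after the counter has advanced, as in
  \<open>count_loop\<close>.\<close>

lemma wp_for:
  assumes m: "bounded B m" and n: "aval a m = n" "n \<le> M"
    and init: "I 0 (store x 0 0 m)"
    and step: "\<And>k m'. k < n \<Longrightarrow> bounded B m' \<Longrightarrow> m' x 0 = k \<Longrightarrow>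
      (\<And>y. y \<notin> insert x (writes P) \<Longrightarrow> m' y = m y) \<Longrightarrow> I k m' \<Longrightarrow>
      wp P (\<lambda>m''. I (Suc k) (store x 0 (Suc k) m'')) m'"
    and final: "\<And>m'. bounded B m' \<Longrightarrow> (\<And>y. y \<notin> insert x (writes P) \<Longrightarrow> m' y = m y) \<Longrightarrow> I n m' \<Longrightarrow> Q m'"
  shows "wp (PFor x a P) Q m"
proof -
  let ?F = "\<lambda>k. count_loop x (sem P) k m"
  have other: "?F k y = m y" if "y \<notin> insert x (writes P)" for k y
    using that by (intro count_loop_other[where W = "writes P"] sem_other) auto
  have inv: "k \<le> n \<Longrightarrow> bounded B (?F k) \<and> I k (?F k) \<and> (\<forall>j < k. safe B M P (?F j))" for k
  proof (induction k)
    case 0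
    show ?case using m init by (auto intro: bounded_store)
  next
    case (Suc k)
    then have k: "bounded B (?F k)" "I k (?F k)" "k < n" "\<forall>j < k. safe B M P (?F j)" by auto
    have w: "wp P (\<lambda>m''. I (Suc k) (store x 0 (Suc k) m'')) (?F k)"
      by (rule step[OF k(3,1) count_loop_counter other k(2)])
    then have s: "safe B M P (?F k)" by (simp add: wp_def)
    have "bounded B (sem P (?F k))" by (rule safe_bounded[OF MB s k(1)])
    then have "bounded B (?F (Suc k))" using Suc.prems n(2) MB by (auto intro: bounded_store)
    then show ?case using w s k(4) by (auto simp: wp_def less_Suc_eq)
  qed
  show ?thesis
    using inv[of n] final[of "?F n", OF _ other] n by (auto simp: wp_def)
qed

end

section \<open>Matrix registers\<close>

text \<open>\<open>D := C + X * Y\<close>, row \<open>i\<close> being reduced modulo \<open>p ^ e i\<close>.  The result is built up in \<open>T\<close> because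
  \<open>D\<close> may be one of the operands.\<close>

definition mac :: "string \<Rightarrow> string \<Rightarrow> string \<Rightarrow> string \<Rightarrow> prog" where
  "mac D C X Y = PSeq
     (PFor ''t'' (var ''ss'') (PSeq
       (PAssign ''T'' (var ''t'') (Read C (var ''t'')))
       (PFor ''k'' (var ''s'')
         (PAssign ''T'' (var ''t'')
           (ModE
             (AddE (Read ''T'' (var ''t''))
               (MulE (Read X (AddE (MulE (DivE (var ''t'') (var ''s'')) (var ''s'')) (var ''k'')))
                     (Read Y (AddE (MulE (var ''k'') (var ''s'')) (ModE (var ''t'') (var ''s''))))))
             (Read ''Q'' (var ''t'')))))))
     (PFor ''t'' (var ''ss'') (PAssign D (var ''t'') (Read ''T'' (var ''t''))))"

definition regs :: "string set" where
  "regs = {''U'', ''Z'', ''E'', ''F'', ''G'', ''Y'', ''V'', ''L'', ''H'', ''W'', ''S'', ''SQ'', ''D'', ''DP'', ''DQ'', ''X''}"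

text \<open>Identity, minus identity, zero and the two inputs. As \<open>mac\<close> can only add a
  product, differences are formed with ''NI''.\<close>

definition const_regs :: "string set" where
  "const_regs = {''I'', ''NI'', ''O'', ''U1'', ''U2''}"

definition temps :: "string set" where
  "temps = {''T'', ''t'', ''k''}"

definition globals :: "string set" where
  "globals = {''s'', ''ss'', ''p'', ''K'', ''N'', ''e'', ''Q''}"

lemma names_disjoint:
  "regs \<inter> const_regs = {}" "regs \<inter> temps = {}" "regs \<inter> globals = {}"
  "const_regs \<inter> temps = {}" "const_regs \<inter> globals = {}" "temps \<inter> globals = {}"
  by (simp_all add: regs_def const_regs_def temps_def globals_def)

type_synonym reg_op = "string \<times> string \<times> string \<times> string"

text \<open>The language has no empty program, so the empty list writes to a temporary
  variable.\<close>

primrec macs :: "reg_op list \<Rightarrow> prog" where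
  "macs [] = PAssign ''t'' (Lit 0) (Lit 0)"
| "macs (c # cs) = PSeq (case c of (D, C, X, Y) \<Rightarrow> mac D C X Y) (macs cs)"

text \<open>Symbolic execution with exact ring elements as register contents; the memory holds them
  only up to \<open>null_ideal\<close>.\<close>

primrec run :: "reg_op list \<Rightarrow> (string \<Rightarrow> rfmat) \<Rightarrow> string \<Rightarrow> rfmat" where
  "run [] \<sigma> = \<sigma>"
| "run (c # cs) \<sigma> = run cs (case c of (D, C, X, Y) \<Rightarrow> \<sigma>(D := \<sigma> C + \<sigma> X * \<sigma> Y))"

lemma writes_mac: "writes (mac D C X Y) = {''t'', ''T'', ''k'', D}"
  by (auto simp: mac_def)

lemma wf_mac: "D \<notin> {''t'', ''ss''} \<Longrightarrow> wf_prog (mac D C X Y)"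
  by (auto simp: mac_def)

text \<open>\<open>K\<close> bounds the number of binary digits of the two exponents treated by
  repeated squaring, \<open>unit_exponent\<close> and \<open>p - 2\<close>.\<close>

locale algorithm = semisimple_pair p es u1 u2 + machine B M
  for p :: nat and es u1 u2 B M +
  fixes K :: nat
  assumes pow_bound: "p ^ ex i \<le> B" and exponent_bound: "unit_exponent \<le> B" and p_bound: "p \<le> B"
    and size_bound: "s * s \<le> M" and K_bound: "K \<le> M"
    and exponent_less: "unit_exponent < 2 ^ K" and p_less: "p < 2 ^ K"
begin

text \<open>Any representatives are allowed; \<open>in_range\<close> records reduced ones
  separately, since \<open>M(A)\<close> asks for them in the answer.\<close>

definition holds :: "memory \<Rightarrow> string \<Rightarrow> rfmat \<Rightarrow> bool" where
  "holds m x f \<longleftrightarrow> f \<in> hom_ring \<and>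
     (\<forall>t < s * s. pp (ex (t div s)) dvd int (m x t) - ent f (t div s) (t mod s))"

definition in_range :: "memory \<Rightarrow> string \<Rightarrow> bool" where
  "in_range m x \<longleftrightarrow> (\<forall>t < s * s. m x t < p ^ ex (t div s))"

definition globals_ok :: "memory \<Rightarrow> bool" where
  "globals_ok m \<longleftrightarrow> m ''s'' 0 = s \<and> m ''ss'' 0 = s * s \<and> m ''p'' 0 = p \<and> m ''K'' 0 = K \<and>
     m ''N'' 0 = unit_exponent \<and> (\<forall>i < s. m ''e'' i = ex i) \<and>
     (\<forall>t < s * s. m ''Q'' t = p ^ ex (t div s))"

definition state :: "memory \<Rightarrow> (string \<Rightarrow> rfmat) \<Rightarrow> bool" where
  "state m \<sigma> \<longleftrightarrow> globals_ok m \<and> (\<forall>x \<in> regs \<union> const_regs. holds m x (\<sigma> x))"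

definition consts_ok :: "(string \<Rightarrow> rfmat) \<Rightarrow> bool" where
  "consts_ok \<sigma> \<longleftrightarrow> \<sigma> ''I'' = 1 \<and> \<sigma> ''NI'' = -1 \<and> \<sigma> ''O'' = 0 \<and> \<sigma> ''U1'' = u1 \<and> \<sigma> ''U2'' = u2"

lemma s_bound: "s \<le> M"
  using size_bound s_pos by (metis le_square le_trans)

lemma globals_cong: "(\<And>y. y \<in> globals \<Longrightarrow> m' y = m y) \<Longrightarrow> globals_ok m \<Longrightarrow> globals_ok m'"
  by (simp add: globals_ok_def globals_def)

lemma state_cong:
  assumes "state m \<sigma>" "\<And>y. y \<in> globals \<union> regs \<union> const_regs \<Longrightarrow> m' y = m y"
  shows "state m' \<sigma>"
proof -
  have "holds m' x (\<sigma> x)" if "x \<in> regs \<union> const_regs" for x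
    using assms(1) assms(2)[of x] that unfolding state_def holds_def by simp
  then show ?thesis using assms globals_cong[of m' m] unfolding state_def by blast
qed

lemma wp_mac_raw:
  assumes m: "bounded B m" "globals_ok m"
    and D: "D \<notin> globals \<union> temps" and CXY: "C \<notin> temps" "X \<notin> temps" "Y \<notin> temps"
    and Q: "\<And>m'. bounded B m' \<Longrightarrow> (\<And>y. y \<notin> insert D temps \<Longrightarrow> m' y = m y) \<Longrightarrow>
      (\<And>t. t < s * s \<Longrightarrow> m' D t < p ^ ex (t div s) \<and>
        pp (ex (t div s)) dvd int (m' D t) -
          (int (m C t) + (\<Sum>k < s. int (m X (t div s * s + k)) * int (m Y (k * s + t mod s))))) \<Longrightarrow>
      Q m'"
  shows "wp (mac D C X Y) Q m"
proof -
  let ?G = "\<lambda>t k. int (m C t) + (\<Sum>l < k. int (m X (t div s * s + l)) * int (m Y (l * s + t mod s)))"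
  define J where "J t v \<longleftrightarrow> v < p ^ ex (t div s) \<and> pp (ex (t div s)) dvd int v - ?G t s" for t v
  note g = m(2)[unfolded globals_ok_def]
  note ns = temps_def globals_def
  let ?upd = "PAssign ''T'' (var ''t'')
           (ModE
             (AddE (Read ''T'' (var ''t''))
               (MulE (Read X (AddE (MulE (DivE (var ''t'') (var ''s'')) (var ''s'')) (var ''k'')))
                     (Read Y (AddE (MulE (var ''k'') (var ''s'')) (ModE (var ''t'') (var ''s''))))))
             (Read ''Q'' (var ''t'')))"
  let ?inner = "PFor ''k'' (var ''s'') ?upd"
  let ?row = "PSeq (PAssign ''T'' (var ''t'') (Read C (var ''t''))) ?inner"
  let ?copy = "PAssign D (var ''t'') (Read ''T'' (var ''t''))"
  show ?thesis unfolding mac_def wp_seq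
  proof (rule wp_for[where n = "s * s" and I = "\<lambda>t m'. \<forall>t' < t. J t' (m' ''T'' t')"])
    fix t m1
    assume t: "t < s * s" and b1: "bounded B m1" and c1: "m1 ''t'' 0 = t"
      and f1: "\<And>y. y \<notin> insert ''t'' (writes ?row) \<Longrightarrow> m1 y = m y"
      and I1: "\<forall>t' < t. J t' (m1 ''T'' t')"
    have g1: "m1 ''s'' = m ''s''" "m1 C = m C" "m1 X = m X" "m1 Y = m Y" "m1 ''Q'' = m ''Q''"
      using CXY by (auto simp: ns intro!: f1)
    define m2 where "m2 = store ''T'' t (m C t) m1"
    have "m C t \<le> B" using m(1) by (simp add: bounded_def)
    then have b2: "bounded B m2" unfolding m2_def by (rule bounded_store[OF b1])
    have g2: "m2 ''s'' 0 = s" "m2 C = m C" "m2 X = m X" "m2 Y = m Y" "m2 ''Q'' t = p ^ ex (t div s)"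
      "m2 ''t'' 0 = t" "m2 ''T'' = (m1 ''T'')(t := m C t)"
      using g1 g t CXY c1 by (auto simp: m2_def ns)
    have "wp ?inner
       (\<lambda>m''. \<forall>t' < Suc t. J t' (store ''t'' 0 (Suc t) m'' ''T'' t')) m2"
    \<comment> \<open>The entry copied from \<open>C\<close> may be unreduced, so the range is
      claimed from the first round on; \<open>s > 0\<close> guarantees one.\<close>
    proof (rule wp_for[where n = s and I = "\<lambda>k m'. (\<forall>t' < t. m' ''T'' t' = m1 ''T'' t') \<and>
          pp (ex (t div s)) dvd int (m' ''T'' t) - ?G t k \<and> (0 < k \<longrightarrow> m' ''T'' t < p ^ ex (t div s))"])
      fix k m3
      assume k: "k < s" and c3: "m3 ''k'' 0 = k"
        and f3: "\<And>y. y \<notin> insert ''k'' (writes ?upd) \<Longrightarrow> m3 y = m2 y"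
        and I3: "(\<forall>t' < t. m3 ''T'' t' = m1 ''T'' t') \<and>
          pp (ex (t div s)) dvd int (m3 ''T'' t) - ?G t k \<and> (0 < k \<longrightarrow> m3 ''T'' t < p ^ ex (t div s))"
      have g3: "m3 ''s'' 0 = s" "m3 X = m X" "m3 Y = m Y" "m3 ''Q'' t = p ^ ex (t div s)" "m3 ''t'' 0 = t"
        using g2 f3 CXY by (auto simp: ns)
      define v where "v = (m3 ''T'' t + m X (t div s * s + k) * m Y (k * s + t mod s)) mod p ^ ex (t div s)"
      have v: "v < p ^ ex (t div s)" unfolding v_def using p_gt_1 by simp
      have "pp (ex (t div s)) dvd int v - (int (m3 ''T'' t) + int (m X (t div s * s + k)) * int (m Y (k * s + t mod s)))"
        unfolding v_def by (simp add: of_nat_mod mod_eq_dvd_iff[symmetric])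
      then have "pp (ex (t div s)) dvd int v - ?G t (Suc k)"
        using dvd_add[of _ _ "int (m3 ''T'' t) - ?G t k"] I3 by (fastforce simp: algebra_simps)
      then show "wp ?upd
         (\<lambda>m''. (\<forall>t' < t. store ''k'' 0 (Suc k) m'' ''T'' t' = m1 ''T'' t') \<and>
            pp (ex (t div s)) dvd int (store ''k'' 0 (Suc k) m'' ''T'' t) - ?G t (Suc k) \<and>
            (0 < Suc k \<longrightarrow> store ''k'' 0 (Suc k) m'' ''T'' t < p ^ ex (t div s))) m3"
        unfolding wp_assign
        using v I3 c3 g3 le_trans[OF less_imp_le[OF v] pow_bound] by (simp add: v_def[symmetric])
    next
      fix m4
      assume "(\<forall>t' < t. m4 ''T'' t' = m1 ''T'' t') \<and>
          pp (ex (t div s)) dvd int (m4 ''T'' t) - ?G t s \<and> (0 < s \<longrightarrow> m4 ''T'' t < p ^ ex (t div s))"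
      then show "\<forall>t' < Suc t. J t' (store ''t'' 0 (Suc t) m4 ''T'' t')"
        using I1 s_pos by (auto simp: J_def less_Suc_eq)
    qed (use b2 g2 s_bound in \<open>auto simp: wp_assign\<close>)
    then show "wp ?row
       (\<lambda>m''. \<forall>t' < Suc t. J t' (store ''t'' 0 (Suc t) m'' ''T'' t')) m1"
      using \<open>m C t \<le> B\<close> g1 c1 by (simp add: wp_seq wp_assign m2_def)
  next
    fix m1
    assume b1: "bounded B m1" and I1: "\<forall>t < s * s. J t (m1 ''T'' t)"
      and f1: "\<And>y. y \<notin> insert ''t'' (writes ?row) \<Longrightarrow> m1 y = m y"
    have ss: "m1 ''ss'' 0 = s * s" using f1[of "''ss''"] g by simp
    show "wp (PFor ''t'' (var ''ss'') ?copy) Q m1"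
    proof (rule wp_for[where n = "s * s" and I = "\<lambda>t m'. \<forall>t' < t. m' D t' = m1 ''T'' t'"])
      fix t m2
      assume "t < s * s" and b2: "bounded B m2" and c2: "m2 ''t'' 0 = t"
        and f2: "\<And>y. y \<notin> insert ''t'' (writes ?copy) \<Longrightarrow> m2 y = m1 y"
        and I2: "\<forall>t' < t. m2 D t' = m1 ''T'' t'"
      then show "wp ?copy
          (\<lambda>m''. \<forall>t' < Suc t. store ''t'' 0 (Suc t) m'' D t' = m1 ''T'' t') m2"
        using D f2[of "''T''"] b2 by (auto simp: wp_assign bounded_def less_Suc_eq ns)
    next
      fix m2
      assume b2: "bounded B m2" and I2: "\<forall>t < s * s. m2 D t = m1 ''T'' t"
        and f2: "\<And>y. y \<notin> insert ''t'' (writes ?copy) \<Longrightarrow> m2 y = m1 y"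
      show "Q m2"
      proof (rule Q[OF b2])
        fix y assume "y \<notin> insert D temps"
        then show "m2 y = m y" using f1[of y] f2[of y] by (simp add: ns)
      next
        fix t assume "t < s * s"
        then show "m2 D t < p ^ ex (t div s) \<and> pp (ex (t div s)) dvd int (m2 D t) - ?G t s"
          using I1 I2 by (simp add: J_def)
      qed
    qed (use b1 ss size_bound in auto)
  qed (use m g size_bound in auto)
qed

lemma wp_mac:
  assumes m: "bounded B m" "state m \<sigma>"
    and D: "D \<in> regs" and CXY: "{C, X, Y} \<subseteq> regs \<union> const_regs"
    and Q: "\<And>m'. bounded B m' \<Longrightarrow> (\<And>y. y \<notin> insert D temps \<Longrightarrow> m' y = m y) \<Longrightarrow>
      state m' (\<sigma>(D := \<sigma> C + \<sigma> X * \<sigma> Y)) \<Longrightarrow> in_range m' D \<Longrightarrow> Q m'"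
  shows "wp (mac D C X Y) Q m"
proof -
  have g: "globals_ok m" and h: "\<And>x. x \<in> regs \<union> const_regs \<Longrightarrow> holds m x (\<sigma> x)"
    using m(2) by (auto simp: state_def)
  have hC: "holds m C (\<sigma> C)" and hX: "holds m X (\<sigma> X)" and hY: "holds m Y (\<sigma> Y)"
    using CXY h by auto
  let ?f = "\<sigma> C + \<sigma> X * \<sigma> Y"
  have f: "?f \<in> hom_ring" using hC hX hY unfolding holds_def by auto
  show ?thesis
  proof (rule wp_mac_raw[OF m(1) g])
    show "D \<notin> globals \<union> temps" using D names_disjoint by blast
    show "C \<notin> temps" "X \<notin> temps" "Y \<notin> temps" using CXY names_disjoint by blast+
    fix m'
    assume b: "bounded B m'" and fr: "\<And>y. y \<notin> insert D temps \<Longrightarrow> m' y = m y"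
      and v: "\<And>t. t < s * s \<Longrightarrow> m' D t < p ^ ex (t div s) \<and>
        pp (ex (t div s)) dvd int (m' D t) -
          (int (m C t) + (\<Sum>k < s. int (m X (t div s * s + k)) * int (m Y (k * s + t mod s))))"
    have "holds m' D ?f" unfolding holds_def
    proof (intro conjI f allI impI)
      fix t assume t: "t < s * s"
      let ?i = "t div s" and ?j = "t mod s"
      have ij: "?i < s" "?j < s" using index_less[OF t] by auto
      have entry: "pp (ex a) dvd int (m x (a * s + b)) - ent g a b"
        if "holds m x g" "a < s" "b < s" for x g a b
        using that(1) pair_less[OF that(2,3)] that(3) unfolding holds_def by fastforce
      define ix iy where "ix k = int (m X (?i * s + k))" and "iy k = int (m Y (k * s + ?j))" for k
      \<comment> \<open>Entry \<open>(k, j)\<close> of \<open>Y\<close> is known modulo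
        \<open>pp (ex k)\<close> only. The deficit is made up by the entry of \<open>X\<close>,
        which \<open>hom_ring\<close> makes divisible by \<open>pp (ex i - ex k)\<close>.\<close>
      have "pp (ex ?i) dvd ix k * iy k - ent (\<sigma> X) ?i k * ent (\<sigma> Y) k ?j" if "k < s" for k
      proof -
        have "pp (ex ?i) dvd (ix k - ent (\<sigma> X) ?i k) * iy k"
          unfolding ix_def using entry[OF hX ij(1) that] by (rule dvd_mult2)
        moreover have "pp (ex ?i) dvd ent (\<sigma> X) ?i k * (iy k - ent (\<sigma> Y) k ?j)"
        proof (rule pp_dvd_mult)
          show "pp (ex ?i - ex k) dvd ent (\<sigma> X) ?i k" using hX unfolding holds_def by (intro hom_ringD) simp
          show "pp (ex k) dvd iy k - ent (\<sigma> Y) k ?j" unfolding iy_def by (rule entry[OF hY that ij(2)])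
        qed simp
        ultimately have "pp (ex ?i) dvd (ix k - ent (\<sigma> X) ?i k) * iy k + ent (\<sigma> X) ?i k * (iy k - ent (\<sigma> Y) k ?j)"
          by (rule dvd_add)
        then show ?thesis by (simp add: algebra_simps)
      qed
      then have d1: "pp (ex ?i) dvd (\<Sum>k < s. ix k * iy k) - (\<Sum>k < s. ent (\<sigma> X) ?i k * ent (\<sigma> Y) k ?j)"
        unfolding sum_subtractf[symmetric] by (intro dvd_sum) auto
      have d2: "pp (ex ?i) dvd ent (\<sigma> X * \<sigma> Y) ?i ?j - (\<Sum>k < s. ent (\<sigma> X) ?i k * ent (\<sigma> Y) k ?j)"
        using hX unfolding holds_def by (intro ent_times_cong) simp
      have d3: "pp (ex ?i) dvd int (m C t) - ent (\<sigma> C) ?i ?j" using hC t unfolding holds_def by blast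
      have d4: "pp (ex ?i) dvd int (m' D t) - (int (m C t) + (\<Sum>k < s. ix k * iy k))"
        using v[OF t] by (simp add: ix_def iy_def)
      show "pp (ex ?i) dvd int (m' D t) - ent ?f ?i ?j"
        using dvd_add[OF dvd_add[OF d4 d3] dvd_diff[OF d1 d2]] by (simp add: algebra_simps)
    qed
    moreover have "holds m' x (\<sigma> x)" if "x \<in> regs \<union> const_regs" "x \<noteq> D" for x
    proof -
      have "x \<notin> insert D temps" using that names_disjoint by blast
      then show ?thesis using h[OF that(1)] fr by (simp add: holds_def)
    qed
    moreover have "globals_ok m'"
    proof (rule globals_cong[OF _ g])
      fix y assume "y \<in> globals"
      then show "m' y = m y" using D names_disjoint by (intro fr) blast
    qed
    ultimately have "state m' (\<sigma>(D := ?f))" unfolding state_def by auto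
    then show "Q m'" using Q b fr v by (auto simp: in_range_def)
  qed
qed

lemma wp_macs:
  assumes "bounded B m" "state m \<sigma>"
    and "\<And>D C X Y. (D, C, X, Y) \<in> set cs \<Longrightarrow> D \<in> regs \<and> {C, X, Y} \<subseteq> regs \<union> const_regs"
    and "\<And>m'. bounded B m' \<Longrightarrow> (\<And>y. y \<notin> temps \<union> fst ` set cs \<Longrightarrow> m' y = m y) \<Longrightarrow>
      state m' (run cs \<sigma>) \<Longrightarrow> Q m'"
  shows "wp (macs cs) Q m"
  using assms
proof (induction cs arbitrary: m \<sigma>)
  case Nil
  show ?case unfolding macs.simps wp_assign
  proof (intro conjI Nil(4))
    show "bounded B (store ''t'' (aval (Lit 0) m) (aval (Lit 0) m) m)"
      using Nil(1) by (intro bounded_store) simp_all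
    show "state (store ''t'' (aval (Lit 0) m) (aval (Lit 0) m) m) (run [] \<sigma>)"
      unfolding run.simps
    proof (rule state_cong[OF Nil(2)])
      fix y assume "y \<in> globals \<union> regs \<union> const_regs"
      moreover have "''t'' \<in> temps" by (simp add: temps_def)
      ultimately have "y \<noteq> ''t''" using names_disjoint by blast
      then show "store ''t'' (aval (Lit 0) m) (aval (Lit 0) m) m y = m y" by simp
    qed
  qed (auto simp: temps_def)
next
  case (Cons c cs)
  obtain D C X Y where c: "c = (D, C, X, Y)" by (cases c) auto
  have dc: "D \<in> regs" "{C, X, Y} \<subseteq> regs \<union> const_regs" using Cons.prems(3)[of D C X Y] c by auto
  have "wp (mac D C X Y) (wp (macs cs) Q) m"
  proof (rule wp_mac[OF Cons.prems(1,2) dc])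
    fix m'
    assume m': "bounded B m'" "\<And>y. y \<notin> insert D temps \<Longrightarrow> m' y = m y"
      "state m' (\<sigma>(D := \<sigma> C + \<sigma> X * \<sigma> Y))"
    show "wp (macs cs) Q m'"
    proof (rule Cons.IH[OF m'(1,3)])
      show "D \<in> regs \<and> {C, X, Y} \<subseteq> regs \<union> const_regs" if "(D, C, X, Y) \<in> set cs" for D C X Y
        using Cons.prems(3)[of D C X Y] that by simp
      fix m''
      assume "bounded B m''" "\<And>y. y \<notin> temps \<union> fst ` set cs \<Longrightarrow> m'' y = m' y"
        "state m'' (run cs (\<sigma>(D := \<sigma> C + \<sigma> X * \<sigma> Y)))"
      then show "Q m''" using Cons.prems(4)[of m''] m'(2) c by simp
    qed
  qed
  then show ?case by (simp add: wp_seq c)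
qed

end

section \<open>The program\<close>

definition odd_test :: "string \<Rightarrow> bexp" where
  "odd_test x = EqE (ModE (var x) (Lit 2)) (Lit 1)"

definition halve :: "string \<Rightarrow> prog" where
  "halve x = PAssign x (Lit 0) (DivE (var x) (Lit 2))"

definition same_block_test :: "string \<Rightarrow> bexp" where
  "same_block_test x =
     EqE (Read ''e'' (DivE (var x) (var ''s''))) (Read ''e'' (ModE (var x) (var ''s'')))"

definition unit_test :: "string \<Rightarrow> string \<Rightarrow> bexp" where
  "unit_test A x = ConjE (same_block_test x) (NegE (EqE (ModE (Read A (var x)) (var ''p'')) (Lit 0)))"

definition seed :: "aexp \<Rightarrow> aexp \<Rightarrow> prog" where
  "seed i a = PSeq
     (PFor ''t'' (var ''ss'') (PAssign ''G'' (var ''t'') (Lit 0)))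
     (PAssign ''G'' i a)"

text \<open>The digits of ''n'' are read from the lowest. After \<open>j\<close> rounds ''D'',
  ''DP'' and ''DQ'' hold the sum and the powers for \<open>2 ^ j\<close>, while ''S'' and ''SQ''
  hold the sum and the power of \<open>Q\<close> for the digits read so far; by
  \<open>gsum_add\<close> no power of \<open>P\<close> is needed for the latter. ''X'' saves a
  product because the new ''D'' uses the old one twice.\<close>

definition avg :: "string \<Rightarrow> string \<Rightarrow> string \<Rightarrow> prog" where
  "avg P W Q = PSeq
     (macs [(''S'', ''O'', ''O'', ''O''), (''SQ'', ''I'', ''O'', ''O''), (''D'', W, ''O'', ''O''),
            (''DP'', P, ''O'', ''O''), (''DQ'', Q, ''O'', ''O'')])
     (PSeq (PAssign ''n'' (Lit 0) (var ''N''))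
     (PFor ''b'' (var ''K'') (PSeq
       (PIf (odd_test ''n'')
         (macs [(''S'', ''O'', ''DP'', ''S''), (''S'', ''S'', ''D'', ''SQ''), (''SQ'', ''O'', ''SQ'', ''DQ'')]))
       (PSeq
         (macs [(''X'', ''O'', ''D'', ''DQ''), (''D'', ''X'', ''DP'', ''D''),
                (''DP'', ''O'', ''DP'', ''DP''), (''DQ'', ''O'', ''DQ'', ''DQ'')])
         (halve ''n'')))))"

text \<open>Fermat's inverse, the power \<open>p - 2\<close>, by repeated squaring. For
  \<open>p = 2\<close> the exponent is 0 and the result 1 is right.\<close>

definition mod_inverse :: prog where
  "mod_inverse = PSeq
     (PAssign ''c'' (Lit 0) (Lit 1))
     (PSeq (PAssign ''q'' (Lit 0) (ModE (Read ''W'' (var ''g'')) (var ''p'')))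
     (PSeq (PAssign ''r'' (Lit 0) (SubE (var ''p'') (Lit 2)))
     (PFor ''h'' (var ''K'') (PSeq
       (PIf (odd_test ''r'') (PAssign ''c'' (Lit 0) (ModE (MulE (var ''c'') (var ''q'')) (var ''p''))))
       (PSeq (PAssign ''q'' (Lit 0) (ModE (MulE (var ''q'') (var ''q'')) (var ''p'')))
         (halve ''r''))))))"

text \<open>''L'' holds \<open>1 - V * Y\<close> and ''W'' the residue \<open>Y - Y * V * Y\<close>,
  whose entry at ''g'' is the candidate for a pivot.\<close>

definition geninv :: prog where
  "geninv = PSeq (macs [(''V'', ''O'', ''O'', ''O'')])
     (PFor ''g'' (var ''ss'') (PSeq
       (macs [(''L'', ''O'', ''V'', ''Y''), (''L'', ''I'', ''NI'', ''L''), (''W'', ''O'', ''Y'', ''L'')])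
       (PIf (unit_test ''W'' ''g'') (PSeq mod_inverse (PSeq
         (seed (AddE (MulE (ModE (var ''g'') (var ''s'')) (var ''s'')) (DivE (var ''g'') (var ''s''))) (var ''c''))
         (macs [(''H'', ''O'', ''Y'', ''V''), (''H'', ''I'', ''NI'', ''H''), (''H'', ''O'', ''G'', ''H''),
                (''V'', ''V'', ''L'', ''H'')]))))))"

text \<open>In the last list ''H'' takes \<open>Z * U\<close> while ''U'' is still the old
  intertwiner, so that ''Z'' becomes \<open>z * x * z + w\<close> before ''U'' is updated.\<close>

definition main_body :: prog where
  "main_body = PSeq
     (macs [(''E'', ''O'', ''Z'', ''U''), (''E'', ''I'', ''NI'', ''E''),
            (''F'', ''O'', ''U'', ''Z''), (''F'', ''I'', ''NI'', ''F'')])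
     (PSeq (seed (var ''a'') (Lit 1))
     (PSeq (avg ''U2'' ''G'' ''U1'')
     (PSeq (macs [(''Y'', ''O'', ''F'', ''S''), (''Y'', ''O'', ''Y'', ''E'')])
     (PSeq geninv
     (PSeq (avg ''U1'' ''V'' ''U2'')
     (macs [(''W'', ''O'', ''U1'', ''S''), (''W'', ''O'', ''W'', ''F''), (''W'', ''O'', ''E'', ''W''),
            (''H'', ''O'', ''Z'', ''U''), (''Z'', ''W'', ''H'', ''Z''), (''U'', ''Y'', ''U'', ''I'')]))))))"

definition main_loop :: prog where
  "main_loop = PFor ''a'' (var ''ss'') (PIf (same_block_test ''a'') main_body)"

text \<open>Adding zero to ''U'' reduces its entries, which the state of the main loop does not
  record. The loop then tests whether \<open>1 - Z * U\<close> is in the radical.\<close>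

definition final_test :: prog where
  "final_test = PSeq
     (macs [(''L'', ''O'', ''Z'', ''U''), (''L'', ''I'', ''NI'', ''L'')])
     (PSeq (mac ''U'' ''U'' ''O'' ''O'')
     (PSeq (PAssign ''found'' (Lit 0) (Lit 1))
     (PFor ''g'' (var ''ss'') (PIf (unit_test ''L'' ''g'') (PAssign ''found'' (Lit 0) (Lit 0))))))"

lemma writes_avg:
  "writes (avg P W Q) \<subseteq> {''S'', ''SQ'', ''D'', ''DP'', ''DQ'', ''X'', ''n'', ''b'', ''T'', ''t'', ''k''}"
  by (auto simp: avg_def halve_def writes_mac)

lemma writes_seed: "writes (seed i a) = {''t'', ''G''}"
  by (auto simp: seed_def)

lemma writes_mod_inverse: "writes mod_inverse = {''c'', ''q'', ''r'', ''h''}"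
  by (auto simp: mod_inverse_def halve_def)

lemma writes_geninv:
  "writes geninv \<subseteq> {''V'', ''g'', ''L'', ''W'', ''H'', ''G'', ''c'', ''q'', ''r'', ''h'', ''T'', ''t'', ''k''}"
  by (auto simp: geninv_def writes_mac writes_seed writes_mod_inverse)

section \<open>Correctness of the elementary matrices, the scalar inverse and the averages\<close>

context algorithm
begin

lemma state_store:
  assumes "state m \<sigma>" "x \<notin> globals \<union> regs \<union> const_regs"
  shows "state (store x i v m) \<sigma>"
proof (rule state_cong[OF assms(1)])
  fix y assume "y \<in> globals \<union> regs \<union> const_regs"
  then have "y \<noteq> x" using assms(2) by blast
  then show "store x i v m y = m y" by simp
qed

lemma same_block_test:
  assumes "globals_ok m" "m x 0 = t" "t < s * s"
  shows "bval (same_block_test x) m \<longleftrightarrow> same_block t"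
  using assms index_less[of t] by (simp add: same_block_test_def globals_ok_def)

lemma unit_test:
  assumes "state m \<sigma>" "A \<in> regs \<union> const_regs" "m x 0 = t" "t < s * s"
  shows "bval (unit_test A x) m \<longleftrightarrow> same_block t \<and> \<not> int p dvd ent (\<sigma> A) (t div s) (t mod s)"
    and "p dvd m A t \<longleftrightarrow> int p dvd ent (\<sigma> A) (t div s) (t mod s)"
proof -
  have g: "globals_ok m" and h: "holds m A (\<sigma> A)" using assms by (auto simp: state_def)
  have "int p dvd int (m A t) - ent (\<sigma> A) (t div s) (t mod s)"
    using h assms(4) index_less[of t] p_dvd_pp[OF ex_pos[of "t div s"]] unfolding holds_def by blast
  then show i: "p dvd m A t \<longleftrightarrow> int p dvd ent (\<sigma> A) (t div s) (t mod s)"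
    using dvd_diff_iff int_dvd_int_iff by blast
  have "m ''p'' 0 = p" using g by (simp add: globals_ok_def)
  then have "bval (unit_test A x) m \<longleftrightarrow> bval (same_block_test x) m \<and> \<not> p dvd m A t"
    unfolding dvd_eq_mod_eq_0[of p] using assms(3) by (simp add: unit_test_def)
  then show "bval (unit_test A x) m \<longleftrightarrow> same_block t \<and> \<not> int p dvd ent (\<sigma> A) (t div s) (t mod s)"
    unfolding i same_block_test[OF g assms(3,4)] .
qed

lemma wp_seed:
  assumes m: "bounded B m" "state m \<sigma>"
    and vars: "avars i \<inter> {''t'', ''G''} = {}" "avars a \<inter> {''t'', ''G''} = {}"
    and i: "aval i m = k * s + l" "k < s" "l < s" "ex k = ex l" and a: "aval a m \<le> B"
  shows "wp (seed i a) (\<lambda>m'. state m' (\<sigma>(''G'' := of_int (int (aval a m)) * elem_mat k l))) m"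
  unfolding seed_def wp_seq
proof (rule wp_for[where n = "s * s" and I = "\<lambda>t m'. \<forall>t' < t. m' ''G'' t' = 0"])
  show "aval (var ''ss'') m = s * s" using m by (simp add: state_def globals_ok_def)
  fix m'
  assume b: "bounded B m'" and z: "\<forall>t' < s * s. m' ''G'' t' = 0"
    and f: "\<And>y. y \<notin> insert ''t'' (writes (PAssign ''G'' (var ''t'') (Lit 0))) \<Longrightarrow> m' y = m y"
  have fr: "m' y = m y" if "y \<notin> {''t'', ''G''}" for y using that by (intro f) simp
  have same: "aval i m' = aval i m" "aval a m' = aval a m"
    by (rule aval_cong, rule fr, use vars in blast)+
  let ?m = "store ''G'' (aval i m') (aval a m') m'"
  let ?f = "of_int (int (aval a m)) * elem_mat k l"
  have "holds ?m ''G'' ?f"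
    unfolding holds_def
  proof (intro conjI allI impI)
    show "?f \<in> hom_ring" using elem_mat_hom[OF i(4)] null.of_int_closed by blast
    fix t assume t: "t < s * s"
    have "t = k * s + l \<longleftrightarrow> t div s = k \<and> t mod s = l"
      using i(3) s_pos by auto
    then show "pp (ex (t div s)) dvd int (?m ''G'' t) - ent ?f (t div s) (t mod s)"
      using z t unfolding same i(1) by (auto simp: ent_of_int_times ent_elem_mat simp del: of_int_of_nat_eq)
  qed
  moreover have fr2: "?m y = m y" if "y \<notin> {''t'', ''G''}" for y using that fr[of y] by simp
  moreover have "holds ?m x (\<sigma> x)" if "x \<in> regs \<union> const_regs" "x \<noteq> ''G''" for x
  proof -
    have "x \<noteq> ''t''" using that by (auto simp: regs_def const_regs_def)
    then show ?thesis using m(2) that calculation(2)[of x] by (simp add: state_def holds_def)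
  qed
  moreover have "globals_ok ?m"
  proof (rule globals_cong[of ?m m])
    fix y assume "y \<in> globals"
    then show "?m y = m y" by (intro fr2) (auto simp: globals_def)
  qed (use m(2) in \<open>simp add: state_def\<close>)
  ultimately have "state ?m (\<sigma>(''G'' := ?f))" unfolding state_def by simp
  then show "wp (PAssign ''G'' i a) (\<lambda>m'. state m' (\<sigma>(''G'' := ?f))) m'"
    using a same by (simp add: wp_assign)
qed (use m size_bound in \<open>auto simp: wp_assign less_Suc_eq\<close>)

lemma wp_mod_inverse:
  assumes m: "bounded B m" "globals_ok m" and w: "m ''g'' 0 = t" "\<not> p dvd m ''W'' t"
  shows "wp mod_inverse (\<lambda>m'. int p dvd int (m' ''c'' 0) * int (m ''W'' t) - 1) m"
proof -
  let ?w = "m ''W'' t"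
  let ?body = "PSeq (PIf (odd_test ''r'') (PAssign ''c'' (Lit 0) (ModE (MulE (var ''c'') (var ''q'')) (var ''p'')))) (PSeq (PAssign ''q'' (Lit 0) (ModE (MulE (var ''q'') (var ''q'')) (var ''p''))) (halve ''r''))"
  note g = m(2)[unfolded globals_ok_def]
  have pm: "x mod p \<le> B" for x using p_bound p_gt_1 by (meson le_trans less_imp_le mod_less_divisor prime_gt_0_nat prime_p)
  define m1 where "m1 = store ''r'' 0 (p - 2) (store ''q'' 0 (?w mod p) (store ''c'' 0 1 m))"
  have b1: "bounded B m1" unfolding m1_def using m(1) p_bound p_gt_1 pm
    by (intro bounded_store) auto
  have "wp (PFor ''h'' (var ''K'') ?body) (\<lambda>m'. int p dvd int (m' ''c'' 0) * int ?w - 1) m1"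
  \<comment> \<open>Up to reduction modulo \<open>p\<close> the product of ''c'' and the power of
    ''q'' with exponent ''r'' is constant, and ''r'' is 0 after \<open>K\<close> rounds because
    \<open>p < 2 ^ K\<close>.\<close>
  proof (rule wp_for[where n = K and I = "\<lambda>j m'. m' ''r'' 0 = (p - 2) div 2 ^ j \<and>
        (m' ''c'' 0 * (m' ''q'' 0) ^ ((p - 2) div 2 ^ j)) mod p = ?w ^ (p - 2) mod p"])
    fix j m2
    assume b2: "bounded B m2"
      and f2: "\<And>y. y \<notin> insert ''h'' (writes ?body) \<Longrightarrow> m2 y = m1 y"
      and I: "m2 ''r'' 0 = (p - 2) div 2 ^ j \<and>
        (m2 ''c'' 0 * (m2 ''q'' 0) ^ ((p - 2) div 2 ^ j)) mod p = ?w ^ (p - 2) mod p"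
    define c q r where "c = m2 ''c'' 0" and "q = m2 ''q'' 0" and "r = (p - 2) div 2 ^ j"
    have p2: "m2 ''p'' 0 = p" using f2[of "''p''"] g by (simp add: halve_def m1_def)
    have half: "r div 2 = (p - 2) div 2 ^ Suc j" by (simp add: r_def div_mult2_eq mult.commute[of 2])
    have rB: "r div 2 \<le> B" using p_bound unfolding r_def by (meson diff_le_self div_le_dividend le_trans)
    have pw: "(c' * (q * q mod p) ^ k) mod p = (c' * q ^ (2 * k)) mod p" for c' k
      by (metis mod_mult_right_eq power_mod power_mult power2_eq_square)
    show "wp ?body
       (\<lambda>m''. store ''h'' 0 (Suc j) m'' ''r'' 0 = (p - 2) div 2 ^ Suc j \<and>
          (store ''h'' 0 (Suc j) m'' ''c'' 0 * (store ''h'' 0 (Suc j) m'' ''q'' 0) ^ ((p - 2) div 2 ^ Suc j)) mod p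
           = ?w ^ (p - 2) mod p) m2"
    proof (cases "r mod 2 = 1")
      case True
      have "(c * q mod p * (q * q mod p) ^ (r div 2)) mod p = (c * q * q ^ (2 * (r div 2))) mod p"
        unfolding pw by (simp add: mod_mult_left_eq)
      also have "c * q * q ^ (2 * (r div 2)) = c * q ^ Suc (2 * (r div 2))" by simp
      also have "Suc (2 * (r div 2)) = r" using True by presburger
      finally show ?thesis
        using True I pm rB p2 half unfolding c_def q_def r_def
        by (simp add: wp_seq wp_if wp_assign odd_test_def halve_def)
    next
      case False
      have "(c * (q * q mod p) ^ (r div 2)) mod p = (c * q ^ (2 * (r div 2))) mod p" by (rule pw)
      also have "2 * (r div 2) = r" using False by presburger
      finally show ?thesis
        using False I pm rB p2 half unfolding c_def q_def r_def
        by (simp add: wp_seq wp_if wp_assign odd_test_def halve_def)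
    qed
  next
    fix m2
    assume I: "m2 ''r'' 0 = (p - 2) div 2 ^ K \<and>
        (m2 ''c'' 0 * (m2 ''q'' 0) ^ ((p - 2) div 2 ^ K)) mod p = ?w ^ (p - 2) mod p"
    have "(p - 2) div 2 ^ K = 0" using p_less by simp
    then have c: "m2 ''c'' 0 mod p = ?w ^ (p - 2) mod p" using I by simp
    have "(m2 ''c'' 0 * ?w) mod p = (m2 ''c'' 0 mod p * ?w) mod p" by (simp add: mod_mult_left_eq)
    also have "\<dots> = (?w ^ (p - 2) * ?w) mod p" unfolding c by (simp add: mod_mult_left_eq)
    also have "?w ^ (p - 2) * ?w = ?w ^ (p - 1)"
    proof -
      have "p - 1 = Suc (p - 2)" using p_gt_1 by simp
      then show ?thesis by (simp only: power_Suc2)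
    qed
    also have "?w ^ (p - 1) mod p = 1 mod p"
      using fermat_theorem[OF prime_p w(2)] by (simp add: cong_def)
    finally have "int (m2 ''c'' 0 * ?w) mod int p = 1 mod int p" by (metis of_nat_1 zmod_int)
    then show "int p dvd int (m2 ''c'' 0) * int ?w - 1" by (simp add: mod_eq_dvd_iff)
  qed (use b1 g K_bound in \<open>auto simp: m1_def power_mod\<close>)
  then show ?thesis
    using pm[of ?w] p_bound p_gt_1 w(1) g
    unfolding mod_inverse_def wp_seq wp_assign m1_def by simp
qed

lemma wp_avg:
  assumes m: "bounded B m" "state m \<sigma>" "consts_ok \<sigma>"
    and names: "{P, W, Q} \<subseteq> (regs \<union> const_regs) - {''S'', ''SQ'', ''D'', ''DP'', ''DQ'', ''X''}"
  shows "wp (avg P W Q) (\<lambda>m'. \<exists>\<sigma>'. state m' \<sigma>' \<and>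
      \<sigma>' ''S'' = gsum (\<sigma> P) (\<sigma> W) (\<sigma> Q) unit_exponent \<and>
      (\<forall>x. x \<notin> {''S'', ''SQ'', ''D'', ''DP'', ''DQ'', ''X''} \<longrightarrow> \<sigma>' x = \<sigma> x)) m"
proof -
  let ?A = "{''S'', ''SQ'', ''D'', ''DP'', ''DQ'', ''X''}"
  let ?N = unit_exponent
  let ?init = "[(''S'', ''O'', ''O'', ''O''), (''SQ'', ''I'', ''O'', ''O''), (''D'', W, ''O'', ''O''), (''DP'', P, ''O'', ''O''), (''DQ'', Q, ''O'', ''O'')]"
  let ?add = "[(''S'', ''O'', ''DP'', ''S''), (''S'', ''S'', ''D'', ''SQ''), (''SQ'', ''O'', ''SQ'', ''DQ'')]"
  let ?double = "[(''X'', ''O'', ''D'', ''DQ''), (''D'', ''X'', ''DP'', ''D''), (''DP'', ''O'', ''DP'', ''DP''), (''DQ'', ''O'', ''DQ'', ''DQ'')]"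
  let ?rest = "PSeq (macs ?double) (halve ''n'')"
  let ?body = "PSeq (PIf (odd_test ''n'') (macs ?add)) ?rest"
  define g where "g = gsum (\<sigma> P) (\<sigma> W) (\<sigma> Q)"
  define J where "J j m' \<longleftrightarrow> m' ''n'' 0 = ?N div 2 ^ j \<and> (\<exists>\<sigma>'. state m' \<sigma>' \<and>
      \<sigma>' ''S'' = g (?N mod 2 ^ j) \<and> \<sigma>' ''SQ'' = \<sigma> Q ^ (?N mod 2 ^ j) \<and>
      \<sigma>' ''D'' = g (2 ^ j) \<and> \<sigma>' ''DP'' = \<sigma> P ^ (2 ^ j) \<and> \<sigma>' ''DQ'' = \<sigma> Q ^ (2 ^ j) \<and>
      (\<forall>x. x \<notin> ?A \<longrightarrow> \<sigma>' x = \<sigma> x))" for j m'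
  let ?post = "\<lambda>m'. \<exists>\<sigma>'. state m' \<sigma>' \<and> \<sigma>' ''S'' = gsum (\<sigma> P) (\<sigma> W) (\<sigma> Q) ?N \<and> (\<forall>x. x \<notin> ?A \<longrightarrow> \<sigma>' x = \<sigma> x)"
  let ?next = "\<lambda>j m'. J (Suc j) (store ''b'' 0 (Suc j) m')"
  have n_fresh: "''n'' \<notin> globals \<union> regs \<union> const_regs" "''b'' \<notin> globals \<union> regs \<union> const_regs"
    by (simp_all add: globals_def regs_def const_regs_def)
  have all: "?A \<subseteq> regs" "{''I'', ''O''} \<subseteq> const_regs"
    by (simp_all add: regs_def const_regs_def)
  show ?thesis unfolding avg_def wp_seq
  proof (rule wp_macs[OF m(1,2)])
    fix D C X Y
    assume "(D, C, X, Y) \<in> set ?init"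
    then show "D \<in> regs \<and> {C, X, Y} \<subseteq> regs \<union> const_regs" using names all by auto
  next
    fix m1
    assume b1: "bounded B m1"
      and s1: "state m1 (run ?init \<sigma>)" (is "state m1 ?\<sigma>1")
    have ne: "P \<noteq> ''S''" "P \<noteq> ''SQ''" "P \<noteq> ''D''" "W \<noteq> ''S''" "W \<noteq> ''SQ''"
      "Q \<noteq> ''S''" "Q \<noteq> ''SQ''" "Q \<noteq> ''D''" "Q \<noteq> ''DP''" using names by auto
    have \<sigma>1: "?\<sigma>1 ''S'' = 0" "?\<sigma>1 ''SQ'' = 1" "?\<sigma>1 ''D'' = \<sigma> W" "?\<sigma>1 ''DP'' = \<sigma> P" "?\<sigma>1 ''DQ'' = \<sigma> Q"
      "x \<notin> ?A \<Longrightarrow> ?\<sigma>1 x = \<sigma> x" for x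
      using m(3) ne by (auto simp: consts_ok_def)
    have N1: "m1 ''N'' 0 = ?N" "m1 ''K'' 0 = K" using s1 by (simp_all add: state_def globals_ok_def)
    let ?m2 = "store ''n'' 0 ?N m1"
    have b2: "bounded B ?m2" using b1 exponent_bound by (rule bounded_store)
    have s2: "state ?m2 ?\<sigma>1" using s1 n_fresh(1) by (rule state_store)
    have "wp (PFor ''b'' (var ''K'') (?body)) ?post ?m2"
    proof (rule wp_for[where n = K and I = J])
      show "J 0 (store ''b'' 0 0 ?m2)" unfolding J_def
      proof (intro conjI exI[of _ ?\<sigma>1])
        show "state (store ''b'' 0 0 ?m2) ?\<sigma>1" using s2 n_fresh(2) by (rule state_store)
      qed (use \<sigma>1 in \<open>simp_all add: g_def del: run.simps\<close>)
    next
      fix j m3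
      assume b3: "bounded B m3" and J: "J j m3"
      then obtain \<sigma>3 where n3: "m3 ''n'' 0 = ?N div 2 ^ j" and s3: "state m3 \<sigma>3"
        and v3: "\<sigma>3 ''S'' = g (?N mod 2 ^ j)" "\<sigma>3 ''SQ'' = \<sigma> Q ^ (?N mod 2 ^ j)"
          "\<sigma>3 ''D'' = g (2 ^ j)" "\<sigma>3 ''DP'' = \<sigma> P ^ (2 ^ j)" "\<sigma>3 ''DQ'' = \<sigma> Q ^ (2 ^ j)"
          "\<And>x. x \<notin> ?A \<Longrightarrow> \<sigma>3 x = \<sigma> x"
        unfolding J_def by blast
      have O3: "\<sigma>3 ''O'' = 0" using v3(6)[of "''O''"] m(3) by (simp add: consts_ok_def)
      have Nmod: "?N mod 2 ^ Suc j = 2 ^ j * (?N div 2 ^ j mod 2) + ?N mod 2 ^ j"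
        using mod_mult2_eq[of ?N "2 ^ j" 2] by (simp add: mult.commute)
      have Ndiv: "?N div 2 ^ j div 2 = ?N div 2 ^ Suc j" by (simp add: div_mult2_eq mult.commute[of 2])
      have NB: "?N div 2 ^ j div 2 \<le> B" using exponent_bound by (meson div_le_dividend le_trans)
      have rest: "wp ?rest
              (?next j) m4"
        if b4: "bounded B m4" and s4: "state m4 \<sigma>4" and n4: "m4 ''n'' 0 = ?N div 2 ^ j"
          and v4: "\<sigma>4 ''S'' = g (?N mod 2 ^ Suc j)" "\<sigma>4 ''SQ'' = \<sigma> Q ^ (?N mod 2 ^ Suc j)"
            "\<And>x. x \<notin> {''S'', ''SQ''} \<Longrightarrow> \<sigma>4 x = \<sigma>3 x" for m4 \<sigma>4
        unfolding wp_seq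
      proof (rule wp_macs[OF b4 s4])
        fix D C X Y
        assume "(D, C, X, Y) \<in> set ?double"
        then show "D \<in> regs \<and> {C, X, Y} \<subseteq> regs \<union> const_regs" using all by auto
      next
        fix m5
        assume b5: "bounded B m5"
          and f5: "\<And>y. y \<notin> temps \<union> fst ` set ?double \<Longrightarrow> m5 y = m4 y"
          and s5: "state m5 (run ?double \<sigma>4)" (is "state m5 ?\<sigma>5")
        have n5: "m5 ''n'' 0 = ?N div 2 ^ j" using f5[of "''n''"] n4 by (simp add: temps_def)
        have old: "\<sigma>4 ''O'' = 0" "\<sigma>4 ''D'' = g (2 ^ j)" "\<sigma>4 ''DP'' = \<sigma> P ^ (2 ^ j)" "\<sigma>4 ''DQ'' = \<sigma> Q ^ (2 ^ j)"
          using v4(3) v3 O3 by auto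
        have "?\<sigma>5 ''D'' = g (2 ^ Suc j)" "?\<sigma>5 ''DP'' = \<sigma> P ^ (2 ^ Suc j)" "?\<sigma>5 ''DQ'' = \<sigma> Q ^ (2 ^ Suc j)"
          "?\<sigma>5 ''S'' = g (?N mod 2 ^ Suc j)" "?\<sigma>5 ''SQ'' = \<sigma> Q ^ (?N mod 2 ^ Suc j)"
          using gsum_add[of "\<sigma> P" "\<sigma> W" "\<sigma> Q" "2 ^ j" "2 ^ j"] old v4(1,2)
          by (simp_all add: g_def add.commute mult_2 power_add)
        moreover have "?\<sigma>5 x = \<sigma> x" if "x \<notin> ?A" for x using that v4(3) v3(6) by simp
        moreover have "state (store ''b'' 0 (Suc j) (store ''n'' 0 (?N div 2 ^ Suc j) m5)) ?\<sigma>5"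
          using s5 n_fresh by (intro state_store)
        ultimately have "J (Suc j) (store ''b'' 0 (Suc j) (store ''n'' 0 (?N div 2 ^ Suc j) m5))"
          unfolding J_def by (intro conjI exI[of _ ?\<sigma>5]) (simp_all del: run.simps)
        then show "wp (halve ''n'') (?next j) m5"
          using n5 NB Ndiv by (simp add: halve_def wp_assign)
      qed
      show "wp (?body) (?next j) m3"
      proof (cases "?N div 2 ^ j mod 2 = 1")
        case True
        have "wp (macs ?add)
          (wp ?rest
              (?next j)) m3"
        proof (rule wp_macs[OF b3 s3])
          fix D C X Y
          assume "(D, C, X, Y) \<in> set ?add"
          then show "D \<in> regs \<and> {C, X, Y} \<subseteq> regs \<union> const_regs" using all by auto
        next
          fix m4
          assume b4: "bounded B m4"
            and f4: "\<And>y. y \<notin> temps \<union> fst ` set ?add \<Longrightarrow> m4 y = m3 y"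
            and s4: "state m4 (run ?add \<sigma>3)"
          show "wp ?rest
              (?next j) m4"
          proof (rule rest[OF b4 s4])
            show "m4 ''n'' 0 = ?N div 2 ^ j" using f4[of "''n''"] n3 by (simp add: temps_def)
            have r: "?N mod 2 ^ Suc j = ?N mod 2 ^ j + 2 ^ j" using Nmod True by simp
            show "run ?add \<sigma>3 ''S''
                = g (?N mod 2 ^ Suc j)"
              unfolding r using v3 O3 by (simp add: g_def gsum_add)
            show "run ?add \<sigma>3 ''SQ''
                = \<sigma> Q ^ (?N mod 2 ^ Suc j)"
              unfolding r using v3 O3 by (simp add: power_add)
          qed simp
        qed
        then show ?thesis using True n3 unfolding wp_seq[of "PIf _ _"] wp_if by (simp add: odd_test_def)
      next
        case False
        then have "?N mod 2 ^ Suc j = ?N mod 2 ^ j" using Nmod by simp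
        then have "wp ?rest
              (?next j) m3"
          by (intro rest[OF b3 s3 n3]) (simp_all only: v3)
        then show ?thesis using False n3 unfolding wp_seq[of "PIf _ _"] wp_if by (simp add: odd_test_def)
      qed
    next
      fix m3 assume "J K m3"
      moreover have "?N mod 2 ^ K = ?N" using exponent_less by simp
      ultimately show "\<exists>\<sigma>'. state m3 \<sigma>' \<and> \<sigma>' ''S'' = gsum (\<sigma> P) (\<sigma> W) (\<sigma> Q) ?N \<and>
          (\<forall>x. x \<notin> ?A \<longrightarrow> \<sigma>' x = \<sigma> x)"
        unfolding J_def g_def by auto
    qed (use b2 N1 K_bound in auto)
    then show "wp (PAssign ''n'' (Lit 0) (var ''N''))
     (wp (PFor ''b'' (var ''K'') (?body)) ?post) m1"
      using N1 exponent_bound by (simp add: wp_assign)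
  qed
qed

end

text \<open>With truncated subtraction the two differences in ''I'' add up to the distance of row
  and column, so 1 minus it is the Kronecker delta. ''NI'' is minus identity, namely
  \<open>Q - 1\<close> on the diagonal. The bound ''K'' rests on
  \<open>N <= p ^ (s * (s + 1))\<close> and on ''kp'' being a bit count of \<open>p\<close>.\<close>

definition setup_prog :: prog where
  "setup_prog = PSeq (PAssign ''ss'' (Lit 0) (MulE (var ''s'') (var ''s'')))
     (PSeq (PAssign ''K'' (Lit 0) (MulE (var ''kp'') (MulE (var ''s'') (AddE (var ''s'') (Lit 1)))))
     (PSeq (PFor ''t'' (var ''ss'') (PSeq (PAssign ''Q'' (var ''t'') (Lit 1))
       (PFor ''k'' (Read ''e'' (DivE (var ''t'') (var ''s'')))
         (PAssign ''Q'' (var ''t'') (MulE (Read ''Q'' (var ''t'')) (var ''p''))))))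
     (PSeq (PFor ''t'' (var ''ss'') (PAssign ''I'' (var ''t'') (SubE (Lit 1)
       (AddE (SubE (DivE (var ''t'') (var ''s'')) (ModE (var ''t'') (var ''s'')))
             (SubE (ModE (var ''t'') (var ''s'')) (DivE (var ''t'') (var ''s'')))))))
     (PSeq (PFor ''t'' (var ''ss'') (PAssign ''NI'' (var ''t'')
       (MulE (Read ''I'' (var ''t'')) (SubE (Read ''Q'' (var ''t'')) (Lit 1)))))
     (PSeq (PAssign ''N'' (Lit 0) (Lit 1))
     (PSeq (PAssign ''h'' (Lit 0) (Lit 1))
     (PFor ''k'' (var ''s'') (PSeq (PAssign ''h'' (Lit 0) (MulE (var ''h'') (var ''p'')))
       (PAssign ''N'' (Lit 0) (MulE (var ''N'')
         (MulE (SubE (var ''h'') (Lit 1)) (SubE (var ''h'') (Lit 1)))))))))))))"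

definition conjugacy_prog :: prog where
  "conjugacy_prog = PSeq setup_prog (PSeq main_loop final_test)"

section \<open>Correctness of the generalised inverse and of one round of the main loop\<close>

context algorithm
begin

lemma holds_cong_p:
  assumes "holds m x f" "t < s * s"
  shows "int p dvd int (m x t) - ent f (t div s) (t mod s)"
  using assms index_less[of t] p_dvd_pp[OF ex_pos[of "t div s"]] unfolding holds_def by blast

lemma wp_geninv:
  assumes m: "bounded B m" "state m \<sigma>" "consts_ok \<sigma>"
  shows "wp geninv (\<lambda>m'. \<exists>\<sigma>'. state m' \<sigma>' \<and> geninv_inv (\<sigma> ''Y'') (\<sigma>' ''V'') (s * s) \<and>
      (\<forall>x. x \<notin> {''V'', ''L'', ''W'', ''H'', ''G''} \<longrightarrow> \<sigma>' x = \<sigma> x)) m"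
proof -
  let ?A = "{''V'', ''L'', ''W'', ''H'', ''G''}"
  define y where "y = \<sigma> ''Y''"
  have yS: "y \<in> hom_ring" using m(2) by (auto simp: y_def state_def holds_def regs_def)
  define J where "J t m' \<longleftrightarrow> (\<exists>\<sigma>'. state m' \<sigma>' \<and> geninv_inv y (\<sigma>' ''V'') t \<and>
      (\<forall>x. x \<notin> ?A \<longrightarrow> \<sigma>' x = \<sigma> x))" for t m'
  have fresh: "x \<notin> globals \<union> regs \<union> const_regs" if "x \<in> {''g'', ''c'', ''q'', ''r'', ''h''}" for x
    using that by (auto simp: globals_def regs_def const_regs_def)
  have all: "{''V'', ''L'', ''W'', ''H'', ''G'', ''Y''} \<subseteq> regs" "{''I'', ''O'', ''NI''} \<subseteq> const_regs"
    by (simp_all add: regs_def const_regs_def)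
  let ?pre = "[(''L'', ''O'', ''V'', ''Y''), (''L'', ''I'', ''NI'', ''L''), (''W'', ''O'', ''Y'', ''L'')]"
  let ?upd = "[(''H'', ''O'', ''Y'', ''V''), (''H'', ''I'', ''NI'', ''H''), (''H'', ''O'', ''G'', ''H''),
                (''V'', ''V'', ''L'', ''H'')]"
  let ?seed = "seed (AddE (MulE (ModE (var ''g'') (var ''s'')) (var ''s'')) (DivE (var ''g'') (var ''s''))) (var ''c'')"
  let ?body = "PSeq (macs ?pre) (PIf (unit_test ''W'' ''g'') (PSeq mod_inverse (PSeq ?seed (macs ?upd))))"
  let ?next = "\<lambda>t m'. J (Suc t) (store ''g'' 0 (Suc t) m')"
  have step: "wp ?body (?next t) m2"
    if t: "t < s * s" and b2: "bounded B m2" and g2: "m2 ''g'' 0 = t" and J2: "J t m2" for t m2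
  proof -
    obtain \<sigma>2 where s2: "state m2 \<sigma>2" and inv: "geninv_inv y (\<sigma>2 ''V'') t"
      and old: "\<And>x. x \<notin> ?A \<Longrightarrow> \<sigma>2 x = \<sigma> x" using J2 unfolding J_def by blast
    define v where "v = \<sigma>2 ''V''"
    define r where "r = y - y * v * y"
    show ?thesis unfolding wp_seq
    proof (rule wp_macs[OF b2 s2])
      fix D C X Y assume "(D, C, X, Y) \<in> set ?pre"
      then show "D \<in> regs \<and> {C, X, Y} \<subseteq> regs \<union> const_regs" using all by auto
    next
      fix m3
      assume b3: "bounded B m3" and f3: "\<And>y. y \<notin> temps \<union> fst ` set ?pre \<Longrightarrow> m3 y = m2 y"
        and s3: "state m3 (run ?pre \<sigma>2)"
      let ?\<sigma>3 = "run ?pre \<sigma>2"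
      have v3: "?\<sigma>3 ''W'' = r" "?\<sigma>3 ''L'' = 1 - v * y" "?\<sigma>3 ''V'' = v" "x \<notin> ?A \<Longrightarrow> ?\<sigma>3 x = \<sigma> x" for x
        using old m(3) by (simp_all add: consts_ok_def v_def y_def r_def algebra_simps)
      have g3: "m3 ''g'' 0 = t" using f3[of "''g''"] g2 by (simp add: temps_def)
      have glob: "globals_ok m3" using s3 by (simp add: state_def)
      have W: "''W'' \<in> regs \<union> const_regs" using all by auto
      note test = unit_test[OF s3 W g3 t, unfolded v3(1)]
      show "wp (PIf (unit_test ''W'' ''g'') (PSeq mod_inverse (PSeq ?seed (macs ?upd))))
          (?next t) m3"
      proof (cases "bval (unit_test ''W'' ''g'') m3")
        case False
        then have "geninv_inv y v (Suc t)"
          using geninv_skip[OF inv] test unfolding r_def v_def by blast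
        then have "J (Suc t) (store ''g'' 0 (Suc t) m3)"
          unfolding J_def using state_store[OF s3 fresh] v3 by (intro exI[of _ ?\<sigma>3]) (simp del: run.simps)
        then show ?thesis using False by (simp add: wp_if)
      next
        case True
        then have sb: "same_block t" and nd: "\<not> p dvd m3 ''W'' t" using test by auto
        have "wp (PSeq mod_inverse (PSeq ?seed (macs ?upd))) (?next t) m3"
          unfolding wp_seq
        proof (rule wp_conseq[OF b3 wp_mod_inverse[OF b3 glob g3 nd]])
          fix m4
          assume b4: "bounded B m4" and f4: "\<And>y. y \<notin> writes mod_inverse \<Longrightarrow> m4 y = m3 y"
            and c4: "int p dvd int (m4 ''c'' 0) * int (m3 ''W'' t) - 1"
          let ?c = "m4 ''c'' 0"
          have s4: "state m4 ?\<sigma>3"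
          proof (rule state_cong[OF s3])
            fix x assume "x \<in> globals \<union> regs \<union> const_regs"
            then have "x \<notin> writes mod_inverse" using fresh unfolding writes_mod_inverse by blast
            then show "m4 x = m3 x" by (rule f4)
          qed
          have g4: "m4 ''g'' 0 = t" using f4[of "''g''"] g3 by (simp add: writes_mod_inverse)
          have ss4: "m4 ''s'' 0 = s" using s4 by (simp add: state_def globals_ok_def)
          have cB: "?c \<le> B" using b4 by (simp add: bounded_def)
          have av: "aval (AddE (MulE (ModE (var ''g'') (var ''s'')) (var ''s'')) (DivE (var ''g'') (var ''s''))) m4
              = t mod s * s + t div s" using g4 ss4 by simp
          \<comment> \<open>The inverse belongs to the stored residue; it serves the exact entry of
            \<open>r\<close> as well, since the two differ by a multiple of
            \<open>p\<close>.\<close>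
          have "int p dvd int ?c * (int (m3 ''W'' t) - ent r (t div s) (t mod s))"
            using holds_cong_p[of m3 "''W''" r t] s3 W t v3(1) unfolding state_def by fastforce
          then have "int p dvd (int ?c * int (m3 ''W'' t) - 1)
              - int ?c * (int (m3 ''W'' t) - ent r (t div s) (t mod s))"
            using c4 by (rule dvd_diff[rotated])
          then have c: "int p dvd int ?c * ent r (t div s) (t mod s) - 1" by (simp add: algebra_simps)
          let ?\<sigma>5 = "?\<sigma>3(''G'' := of_int (int ?c) * elem_mat (t mod s) (t div s))"
          show "wp ?seed (wp (macs ?upd) (?next t)) m4"
          proof (rule wp_conseq[OF b4 wp_seed[OF b4 s4 _ _ av]])
            show "aval (var ''c'') m4 \<le> B" using cB by simp
            fix m5
            assume b5: "bounded B m5"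
              and "state m5 (?\<sigma>3(''G'' := of_int (int (aval (var ''c'') m4)) * elem_mat (t mod s) (t div s)))"
            then have s5: "state m5 ?\<sigma>5" by simp
            show "wp (macs ?upd) (?next t) m5"
            proof (rule wp_macs[OF b5 s5])
              fix D C X Y assume "(D, C, X, Y) \<in> set ?upd"
              then show "D \<in> regs \<and> {C, X, Y} \<subseteq> regs \<union> const_regs" using all by auto
            next
              fix m6
              assume s6: "state m6 (run ?upd ?\<sigma>5)"
              let ?\<sigma>6 = "run ?upd ?\<sigma>5"
              have old6: "?\<sigma>6 x = \<sigma> x" if "x \<notin> ?A" for x using that old by simp
              have "?\<sigma>6 ''V'' = v + (1 - v * y) * (of_int (int ?c) * elem_mat (t mod s) (t div s) * (1 - y * v))"
                using v3(2,3) v3(4)[of "''I''"] v3(4)[of "''NI''"] v3(4)[of "''O''"] v3(4)[of "''Y''"] m(3)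
                by (simp add: consts_ok_def y_def del: of_int_of_nat_eq)
              then have "geninv_inv y (?\<sigma>6 ''V'') (Suc t)"
                using geninv_step[OF yS inv t sb c[unfolded r_def v_def]] unfolding v_def by blast
              moreover have "state (store ''g'' 0 (Suc t) m6) ?\<sigma>6"
                using s6 fresh by (intro state_store) auto
              ultimately show "J (Suc t) (store ''g'' 0 (Suc t) m6)"
                unfolding J_def using old6 by blast
            qed
          qed (use index_less[OF t] sb in auto)
        qed
        then show ?thesis using True by (simp add: wp_if)
      qed
    qed
  qed
  show ?thesis unfolding geninv_def wp_seq
  proof (rule wp_macs[OF m(1,2)])
    fix D C X Y assume "(D, C, X, Y) \<in> set [(''V'', ''O'', ''O'', ''O'')]"
    then show "D \<in> regs \<and> {C, X, Y} \<subseteq> regs \<union> const_regs" using all by auto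
  next
    fix m1
    assume b1: "bounded B m1" and s1: "state m1 (run [(''V'', ''O'', ''O'', ''O'')] \<sigma>)"
    show "wp (PFor ''g'' (var ''ss'') ?body) (\<lambda>m'. \<exists>\<sigma>'. state m' \<sigma>' \<and>
        geninv_inv (\<sigma> ''Y'') (\<sigma>' ''V'') (s * s) \<and> (\<forall>x. x \<notin> ?A \<longrightarrow> \<sigma>' x = \<sigma> x)) m1"
    proof (rule wp_for[where n = "s * s" and I = J])
      show "bounded B m1" by fact
      show "aval (var ''ss'') m1 = s * s" using s1 by (simp add: state_def globals_ok_def)
      show "J 0 (store ''g'' 0 0 m1)" unfolding J_def
      proof (intro exI[of _ "run [(''V'', ''O'', ''O'', ''O'')] \<sigma>"] conjI)
        show "geninv_inv y (run [(''V'', ''O'', ''O'', ''O'')] \<sigma> ''V'') 0"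
          using m(3) geninv_init by (simp add: consts_ok_def)
      qed (use state_store[OF s1 fresh] in auto)
      show "wp ?body (\<lambda>m''. J (Suc t) (store ''g'' 0 (Suc t) m'')) m2"
        if "t < s * s" "bounded B m2" "m2 ''g'' 0 = t" "J t m2" for t m2
        by (rule step[OF that])
    qed (use size_bound in \<open>auto simp: J_def y_def\<close>)
  qed
qed

lemma wp_main_body:
  assumes m: "bounded B m" "state m \<sigma>" "consts_ok \<sigma>" and t: "m ''a'' 0 = t" "t < s * s" "same_block t"
    and inv: "main_inv (\<sigma> ''U'') (\<sigma> ''Z'') t"
  shows "wp main_body (\<lambda>m'. \<exists>\<sigma>'. state m' \<sigma>' \<and> consts_ok \<sigma>' \<and> main_inv (\<sigma>' ''U'') (\<sigma>' ''Z'') (Suc t)) m"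
proof -
  define x z where "x = \<sigma> ''U''" and "z = \<sigma> ''Z''"
  have all: "{''V'', ''L'', ''W'', ''H'', ''G'', ''Y'', ''E'', ''F'', ''S'', ''Z'', ''U''} \<subseteq> regs"
    "{''I'', ''O'', ''NI'', ''U1'', ''U2''} \<subseteq> const_regs"
    by (simp_all add: regs_def const_regs_def)
  let ?l1 = "[(''E'', ''O'', ''Z'', ''U''), (''E'', ''I'', ''NI'', ''E''),
            (''F'', ''O'', ''U'', ''Z''), (''F'', ''I'', ''NI'', ''F'')]"
  let ?l4 = "[(''Y'', ''O'', ''F'', ''S''), (''Y'', ''O'', ''Y'', ''E'')]"
  let ?l7 = "[(''W'', ''O'', ''U1'', ''S''), (''W'', ''O'', ''W'', ''F''), (''W'', ''O'', ''E'', ''W''),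
            (''H'', ''O'', ''Z'', ''U''), (''Z'', ''W'', ''H'', ''Z''), (''U'', ''Y'', ''U'', ''I'')]"
  let ?Q = "\<lambda>m'. \<exists>\<sigma>'. state m' \<sigma>' \<and> consts_ok \<sigma>' \<and> main_inv (\<sigma>' ''U'') (\<sigma>' ''Z'') (Suc t)"
  let ?A = "{''S'', ''SQ'', ''D'', ''DP'', ''DQ'', ''X''}"
  let ?c7 = "wp (macs ?l7) ?Q"
  let ?c6 = "wp (avg ''U1'' ''V'' ''U2'') ?c7"
  let ?c5 = "wp geninv ?c6"
  let ?c4 = "wp (macs ?l4) ?c5"
  show ?thesis unfolding main_body_def wp_seq
  proof (rule wp_macs[OF m(1,2)])
    fix D C X Y assume "(D, C, X, Y) \<in> set ?l1"
    then show "D \<in> regs \<and> {C, X, Y} \<subseteq> regs \<union> const_regs" using all by auto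
  next
    fix m1
    assume b1: "bounded B m1" and f1: "\<And>y. y \<notin> temps \<union> fst ` set ?l1 \<Longrightarrow> m1 y = m y"
      and s1: "state m1 (run ?l1 \<sigma>)"
    define \<sigma>1 where "\<sigma>1 = run ?l1 \<sigma>"
    have v1: "\<sigma>1 ''E'' = 1 - z * x" "\<sigma>1 ''F'' = 1 - x * z" "\<sigma>1 ''U'' = x" "\<sigma>1 ''Z'' = z" "consts_ok \<sigma>1"
      using m(3) by (simp_all add: \<sigma>1_def x_def z_def consts_ok_def)
    note s1 = s1[folded \<sigma>1_def]
    have a1: "m1 ''a'' 0 = t" using f1[of "''a''"] t(1) by (simp add: temps_def)
    have "t = t div s * s + t mod s" by simp
    then have av: "aval (var ''a'') m1 = t div s * s + t mod s" using a1 by simp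
    have "B \<ge> 1" using p_bound p_gt_1 by simp
    have "wp (seed (var ''a'') (Lit 1)) (\<lambda>m'. state m' (\<sigma>1(''G'' := of_int (int (aval (Lit 1) m1)) * elem_mat (t div s) (t mod s)))) m1"
      using index_less[OF t(2)] t(3) \<open>B \<ge> 1\<close> by (intro wp_seed[OF b1 s1 _ _ av]) auto
    then show "wp (seed (var ''a'') (Lit 1)) (wp (avg ''U2'' ''G'' ''U1'') ?c4) m1"
    proof (rule wp_conseq[OF b1])
      fix m2
      define \<sigma>2 where "\<sigma>2 = \<sigma>1(''G'' := elem_mat (t div s) (t mod s))"
      assume b2: "bounded B m2"
        and "state m2 (\<sigma>1(''G'' := of_int (int (aval (Lit 1) m1)) * elem_mat (t div s) (t mod s)))"
      then have s2: "state m2 \<sigma>2" by (simp add: \<sigma>2_def)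
      have v2: "\<sigma>2 ''E'' = 1 - z * x" "\<sigma>2 ''F'' = 1 - x * z" "\<sigma>2 ''U'' = x" "\<sigma>2 ''Z'' = z" "consts_ok \<sigma>2"
        "\<sigma>2 ''G'' = elem_mat (t div s) (t mod s)"
        using v1 by (simp_all add: \<sigma>2_def consts_ok_def)
      have "wp (avg ''U2'' ''G'' ''U1'') (\<lambda>m'. \<exists>\<sigma>'. state m' \<sigma>' \<and>
          \<sigma>' ''S'' = gsum (\<sigma>2 ''U2'') (\<sigma>2 ''G'') (\<sigma>2 ''U1'') unit_exponent \<and>
          (\<forall>x. x \<notin> ?A \<longrightarrow> \<sigma>' x = \<sigma>2 x)) m2"
        by (rule wp_avg[OF b2 s2 v2(5)]) (simp add: regs_def const_regs_def)
      then show "wp (avg ''U2'' ''G'' ''U1'') ?c4 m2"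
      proof (rule wp_conseq[OF b2])
        fix m3
        assume b3: "bounded B m3" and "\<exists>\<sigma>'. state m3 \<sigma>' \<and>
          \<sigma>' ''S'' = gsum (\<sigma>2 ''U2'') (\<sigma>2 ''G'') (\<sigma>2 ''U1'') unit_exponent \<and>
          (\<forall>x. x \<notin> ?A \<longrightarrow> \<sigma>' x = \<sigma>2 x)"
        then obtain \<sigma>3 where s3: "state m3 \<sigma>3"
          and S3: "\<sigma>3 ''S'' = gsum (\<sigma>2 ''U2'') (\<sigma>2 ''G'') (\<sigma>2 ''U1'') unit_exponent"
          and o3: "\<And>x. x \<notin> ?A \<Longrightarrow> \<sigma>3 x = \<sigma>2 x" by blast
        have v3: "\<sigma>3 ''E'' = 1 - z * x" "\<sigma>3 ''F'' = 1 - x * z" "\<sigma>3 ''U'' = x" "\<sigma>3 ''Z'' = z" "consts_ok \<sigma>3"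
          using v2 o3 by (simp_all add: consts_ok_def)
        have S3: "\<sigma>3 ''S'' = trace_elem t"
          using S3 v2(5,6) by (simp add: trace_elem_def consts_ok_def)
        show "?c4 m3"
        proof (rule wp_macs[OF b3 s3])
          fix D C X Y assume "(D, C, X, Y) \<in> set ?l4"
          then show "D \<in> regs \<and> {C, X, Y} \<subseteq> regs \<union> const_regs" using all by auto
        next
          fix m4
          assume b4: "bounded B m4" and s4: "state m4 (run ?l4 \<sigma>3)"
          define \<sigma>4 where "\<sigma>4 = run ?l4 \<sigma>3"
          define y where "y = \<sigma>4 ''Y''"
          note s4 = s4[folded \<sigma>4_def]
          have v4: "\<sigma>4 ''E'' = 1 - z * x" "\<sigma>4 ''F'' = 1 - x * z" "\<sigma>4 ''U'' = x" "\<sigma>4 ''Z'' = z" "consts_ok \<sigma>4"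
            using v3 by (simp_all add: \<sigma>4_def consts_ok_def)
          have y: "y = (1 - x * z) * trace_elem t * (1 - z * x)"
            using v3 S3 by (simp add: y_def \<sigma>4_def consts_ok_def)
          have yS: "y \<in> hom_ring" using s4 all(1) by (auto simp: y_def state_def holds_def)
          show "?c5 m4"
          proof (rule wp_conseq[OF b4 wp_geninv[OF b4 s4 v4(5)]])
            fix m5
            assume b5: "bounded B m5" and "\<exists>\<sigma>'. state m5 \<sigma>' \<and> geninv_inv (\<sigma>4 ''Y'') (\<sigma>' ''V'') (s * s) \<and>
                (\<forall>x. x \<notin> {''V'', ''L'', ''W'', ''H'', ''G''} \<longrightarrow> \<sigma>' x = \<sigma>4 x)"
            then obtain \<sigma>5 where s5: "state m5 \<sigma>5" and V5: "geninv_inv y (\<sigma>5 ''V'') (s * s)"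
              and o5: "\<And>x. x \<notin> {''V'', ''L'', ''W'', ''H'', ''G''} \<Longrightarrow> \<sigma>5 x = \<sigma>4 x"
              unfolding y_def by blast
            define v where "v = \<sigma>5 ''V''"
            have v5: "\<sigma>5 ''E'' = 1 - z * x" "\<sigma>5 ''F'' = 1 - x * z" "\<sigma>5 ''U'' = x" "\<sigma>5 ''Z'' = z"
              "\<sigma>5 ''Y'' = y" "consts_ok \<sigma>5"
              using v4 o5 by (simp_all add: consts_ok_def y_def)
            have "wp (avg ''U1'' ''V'' ''U2'') (\<lambda>m'. \<exists>\<sigma>'. state m' \<sigma>' \<and>
                \<sigma>' ''S'' = gsum (\<sigma>5 ''U1'') (\<sigma>5 ''V'') (\<sigma>5 ''U2'') unit_exponent \<and>
                (\<forall>x. x \<notin> ?A \<longrightarrow> \<sigma>' x = \<sigma>5 x)) m5"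
              by (rule wp_avg[OF b5 s5 v5(6)]) (simp add: regs_def const_regs_def)
            then show "?c6 m5"
            proof (rule wp_conseq[OF b5])
              fix m6
              assume b6: "bounded B m6" and "\<exists>\<sigma>'. state m6 \<sigma>' \<and>
                \<sigma>' ''S'' = gsum (\<sigma>5 ''U1'') (\<sigma>5 ''V'') (\<sigma>5 ''U2'') unit_exponent \<and>
                (\<forall>x. x \<notin> ?A \<longrightarrow> \<sigma>' x = \<sigma>5 x)"
              then obtain \<sigma>6 where s6: "state m6 \<sigma>6"
                and S6: "\<sigma>6 ''S'' = gsum (\<sigma>5 ''U1'') (\<sigma>5 ''V'') (\<sigma>5 ''U2'') unit_exponent"
                and o6: "\<And>x. x \<notin> ?A \<Longrightarrow> \<sigma>6 x = \<sigma>5 x" by blast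
              have v6: "\<sigma>6 ''E'' = 1 - z * x" "\<sigma>6 ''F'' = 1 - x * z" "\<sigma>6 ''U'' = x" "\<sigma>6 ''Z'' = z"
                "\<sigma>6 ''Y'' = y" "consts_ok \<sigma>6" "\<sigma>6 ''S'' = gsum u1 v u2 unit_exponent"
                using v5 o6 S6 by (simp_all add: consts_ok_def v_def)
              show "?c7 m6"
              proof (rule wp_macs[OF b6 s6])
                fix D C X Y assume "(D, C, X, Y) \<in> set ?l7"
                then show "D \<in> regs \<and> {C, X, Y} \<subseteq> regs \<union> const_regs" using all by auto
              next
                fix m7
                assume s7: "state m7 (run ?l7 \<sigma>6)"
                define w where "w = (1 - z * x) * (u1 * gsum u1 v u2 unit_exponent) * (1 - x * z)"
                have c7: "consts_ok (run ?l7 \<sigma>6)" using v6(6) by (simp add: consts_ok_def)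
                have "run ?l7 \<sigma>6 ''U'' = x + y" using v6 by (simp add: consts_ok_def)
                moreover have "run ?l7 \<sigma>6 ''Z'' = z * x * z + w"
                  using v6 by (simp add: consts_ok_def w_def mult.assoc)
                moreover have "main_inv (x + y) (z * x * z + w) (Suc t)"
                  using geninv_final[OF yS V5, folded v_def] inv t(3) y
                  by (intro main_step[where e = "1 - z * x" and f = "1 - x * z" and v = v])
                     (simp_all add: x_def z_def w_def)
                ultimately show "?Q m7" using s7 c7 by metis
              qed
            qed
          qed
        qed
      qed
    qed
  qed
qed

end

lemma writes_setup_prog:
  "writes setup_prog = {''ss'', ''K'', ''t'', ''Q'', ''k'', ''I'', ''NI'', ''N'', ''h''}"
  by (auto simp: setup_prog_def)

section \<open>The main loop, the final test, the setup and the meaning of the answer\<close>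

context algorithm
begin

lemma wp_main_loop:
  assumes m: "bounded B m" "state m \<sigma>" "consts_ok \<sigma>" and z: "\<sigma> ''U'' = 0" "\<sigma> ''Z'' = 0"
  shows "wp main_loop (\<lambda>m'. \<exists>\<sigma>'. state m' \<sigma>' \<and> consts_ok \<sigma>' \<and>
      main_inv (\<sigma>' ''U'') (\<sigma>' ''Z'') (s * s)) m"
proof -
  define J where "J t m' \<longleftrightarrow> (\<exists>\<sigma>'. state m' \<sigma>' \<and> consts_ok \<sigma>' \<and> main_inv (\<sigma>' ''U'') (\<sigma>' ''Z'') t)" for t m'
  have fresh: "''a'' \<notin> globals \<union> regs \<union> const_regs"
    by (simp add: globals_def regs_def const_regs_def)
  have J_store: "J t (store ''a'' 0 k m')" if "J t m'" for t k m'
    using that state_store[OF _ fresh] unfolding J_def by blast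
  show ?thesis unfolding main_loop_def
  proof (rule wp_for[where n = "s * s" and I = J])
    show "aval (var ''ss'') m = s * s" using m(2) by (simp add: state_def globals_ok_def)
    show "J 0 (store ''a'' 0 0 m)"
      using m z main_init by (intro J_store) (auto simp: J_def)
  next
    fix t m2
    assume t: "t < s * s" and b2: "bounded B m2" and a2: "m2 ''a'' 0 = t" and J2: "J t m2"
    then obtain \<sigma>2 where s2: "state m2 \<sigma>2" "consts_ok \<sigma>2" "main_inv (\<sigma>2 ''U'') (\<sigma>2 ''Z'') t"
      unfolding J_def by blast
    have g: "globals_ok m2" using s2 by (simp add: state_def)
    note test = same_block_test[OF g a2 t]
    show "wp (PIf (same_block_test ''a'') main_body) (\<lambda>m''. J (Suc t) (store ''a'' 0 (Suc t) m'')) m2"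
    proof (cases "same_block t")
      case True
      have "wp main_body (\<lambda>m''. J (Suc t) (store ''a'' 0 (Suc t) m'')) m2"
        by (rule wp_conseq[OF b2 wp_main_body[OF b2 s2(1,2) a2 t True s2(3)]])
          (intro J_store, simp add: J_def)
      then show ?thesis using True test by (simp add: wp_if)
    next
      case False
      have "J (Suc t) (store ''a'' 0 (Suc t) m2)"
        using s2 main_skip[OF s2(3) False] by (intro J_store) (auto simp: J_def)
      then show ?thesis using False test by (simp add: wp_if)
    qed
  qed (use m size_bound in \<open>auto simp: J_def\<close>)
qed

lemma wp_final_test:
  assumes m: "bounded B m" "state m \<sigma>" "consts_ok \<sigma>"
  shows "wp final_test (\<lambda>m'. holds m' ''U'' (\<sigma> ''U'') \<and> in_range m' ''U'' \<and>
      (m' ''found'' 0 \<noteq> 0 \<longleftrightarrow> 1 - \<sigma> ''Z'' * \<sigma> ''U'' \<in> rad_ideal)) m"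
proof -
  let ?e = "1 - \<sigma> ''Z'' * \<sigma> ''U''"
  let ?Q = "\<lambda>m'. holds m' ''U'' (\<sigma> ''U'') \<and> in_range m' ''U'' \<and> (m' ''found'' 0 \<noteq> 0 \<longleftrightarrow> ?e \<in> rad_ideal)"
  have all: "{''L'', ''Z'', ''U''} \<subseteq> regs" "{''I'', ''O'', ''NI''} \<subseteq> const_regs"
    by (simp_all add: regs_def const_regs_def)
  let ?l = "[(''L'', ''O'', ''Z'', ''U''), (''L'', ''I'', ''NI'', ''L'')]"
  have fresh: "''g'' \<notin> globals \<union> regs \<union> const_regs" "''found'' \<notin> globals \<union> regs \<union> const_regs"
    by (simp_all add: globals_def regs_def const_regs_def)
  let ?loop = "PFor ''g'' (var ''ss'') (PIf (unit_test ''L'' ''g'') (PAssign ''found'' (Lit 0) (Lit 0)))"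
  show ?thesis unfolding final_test_def wp_seq
  proof (rule wp_macs[OF m(1,2)])
    fix D C X Y assume "(D, C, X, Y) \<in> set ?l"
    then show "D \<in> regs \<and> {C, X, Y} \<subseteq> regs \<union> const_regs" using all by auto
  next
    fix m1 assume b1: "bounded B m1" and s1: "state m1 (run ?l \<sigma>)"
    have v1: "run ?l \<sigma> ''L'' = ?e" "run ?l \<sigma> ''U'' = \<sigma> ''U''" "run ?l \<sigma> ''O'' = 0"
      using m(3) by (simp_all add: consts_ok_def)
    have CXY: "''U'' \<in> regs" "{''U'', ''O'', ''O''} \<subseteq> regs \<union> const_regs" using all by auto
    show "wp (mac ''U'' ''U'' ''O'' ''O'') (wp (PAssign ''found'' (Lit 0) (Lit 1)) (wp ?loop
        ?Q)) m1"
    proof (rule wp_mac[OF b1 s1 CXY])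
      fix m2
      define \<sigma>2 where "\<sigma>2 = (run ?l \<sigma>)(''U'' := run ?l \<sigma> ''U'' + run ?l \<sigma> ''O'' * run ?l \<sigma> ''O'')"
      assume b2: "bounded B m2" and "state m2 ((run ?l \<sigma>)(''U'' := run ?l \<sigma> ''U'' + run ?l \<sigma> ''O'' * run ?l \<sigma> ''O''))"
        and r2: "in_range m2 ''U''"
      then have s2: "state m2 \<sigma>2" by (simp only: \<sigma>2_def)
      have v2: "\<sigma>2 ''L'' = ?e" "\<sigma>2 ''U'' = \<sigma> ''U''" using v1 by (simp_all add: \<sigma>2_def del: run.simps)
      have "holds m2 ''L'' (\<sigma>2 ''L'')" using s2 all(1) unfolding state_def by blast
      then have eS: "?e \<in> hom_ring" unfolding holds_def v2(1) by blast
      let ?m3 = "store ''found'' 0 1 m2"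
      have B1: "1 \<le> B" using p_bound p_gt_1 by simp
      have b3: "bounded B ?m3" using b2 B1 by (rule bounded_store)
      have s3: "state ?m3 \<sigma>2" using s2 fresh(2) by (rule state_store)
      define J where "J t m' \<longleftrightarrow> state m' \<sigma>2 \<and> in_range m' ''U'' \<and>
          m' ''found'' 0 = (if \<forall>t' < t. same_block t' \<longrightarrow> int p dvd ent ?e (t' div s) (t' mod s) then 1 else 0)"
        for t m'
      have "wp ?loop ?Q ?m3"
      proof (rule wp_for[where n = "s * s" and I = J])
        show "aval (var ''ss'') ?m3 = s * s" using s3 by (simp add: state_def globals_ok_def)
        show "J 0 (store ''g'' 0 0 ?m3)"
          using state_store[OF s3 fresh(1)] r2 by (simp add: J_def in_range_def)
      next
        fix t m4
        assume t: "t < s * s" and b4: "bounded B m4" and g4: "m4 ''g'' 0 = t" and J4: "J t m4"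
        then have s4: "state m4 \<sigma>2" by (simp add: J_def)
        have L: "''L'' \<in> regs \<union> const_regs" using all by auto
        note test = unit_test(1)[OF s4 L g4 t, unfolded v2(1)]
        have st: "state (store ''g'' 0 (Suc t) m4) \<sigma>2"
          "state (store ''g'' 0 (Suc t) (store ''found'' 0 0 m4)) \<sigma>2"
          by (rule state_store[OF s4 fresh(1)], rule state_store[OF state_store[OF s4 fresh(2)] fresh(1)])
        show "wp (PIf (unit_test ''L'' ''g'') (PAssign ''found'' (Lit 0) (Lit 0)))
            (\<lambda>m''. J (Suc t) (store ''g'' 0 (Suc t) m'')) m4"
        proof (cases "bval (unit_test ''L'' ''g'') m4")
          case True
          then show ?thesis using test J4 st(2)
            by (auto simp: wp_if wp_assign J_def in_range_def simp del: ent_diff)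
        next
          case False
          then show ?thesis using test J4 st(1)
            by (auto simp: wp_if J_def in_range_def less_Suc_eq simp del: ent_diff)
        qed
      next
        fix m4 assume J4: "J (s * s) m4"
        have "?e \<in> rad_ideal \<longleftrightarrow> (\<forall>t' < s * s. same_block t' \<longrightarrow> int p dvd ent ?e (t' div s) (t' mod s))"
        proof
          assume "?e \<in> rad_ideal"
          then show "\<forall>t' < s * s. same_block t' \<longrightarrow> int p dvd ent ?e (t' div s) (t' mod s)"
            unfolding rad_ideal_def using ex_pos index_less by blast
        qed (use radI[OF eS] in blast)
        moreover have "holds m4 ''U'' (\<sigma>2 ''U'')" using J4 all(1) unfolding J_def state_def by blast
        then have "holds m4 ''U'' (\<sigma> ''U'')" unfolding v2(2) .
        ultimately show "holds m4 ''U'' (\<sigma> ''U'') \<and> in_range m4 ''U'' \<and>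
            (m4 ''found'' 0 \<noteq> 0 \<longleftrightarrow> ?e \<in> rad_ideal)"
          using J4 by (simp add: J_def del: ent_diff)
      qed (use b3 size_bound in auto)
      then show "wp (PAssign ''found'' (Lit 0) (Lit 1)) (wp ?loop
        ?Q) m2"
        using B1 by (simp add: wp_assign)
    qed
  qed
qed

text \<open>The memory after the bit length of \<open>p\<close> has been computed. The registers are
  still zero, so the initial pair of the main loop needs no code.\<close>

definition initial :: "memory \<Rightarrow> bool" where
  "initial m \<longleftrightarrow> m ''p'' 0 = p \<and> m ''s'' 0 = s \<and> m ''kp'' 0 * (s * (s + 1)) = K \<and>
     (\<forall>i < s. m ''e'' i = ex i) \<and> (\<forall>x \<in> insert ''O'' regs. \<forall>i. m x i = 0) \<and>
     holds m ''U1'' u1 \<and> holds m ''U2'' u2"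

text \<open>The setup must not exceed \<open>B\<close> on the way to \<open>N\<close>; the partial
  products divide \<open>N\<close>, which is positive.\<close>

lemma partial_exponent_le:
  assumes "k \<le> s"
  shows "(\<Prod>i < k. (p ^ Suc i - 1) ^ 2) \<le> B"
proof -
  have "(\<Prod>i < k. (p ^ Suc i - 1) ^ 2) dvd unit_exponent"
    unfolding unit_exponent_def using assms by (intro prod_dvd_prod_subset) auto
  moreover have "0 < unit_exponent"
  proof -
    have "1 < p ^ Suc i" for i by (rule one_less_power[OF p_gt_1]) simp
    then show ?thesis unfolding unit_exponent_def by (intro prod_pos) (simp del: power_Suc)
  qed
  ultimately show ?thesis using exponent_bound dvd_imp_le le_trans by blast
qed

lemma wp_setup_values:
  assumes m: "bounded B m" "initial m" and ps: "p ^ s \<le> B" and exM: "\<And>i. ex i \<le> M"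
  shows "wp setup_prog (\<lambda>m'. m' ''ss'' 0 = s * s \<and> m' ''K'' 0 = K \<and> m' ''N'' 0 = unit_exponent \<and>
      (\<forall>t < s * s. m' ''Q'' t = p ^ ex (t div s)) \<and>
      (\<forall>t < s * s. m' ''I'' t = (if t div s = t mod s then 1 else 0)) \<and>
      (\<forall>t < s * s. m' ''NI'' t = (if t div s = t mod s then p ^ ex (t div s) - 1 else 0))) m"
proof -
  note i = m(2)[unfolded initial_def]
  have B: "s * s \<le> B" "K \<le> B" "1 \<le> B" using size_bound K_bound MB p_bound p_gt_1 by auto
  define m2 where "m2 = store ''K'' 0 K (store ''ss'' 0 (s * s) m)"
  have b2: "bounded B m2" unfolding m2_def using m(1) B by (intro bounded_store)
  have f2: "m2 y = m y" if "y \<notin> {''ss'', ''K''}" for y using that by (simp add: m2_def)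
  have v2: "m2 ''ss'' 0 = s * s" "m2 ''K'' 0 = K" by (simp_all add: m2_def)
  let ?post = "\<lambda>m'. m' ''ss'' 0 = s * s \<and> m' ''K'' 0 = K \<and> m' ''N'' 0 = unit_exponent \<and>
 (\<forall>t < s * s. m' ''Q'' t = p ^ ex (t div s)) \<and>
 (\<forall>t < s * s. m' ''I'' t = (if t div s = t mod s then 1 else 0)) \<and>
 (\<forall>t < s * s. m' ''NI'' t = (if t div s = t mod s then p ^ ex (t div s) - 1 else 0))"
  let ?mult = "PAssign ''Q'' (var ''t'') (MulE (Read ''Q'' (var ''t'')) (var ''p''))"
  let ?pow = "PFor ''k'' (Read ''e'' (DivE (var ''t'') (var ''s''))) ?mult"
  let ?row = "PSeq (PAssign ''Q'' (var ''t'') (Lit 1)) ?pow"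
  let ?idn = "PAssign ''I'' (var ''t'') (SubE (Lit 1) (AddE (SubE (DivE (var ''t'') (var ''s'')) (ModE (var ''t'') (var ''s''))) (SubE (ModE (var ''t'') (var ''s'')) (DivE (var ''t'') (var ''s'')))))"
  let ?neg = "PAssign ''NI'' (var ''t'') (MulE (Read ''I'' (var ''t'')) (SubE (Read ''Q'' (var ''t'')) (Lit 1)))"
  let ?step = "PSeq (PAssign ''h'' (Lit 0) (MulE (var ''h'') (var ''p''))) (PAssign ''N'' (Lit 0) (MulE (var ''N'') (MulE (SubE (var ''h'') (Lit 1)) (SubE (var ''h'') (Lit 1)))))"
  let ?P3 = "PFor ''t'' (var ''ss'') ?row"
  let ?P4 = "PFor ''t'' (var ''ss'') ?idn"
  let ?P5 = "PFor ''t'' (var ''ss'') ?neg"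
  let ?P6 = "PFor ''k'' (var ''s'') ?step"
  let ?tail = "wp (PAssign ''N'' (Lit 0) (Lit 1)) (wp (PAssign ''h'' (Lit 0) (Lit 1)) (wp ?P6 ?post))"
  have w3: "wp ?P3 (\<lambda>m'. \<forall>t < s * s. m' ''Q'' t = p ^ ex (t div s)) m2"
  proof (rule wp_for[where n = "s * s" and I = "\<lambda>t m'. \<forall>t' < t. m' ''Q'' t' = p ^ ex (t' div s)"])
    fix t m3
    assume t: "t < s * s" and b3: "bounded B m3" and c3: "m3 ''t'' 0 = t"
      and f3: "\<And>y. y \<notin> insert ''t'' (writes ?row) \<Longrightarrow> m3 y = m2 y"
      and I3: "\<forall>t' < t. m3 ''Q'' t' = p ^ ex (t' div s)"
    have g3: "m3 ''s'' 0 = s" "m3 ''p'' 0 = p" "m3 ''e'' (t div s) = ex (t div s)"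
      using f3[of "''s''"] f3[of "''p''"] f3[of "''e''"] f2 i index_less[OF t] by auto
    let ?m4 = "store ''Q'' t 1 m3"
    have b4: "bounded B ?m4" using b3 B(3) by (rule bounded_store)
    have "wp ?pow
       (\<lambda>m''. \<forall>t' < Suc t. store ''t'' 0 (Suc t) m'' ''Q'' t' = p ^ ex (t' div s)) ?m4"
    proof (rule wp_for[where n = "ex (t div s)" and I = "\<lambda>k m'. m' ''Q'' t = p ^ k \<and>
          (\<forall>t' < t. m' ''Q'' t' = p ^ ex (t' div s))"])
      fix k m5
      assume k: "k < ex (t div s)"
        and f5: "\<And>y. y \<notin> insert ''k'' (writes ?mult) \<Longrightarrow> m5 y = ?m4 y"
        and I5: "m5 ''Q'' t = p ^ k \<and> (\<forall>t' < t. m5 ''Q'' t' = p ^ ex (t' div s))"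
      have g5: "m5 ''t'' 0 = t" "m5 ''p'' 0 = p"
        using f5[of "''t''"] f5[of "''p''"] c3 g3 by auto
      have "p ^ Suc k \<le> p ^ ex (t div s)" using k p_gt_1 by (intro power_increasing) auto
      then have "p ^ Suc k \<le> B" using pow_bound le_trans by blast
      then show "wp ?mult
          (\<lambda>m''. store ''k'' 0 (Suc k) m'' ''Q'' t = p ^ Suc k \<and>
            (\<forall>t' < t. store ''k'' 0 (Suc k) m'' ''Q'' t' = p ^ ex (t' div s))) m5"
        using I5 g5 by (simp add: wp_assign mult.commute)
    qed (use b4 c3 g3 exM I3 in \<open>auto simp: less_Suc_eq\<close>)
    then show "wp ?row
       (\<lambda>m''. \<forall>t' < Suc t. store ''t'' 0 (Suc t) m'' ''Q'' t' = p ^ ex (t' div s)) m3"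
      using B(3) c3 by (simp add: wp_seq wp_assign)
  qed (use b2 v2 size_bound in auto)
  have "wp ?P3 (wp ?P4 (wp ?P5 ?tail)) m2"
  proof (rule wp_conseq[OF b2 w3])
    fix m3
    assume b3: "bounded B m3" and f3: "\<And>y. y \<notin> writes ?P3 \<Longrightarrow> m3 y = m2 y"
      and Q3: "\<forall>t < s * s. m3 ''Q'' t = p ^ ex (t div s)"
    have v3: "m3 ''ss'' 0 = s * s" "m3 ''K'' 0 = K" "m3 ''s'' 0 = s" "m3 ''p'' 0 = p"
      using f3[of "''ss''"] f3[of "''K''"] f3[of "''s''"] f3[of "''p''"] f2 v2 i by auto
    have w4: "wp ?P4 (\<lambda>m'. \<forall>t < s * s. m' ''I'' t = (if t div s = t mod s then 1 else 0)) m3"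
    proof (rule wp_for[where n = "s * s" and I = "\<lambda>t m'. \<forall>t' < t. m' ''I'' t' = (if t' div s = t' mod s then 1 else 0)"])
      fix t m4
      assume c4: "m4 ''t'' 0 = t"
        and f4: "\<And>y. y \<notin> insert ''t'' (writes ?idn)  \<Longrightarrow> m4 y = m3 y"
        and I4: "\<forall>t' < t. m4 ''I'' t' = (if t' div s = t' mod s then 1 else 0)"
      have "m4 ''s'' 0 = s" using f4[of "''s''"] v3 by simp
      then show "wp ?idn
          (\<lambda>m''. \<forall>t' < Suc t. store ''t'' 0 (Suc t) m'' ''I'' t' = (if t' div s = t' mod s then 1 else 0)) m4"
        using c4 I4 B(3) by (auto simp: wp_assign less_Suc_eq)
    qed (use b3 v3 size_bound in auto)
    show "wp ?P4 (wp ?P5 ?tail) m3"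
    proof (rule wp_conseq[OF b3 w4])
      fix m4
      assume b4: "bounded B m4" and f4: "\<And>y. y \<notin> writes ?P4 \<Longrightarrow> m4 y = m3 y"
        and I4: "\<forall>t < s * s. m4 ''I'' t = (if t div s = t mod s then 1 else 0)"
      have v4: "m4 ''ss'' 0 = s * s" "m4 ''K'' 0 = K" "m4 ''s'' 0 = s" "m4 ''p'' 0 = p"
          "\<forall>t < s * s. m4 ''Q'' t = p ^ ex (t div s)"
        using f4[of "''ss''"] f4[of "''K''"] f4[of "''s''"] f4[of "''p''"] f4[of "''Q''"] v3 Q3 by auto
      have w5: "wp ?P5 (\<lambda>m'. \<forall>t < s * s. m' ''NI'' t = (if t div s = t mod s then p ^ ex (t div s) - 1 else 0)) m4"
      proof (rule wp_for[where n = "s * s" and I = "\<lambda>t m'. \<forall>t' < t. m' ''NI'' t' =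
            (if t' div s = t' mod s then p ^ ex (t' div s) - 1 else 0)"])
        fix t m5
        assume t: "t < s * s" and c5: "m5 ''t'' 0 = t"
          and f5: "\<And>y. y \<notin> insert ''t'' (writes ?neg) \<Longrightarrow> m5 y = m4 y"
          and I5: "\<forall>t' < t. m5 ''NI'' t' = (if t' div s = t' mod s then p ^ ex (t' div s) - 1 else 0)"
        have "m5 ''I'' = m4 ''I''" "m5 ''Q'' = m4 ''Q''" using f5 by auto
        then show "wp ?neg
            (\<lambda>m''. \<forall>t' < Suc t. store ''t'' 0 (Suc t) m'' ''NI'' t' =
               (if t' div s = t' mod s then p ^ ex (t' div s) - 1 else 0)) m5"
          using c5 I5 I4 v4(5) t le_trans[OF diff_le_self pow_bound] by (auto simp: wp_assign less_Suc_eq)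
      qed (use b4 v4 size_bound in auto)
      show "wp ?P5 ?tail m4"
      proof (rule wp_conseq[OF b4 w5])
        fix m5
        assume b5: "bounded B m5" and f5: "\<And>y. y \<notin> writes ?P5 \<Longrightarrow> m5 y = m4 y"
          and NI5: "\<forall>t < s * s. m5 ''NI'' t = (if t div s = t mod s then p ^ ex (t div s) - 1 else 0)"
        have e5: "m5 y = m4 y" if "y \<notin> {''t'', ''NI''}" for y using f5[of y] that by simp
        define m6 where "m6 = store ''h'' 0 1 (store ''N'' 0 1 m5)"
        have b6: "bounded B m6" unfolding m6_def using b5 B(3) by (intro bounded_store)
        have e6: "m6 y = m5 y" if "y \<notin> {''h'', ''N''}" for y using that by (simp add: m6_def)
        have "wp ?P6 (\<lambda>m'. m' ''N'' 0 = unit_exponent) m6"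
        proof (rule wp_for[where n = s and I = "\<lambda>k m'. m' ''h'' 0 = p ^ k \<and>
              m' ''N'' 0 = (\<Prod>i < k. (p ^ Suc i - 1) ^ 2)"])
          fix k m7
          assume k: "k < s"
            and f7: "\<And>y. y \<notin> insert ''k'' (writes ?step) \<Longrightarrow> m7 y = m6 y"
            and I7: "m7 ''h'' 0 = p ^ k \<and> m7 ''N'' 0 = (\<Prod>i < k. (p ^ Suc i - 1) ^ 2)"
          have p7: "m7 ''p'' 0 = p" using f7[of "''p''"] e6[of "''p''"] e5[of "''p''"] v4 by simp
          have "p ^ Suc k \<le> p ^ s" using k p_gt_1 by (intro power_increasing) auto
          then have "p * p ^ k \<le> B" using ps by simp
          moreover have "(\<Prod>i < k. (p ^ Suc i - 1) ^ 2) * ((p * p ^ k - 1) * (p * p ^ k - 1))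
              = (\<Prod>i < Suc k. (p ^ Suc i - 1) ^ 2)" by (simp add: power2_eq_square)
          moreover have "(\<Prod>i < Suc k. (p ^ Suc i - 1) ^ 2) \<le> B" using k by (intro partial_exponent_le) simp
          ultimately show "wp ?step
              (\<lambda>m''. store ''k'' 0 (Suc k) m'' ''h'' 0 = p ^ Suc k \<and>
                store ''k'' 0 (Suc k) m'' ''N'' 0 = (\<Prod>i < Suc k. (p ^ Suc i - 1) ^ 2)) m7"
            using I7 p7 by (simp add: wp_seq wp_assign mult.commute[of "p ^ k" p] del: prod.lessThan_Suc power_Suc)
              (simp del: prod.lessThan_Suc)
        qed (use b6 s_bound e6[of "''s''"] e5[of "''s''"] v4 in \<open>auto simp: m6_def unit_exponent_def\<close>)
        then have "wp ?P6 ?post m6"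
        proof (rule wp_conseq[OF b6])
          fix m7
          assume f7: "\<And>y. y \<notin> writes ?P6 \<Longrightarrow> m7 y = m6 y" and N7: "m7 ''N'' 0 = unit_exponent"
          have e7: "m7 y = m5 y" if "y \<notin> {''k'', ''h'', ''N''}" for y using f7[of y] e6[of y] that by simp
          show "m7 ''ss'' 0 = s * s \<and> m7 ''K'' 0 = K \<and> m7 ''N'' 0 = unit_exponent \<and>
            (\<forall>t < s * s. m7 ''Q'' t = p ^ ex (t div s)) \<and>
            (\<forall>t < s * s. m7 ''I'' t = (if t div s = t mod s then 1 else 0)) \<and>
            (\<forall>t < s * s. m7 ''NI'' t = (if t div s = t mod s then p ^ ex (t div s) - 1 else 0))"
            using N7 NI5 I4 v4 e7 e5 by simp
        qed
        then show "?tail m5"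
          unfolding wp_assign m6_def using B(3) by simp
      qed
    qed
  qed
  then show ?thesis
    unfolding setup_prog_def wp_seq wp_assign m2_def using i B by simp
qed

lemma wp_setup:
  assumes m: "bounded B m" "initial m" and ps: "p ^ s \<le> B" and exM: "\<And>i. ex i \<le> M"
  shows "wp setup_prog (\<lambda>m'. \<exists>\<sigma>. state m' \<sigma> \<and> consts_ok \<sigma> \<and> \<sigma> ''U'' = 0 \<and> \<sigma> ''Z'' = 0) m"
proof (rule wp_conseq[OF m(1) wp_setup_values[OF assms]])
  fix m'
  assume fr: "\<And>y. y \<notin> writes setup_prog \<Longrightarrow> m' y = m y"
    and v: "m' ''ss'' 0 = s * s \<and> m' ''K'' 0 = K \<and> m' ''N'' 0 = unit_exponent \<and>
      (\<forall>t < s * s. m' ''Q'' t = p ^ ex (t div s)) \<and>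
      (\<forall>t < s * s. m' ''I'' t = (if t div s = t mod s then 1 else 0)) \<and>
      (\<forall>t < s * s. m' ''NI'' t = (if t div s = t mod s then p ^ ex (t div s) - 1 else 0))"
  note i = m(2)[unfolded initial_def]
  define \<sigma> :: "string \<Rightarrow> rfmat" where "\<sigma> = (\<lambda>_. 0)(''I'' := 1, ''NI'' := -1, ''U1'' := u1, ''U2'' := u2)"
  have "holds m' ''I'' 1" unfolding holds_def using v by auto
  moreover have "holds m' ''NI'' (-1)" unfolding holds_def
  proof (intro conjI allI impI)
    show "-1 \<in> hom_ring" by (rule null.uminus_closed) simp
    fix t assume "t < s * s"
    then show "pp (ex (t div s)) dvd int (m' ''NI'' t) - ent (- 1) (t div s) (t mod s)"
      using v p_gt_1 by (simp add: of_nat_diff)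
  qed
  moreover have "holds m' x 0" if x: "x \<in> insert ''O'' regs" for x
  proof -
    have "x \<notin> writes setup_prog" using x by (auto simp: writes_setup_prog regs_def)
    then have "m' x = m x" by (rule fr)
    moreover have "\<forall>y \<in> insert ''O'' regs. \<forall>i. m y i = 0" using i by (elim conjE)
    then have "\<forall>i. m x i = 0" using x by (rule bspec)
    ultimately show ?thesis by (simp add: holds_def)
  qed
  moreover have "holds m' ''U1'' u1" "holds m' ''U2'' u2"
    using fr[of "''U1''"] fr[of "''U2''"] i by (simp_all add: writes_setup_prog holds_def)
  moreover have "''O'' \<in> insert ''O'' regs" by simp
  ultimately have "\<forall>x \<in> regs \<union> const_regs. holds m' x (\<sigma> x)"
    unfolding \<sigma>_def const_regs_def regs_def by simp
  moreover have "globals_ok m'"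
    using v i fr[of "''s''"] fr[of "''p''"] fr[of "''e''"]
    by (simp add: globals_ok_def writes_setup_prog)
  ultimately have "state m' \<sigma>" by (simp add: state_def)
  moreover have "consts_ok \<sigma>" "\<sigma> ''U'' = 0" "\<sigma> ''Z'' = 0" by (simp_all add: \<sigma>_def consts_ok_def)
  ultimately show "\<exists>\<sigma>. state m' \<sigma> \<and> consts_ok \<sigma> \<and> \<sigma> ''U'' = 0 \<and> \<sigma> ''Z'' = 0" by blast
qed

lemma wp_conjugacy_prog:
  assumes "bounded B m" "initial m" "p ^ s \<le> B" "\<And>i. ex i \<le> M"
  shows "wp conjugacy_prog (\<lambda>m'. \<exists>x z. main_inv x z (s * s) \<and> holds m' ''U'' x \<and> in_range m' ''U'' \<and>
      (m' ''found'' 0 \<noteq> 0 \<longleftrightarrow> 1 - z * x \<in> rad_ideal)) m"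
  unfolding conjugacy_prog_def wp_seq
proof (rule wp_conseq[OF assms(1) wp_setup[OF assms]])
  fix m1
  assume b1: "bounded B m1" and "\<exists>\<sigma>. state m1 \<sigma> \<and> consts_ok \<sigma> \<and> \<sigma> ''U'' = 0 \<and> \<sigma> ''Z'' = 0"
  then obtain \<sigma>1 where s1: "state m1 \<sigma>1" "consts_ok \<sigma>1" "\<sigma>1 ''U'' = 0" "\<sigma>1 ''Z'' = 0" by blast
  show "wp main_loop (wp final_test (\<lambda>m'. \<exists>x z. main_inv x z (s * s) \<and> holds m' ''U'' x \<and>
      in_range m' ''U'' \<and> (m' ''found'' 0 \<noteq> 0 \<longleftrightarrow> 1 - z * x \<in> rad_ideal))) m1"
  proof (rule wp_conseq[OF b1 wp_main_loop[OF b1 s1]])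
    fix m2
    assume b2: "bounded B m2" and "\<exists>\<sigma>'. state m2 \<sigma>' \<and> consts_ok \<sigma>' \<and> main_inv (\<sigma>' ''U'') (\<sigma>' ''Z'') (s * s)"
    then obtain \<sigma>2 where s2: "state m2 \<sigma>2" "consts_ok \<sigma>2" "main_inv (\<sigma>2 ''U'') (\<sigma>2 ''Z'') (s * s)" by blast
    show "wp final_test (\<lambda>m'. \<exists>x z. main_inv x z (s * s) \<and> holds m' ''U'' x \<and>
        in_range m' ''U'' \<and> (m' ''found'' 0 \<noteq> 0 \<longleftrightarrow> 1 - z * x \<in> rad_ideal)) m2"
      by (rule wp_conseq[OF b2 wp_final_test[OF b2 s2(1,2)]]) (use s2(3) in blast)
  qed
qed


text \<open>A conjugator and its inverse serve as \<open>Phi\<close> and \<open>Psi\<close> in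
  \<open>main_complete\<close>, so a negative answer excludes conjugators. For a positive one,
  \<open>x\<close> is a unit modulo the radical, hence has determinant prime to \<open>p\<close>,
  and it intertwines exactly by the invariant.\<close>

lemma answer_correct:
  assumes U: "U1 \<in> carrier R" "U2 \<in> carrier R" "u1 = cor U1" "u2 = cor U2"
    and inv: "main_inv x z (s * s)" and h: "holds m ''U'' x" "in_range m ''U''"
    and found: "m ''found'' 0 \<noteq> 0 \<longleftrightarrow> 1 - z * x \<in> rad_ideal"
  shows "correct_answer p es U1 U2 (conjugacy_output (length es) m)"
proof -
  note xz = inv[unfolded main_inv_def]
  have x: "x \<in> hom_ring" and z: "z \<in> hom_ring" and com: "null.cong (u2 * x) (x * u1)"
    using xz by auto
  have M: "U1 \<in> M_set p es" "U2 \<in> M_set p es" using U by (auto simp: carrier_R)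
  show ?thesis
  proof (cases "m ''found'' 0 = 0")
    case True
    have "U \<notin> conjugators p es U1 U2" for U
    proof
      assume "U \<in> conjugators p es U1 U2"
      then have UR: "U \<in> carrier R" and eq: "M_mult p es U U1 = M_mult p es U2 U"
        by (auto simp: conjugators_def)
      have UM: "U \<in> M_set p es" using UR by (simp add: carrier_R)
      have "null.cong (u2 * cor U) (cor (M_mult p es U2 U))"
        unfolding U(4) by (rule null.cong_sym[OF M_mult_cong[OF M(2) UM]])
      also have "null.cong \<dots> (cor U * u1)"
        unfolding eq[symmetric] U(3) by (rule M_mult_cong[OF UM M(1)])
      finally have com: "null.cong (u2 * cor U) (cor U * u1)" .
      obtain g where g: "g \<in> hom_ring" "null.cong (g * cor U) 1" using R_inverse[OF UR] by blast
      have "1 - z * x \<in> rad_ideal"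
        by (rule main_complete[OF inv M_set_hom[OF UM] com g])
      then show False using True found by simp
    qed
    then show ?thesis using True by (auto simp: correct_answer_def conjugacy_output_def)
  next
    case False
    define V where "V = mat s s (\<lambda>(i, j). int (m ''U'' (i * s + j)))"
    have lt: "i * s + j < s * s" "(i * s + j) div s = i" "(i * s + j) mod s = j" if "i < s" "j < s" for i j
      using that pair_less by auto
    have cong: "null.cong (cor V) x" unfolding null_cong_iff
    proof (intro allI impI)
      fix i j assume i: "i < s"
      show "pp (ex i) dvd ent (cor V) i j - ent x i j"
      proof (cases "j < s")
        case True
        then show ?thesis using h(1) i lt[OF i True] unfolding holds_def V_def
          by (auto simp: ent_corner dest!: conjunct2 spec[of _ "i * s + j"])
      next
        case False
        then show ?thesis using hom_ringD[OF x, of i j] ex_zero[of j] by (simp add: ent_corner)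
      qed
    qed
    have VM: "V \<in> M_set p es"
      unfolding M_set_iff
    proof (intro conjI allI impI)
      show "V \<in> carrier_mat s s" by (simp add: V_def)
      show "cor V \<in> hom_ring" by (rule null.cong_closed[OF cong x])
      fix i j assume ij: "i < s" "j < s"
      show "0 \<le> V $$ (i, j)" using ij by (simp add: V_def)
      have "m ''U'' (i * s + j) < p ^ ex i" using h(2) lt[OF ij] unfolding in_range_def by metis
      then show "V $$ (i, j) < pp (ex i)" using ij by (simp add: V_def flip: of_nat_power)
    qed
    have "1 - z * x \<in> rad_ideal" using False found by blast
    then have "\<not> int p dvd det (block x)" by (rule det_block_unitriangular[OF x z])
    then have VR: "V \<in> carrier R"
      using dvd_diff_iff[OF det_block_cong[OF cong]] VM by (simp add: carrier_R)
    have "null.cong (cor (M_mult p es V U1)) (cor V * u1)"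
      unfolding U(3) by (rule M_mult_cong[OF VM M(1)])
    also have "null.cong \<dots> (x * u1)" by (rule null.cong_right[OF cong u1])
    also have "null.cong \<dots> (u2 * x)" by (rule null.cong_sym[OF com])
    also have "null.cong \<dots> (u2 * cor V)" by (rule null.cong_left[OF null.cong_sym[OF cong] u2])
    also have "null.cong \<dots> (cor (M_mult p es U2 V))"
      unfolding U(4) by (rule null.cong_sym[OF M_mult_cong[OF M(2) VM]])
    finally have "M_mult p es V U1 = M_mult p es U2 V"
      using M_set_eqI[OF M_mult_closed[OF VM M(1)] M_mult_closed[OF M(2) VM]] by blast
    then have "V \<in> conjugators p es U1 U2" using VR by (simp add: conjugators_def)
    then show ?thesis
      using False by (simp add: correct_answer_def conjugacy_output_def V_def s_def)
  qed
qed

end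

section \<open>Running time\<close>

text \<open>Counting loops with polynomially many rounds cannot find the bit length of \<open>p\<close>.\<close>

definition bits_loop :: com where
  "bits_loop = While (NegE (LessE (var ''p'') (var ''w'')))
     (Seq (Assign ''w'' (Lit 0) (MulE (var ''w'') (Lit 2)))
          (Assign ''kp'' (Lit 0) (AddE (var ''kp'') (Lit 1))))"

definition bits_weight :: nat where
  "bits_weight = bweight (NegE (LessE (var ''p'') (var ''w'')))
     + assign_weight (Lit 0) (MulE (var ''w'') (Lit 2)) + assign_weight (Lit 0) (AddE (var ''kp'') (Lit 1))"

text \<open>\<open>d\<close> bounds the number of rounds left. The loop stops at the first power of
  2 above \<open>p\<close>, so ''w'' never exceeds \<open>2 * p\<close>; the same estimate later
  limits \<open>K\<close>.\<close>

lemma runs_bits_loop: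
  assumes "2 * p \<le> B" "bounded B m" "m ''p'' 0 = p" "m ''w'' 0 = 2 ^ j" "m ''kp'' 0 = j"
    "2 ^ j \<le> 2 * p" "p < 2 ^ (j + d)"
  shows "\<exists>k m'. runs bits_loop m (Suc d * bits_weight * bit_length B) m' \<and> p < 2 ^ k \<and> 2 ^ k \<le> 2 * p \<and>
     m' ''kp'' 0 = k \<and> (\<forall>y. y \<notin> {''w'', ''kp''} \<longrightarrow> m' y = m y) \<and> bounded B m'"
proof -
  let ?b = "NegE (LessE (var ''p'') (var ''w''))"
  let ?l = "bit_length B"
  have exit: "\<exists>k m'. runs bits_loop m (Suc d * bits_weight * ?l) m' \<and> p < 2 ^ k \<and> 2 ^ k \<le> 2 * p \<and>
     m' ''kp'' 0 = k \<and> (\<forall>y. y \<notin> {''w'', ''kp''} \<longrightarrow> m' y = m y) \<and> bounded B m'"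
    if "bounded B m" "m ''p'' 0 = p" "m ''w'' 0 = 2 ^ j" "m ''kp'' 0 = j" "2 ^ j \<le> 2 * p" "p < 2 ^ j" for d j m
  proof -
    have "exec bits_loop m (bcost ?b m) m"
      unfolding bits_loop_def by (rule exec_WhileFalse) (use that in simp)
    moreover have "bcost ?b m \<le> bweight ?b * ?l" by (rule bcost_le[OF that(1)])
    moreover have "bweight ?b * ?l \<le> Suc d * bits_weight * ?l"
      unfolding bits_weight_def by (intro mult_le_mono1) (simp add: trans_le_add1)
    ultimately have "runs bits_loop m (Suc d * bits_weight * ?l) m"
      unfolding runs_def using le_trans by blast
    then show ?thesis using that by (intro exI[of _ j] exI[of _ m]) simp
  qed
  show ?thesis
    using assms(2-)
  proof (induction d arbitrary: j m)
    case 0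
    then show ?case using exit[of m j 0] by simp
  next
    case (Suc d)
    show ?case
    proof (cases "p < 2 ^ j")
      case True
      then show ?thesis by (rule exit[OF Suc.prems(1-5)])
    next
      case False
      then have le: "2 ^ Suc j \<le> 2 * p" by simp
      let ?a1 = "Assign ''w'' (Lit 0) (MulE (var ''w'') (Lit 2))"
      let ?a2 = "Assign ''kp'' (Lit 0) (AddE (var ''kp'') (Lit 1))"
      define m1 where "m1 = store ''w'' 0 (2 ^ Suc j) m"
      define m2 where "m2 = store ''kp'' 0 (Suc j) m1"
      have b1: "bounded B m1" unfolding m1_def
        using Suc.prems(1) le assms(1) by (intro bounded_store) auto
      have "Suc j \<le> 2 ^ Suc j" using less_exp[of "Suc j"] by simp
      then have b2: "bounded B m2" unfolding m2_def
        using b1 le assms(1) by (intro bounded_store) auto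
      have "runs ?a1 m (assign_weight (Lit 0) (MulE (var ''w'') (Lit 2)) * ?l) m1"
        using runs_Assign[OF Suc.prems(1), of "''w''" "Lit 0" "MulE (var ''w'') (Lit 2)"] Suc.prems(3)
        by (simp add: m1_def mult.commute)
      moreover have "runs ?a2 m1 (assign_weight (Lit 0) (AddE (var ''kp'') (Lit 1)) * ?l) m2"
        using runs_Assign[OF b1, of "''kp''" "Lit 0" "AddE (var ''kp'') (Lit 1)"] Suc.prems(4)
        by (simp add: m1_def m2_def)
      ultimately obtain t1 where t1: "exec (Seq ?a1 ?a2) m t1 m2"
        "t1 \<le> assign_weight (Lit 0) (MulE (var ''w'') (Lit 2)) * ?l + assign_weight (Lit 0) (AddE (var ''kp'') (Lit 1)) * ?l"
        using runs_Seq[of ?a1 m _ m1 ?a2 _ m2] unfolding runs_def by blast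
      have "\<exists>k m'. runs bits_loop m2 (Suc d * bits_weight * ?l) m' \<and> p < 2 ^ k \<and> 2 ^ k \<le> 2 * p \<and>
         m' ''kp'' 0 = k \<and> (\<forall>y. y \<notin> {''w'', ''kp''} \<longrightarrow> m' y = m2 y) \<and> bounded B m'"
        using Suc.prems le by (intro Suc.IH[OF b2, of "Suc j"]) (simp_all add: m1_def m2_def)
      then obtain k m' where rr: "runs bits_loop m2 (Suc d * bits_weight * ?l) m'"
        and k: "p < 2 ^ k" "2 ^ k \<le> 2 * p" "m' ''kp'' 0 = k" "bounded B m'"
          "\<And>y. y \<notin> {''w'', ''kp''} \<Longrightarrow> m' y = m2 y" by (elim exE conjE) simp
      obtain t2 where r: "exec bits_loop m2 t2 m'" "t2 \<le> Suc d * bits_weight * ?l"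
        using rr unfolding runs_def by blast
      have "bval ?b m" using False Suc.prems by simp
      then have e: "exec bits_loop m (bcost ?b m + t1 + t2) m'"
        using t1(1) r(1) unfolding bits_loop_def by (rule exec_WhileTrue)
      have "bcost ?b m + t1 + t2 \<le> bits_weight * ?l + Suc d * bits_weight * ?l"
        using bcost_le[OF Suc.prems(1), of ?b] t1(2) r(2)
        unfolding bits_weight_def add_mult_distrib by linarith
      also have "\<dots> = Suc (Suc d) * bits_weight * ?l" by (simp add: add_mult_distrib)
      finally have "runs bits_loop m (Suc (Suc d) * bits_weight * ?l) m'"
        using e unfolding runs_def by blast
      moreover have "m' y = m y" if "y \<notin> {''w'', ''kp''}" for y
        using k(5)[OF that] that by (simp add: m2_def m1_def)
      ultimately show ?thesis using k(1-4) by (intro exI[of _ k] exI[of _ m']) simp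
    qed
qed
qed

lemma wf_seed: "wf_prog (seed i a)"
  by (simp add: seed_def)

lemma wf_avg: "wf_prog (avg P W Q)"
  by (simp add: avg_def wf_mac halve_def writes_mac)

lemma wf_mod_inverse: "wf_prog mod_inverse"
  by (simp add: mod_inverse_def halve_def)

lemma wf_geninv: "wf_prog geninv"
  by (simp add: geninv_def wf_mac wf_seed wf_mod_inverse writes_mac writes_seed writes_mod_inverse)

lemma writes_main_body: "''a'' \<notin> writes main_body" "''ss'' \<notin> writes main_body"
  using writes_avg[of "''U2''" "''G''" "''U1''"] writes_avg[of "''U1''" "''V''" "''U2''"] writes_geninv
  by (auto simp: main_body_def writes_mac writes_seed)

lemma wf_conjugacy_prog: "wf_prog conjugacy_prog"
  using writes_main_body
  by (simp add: conjugacy_prog_def setup_prog_def main_loop_def main_body_def final_test_def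
      wf_mac wf_seed wf_avg wf_geninv)

text \<open>When the order of \<open>A\<close> is at most \<open>2 ^ n\<close>, the numbers
  \<open>s\<close> and \<open>ex i\<close> are at most \<open>n\<close> and the bit count
  \<open>kp\<close> of \<open>p\<close> is at most \<open>n + 1\<close>. The cube in
  \<open>M\<close> is there for the loop bound \<open>K = kp * (s * (s + 1))\<close>. Values stay
  within \<open>2 ^ M\<close>, hence within \<open>M + 1\<close> bits.\<close>

lemma exec_conjugacy:
  fixes p :: nat and es :: "nat list" and U1 U2 :: "int mat" and n :: nat
  assumes inst: "conjugacy_instance p es U1 U2" and n: "p ^ sum_list es \<le> 2 ^ n"
  defines "M \<equiv> (n + 2) ^ 3"
  shows "\<exists>m. runs (Seq (Seq (Assign ''w'' (Lit 0) (Lit 1)) bits_loop) (compile conjugacy_prog))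
        (conjugacy_input p es U1 U2)
        ((assign_weight (Lit 0) (Lit 1) + (n + 2) * bits_weight + weight conjugacy_prog M) * (M + 1)) m \<and>
      correct_answer p es U1 U2 (conjugacy_output (length es) m)"
proof -
  have valid: "valid_type p es" and UR: "U1 \<in> carrier (R_group p es)" "U2 \<in> carrier (R_group p es)"
    and ord: "coprime (group.ord (R_group p es) U1) p" "coprime (group.ord (R_group p es) U2) p"
    using inst by (auto simp: conjugacy_instance_def)
  interpret pe: prime_exponents p es by unfold_locales (rule valid)
  define u1 u2 where "u1 = pe.cor U1" and "u2 = pe.cor U2"
  have UM: "U1 \<in> M_set p es" "U2 \<in> M_set p es" using UR by (auto simp: pe.carrier_R)
  interpret pair: semisimple_pair p es u1 u2
    using pe.M_set_hom[OF UM(1)] pe.M_set_hom[OF UM(2)]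
      pe.power_unit_exponent[OF UR(1) ord(1)] pe.power_unit_exponent[OF UR(2) ord(2)]
    by unfold_locales (simp_all add: u1_def u2_def)
  let ?s = "pe.s"
  define e where "e = sum_list es"
  define B :: nat where "B = 2 ^ M"
  define l where "l = bit_length B"
  have two: "2 ^ k \<le> p ^ k" for k using pe.p_gt_1 by (intro power_mono) auto
  have "length es \<le> e"
  proof -
    have "(\<Sum>i < length es. 1) \<le> (\<Sum>i < length es. es ! i)"
      using valid by (intro sum_mono) (auto simp: valid_type_def Suc_le_eq)
    then show ?thesis by (simp add: e_def sum_list_sum_nth atLeast0LessThan)
  qed
  then have se: "?s \<le> e" by (simp add: pe.s_def)
  have "(2::nat) ^ e \<le> 2 ^ n" using two[of e] n unfolding e_def by linarith
  then have en: "e \<le> n" by (simp add: power_le_imp_le_exp)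
  have exe: "pe.ex i \<le> e" for i
    by (auto simp: pe.ex_def pe.s_def e_def intro: member_le_sum_list)
  have s1: "1 \<le> ?s" using pe.s_pos by simp
  have pn: "p ^ k \<le> 2 ^ n" if "k \<le> e" for k
    using power_increasing[OF that, of p] pe.p_gt_1 n unfolding e_def by linarith
  have p_n: "p \<le> 2 ^ n" using pn[of 1] s1 se by simp
  have cube: "(n + 2) ^ 3 = (n + 2) * (n + 2) * (n + 2)" by (simp add: power3_eq_cube)
  have nM: "n + 2 \<le> M" "(n + 1) * (n * (n + 1)) \<le> M" "n * n \<le> M"
    unfolding M_def cube by (simp_all add: algebra_simps)
  have pow_B: "x \<le> B" if "x \<le> 2 ^ k" "k \<le> M" for x k
    unfolding B_def using that power_increasing[of k M "2::nat"] by linarith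
  have MB: "M \<le> B" unfolding B_def by (rule less_imp_le[OF less_exp])
  have p2B: "2 * p \<le> B" using p_n nM(1) by (intro pow_B[of _ "Suc n"]) auto
  define m0 where "m0 = conjugacy_input p es U1 U2"
  have m0: "m0 ''p'' = (\<lambda>n. if n = 0 then p else 0)" "m0 ''s'' = (\<lambda>n. if n = 0 then length es else 0)"
    "m0 ''e'' = (\<lambda>n. if n < length es then es ! n else 0)"
    "m0 ''U1'' = mat_array U1" "m0 ''U2'' = mat_array U2"
    "\<And>x. x \<notin> {''p'', ''s'', ''e'', ''U1'', ''U2''} \<Longrightarrow> m0 x = (\<lambda>_. 0)"
    by (auto simp: m0_def conjugacy_input_def)
  have array: "mat_array U t = nat (U $$ (t div ?s, t mod ?s))" if "U \<in> M_set p es" "t < ?s * ?s" for U t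
    using that by (auto simp: mat_array_def pe.M_set_iff)
  have array_le: "mat_array U t \<le> B" if U: "U \<in> M_set p es" for U t
  proof (cases "t < ?s * ?s")
    case True
    have "U $$ (t div ?s, t mod ?s) < int p ^ pe.ex (t div ?s)"
      using U pe.index_less[OF True] by (simp add: pe.M_set_iff)
    moreover have "0 \<le> U $$ (t div ?s, t mod ?s)"
      using U pe.index_less[OF True] by (simp add: pe.M_set_iff)
    ultimately have "mat_array U t < p ^ pe.ex (t div ?s)"
      using array[OF U True] by (simp add: nat_less_iff flip: of_nat_power)
    then show ?thesis using pn[OF exe, of "t div ?s"] nM(1) by (intro pow_B[of _ n]) auto
  next
    case False
    then show ?thesis using U by (auto simp: mat_array_def pe.M_set_iff)
  qed
  have b0: "bounded B m0" unfolding bounded_def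
  proof (intro allI)
    fix x i
    have sB: "length es \<le> B" using se en nM(1) MB by (simp add: pe.s_def)
    have eB: "es ! i \<le> B" if "i < length es"
      using exe[of i] that en nM(1) MB by (simp add: pe.ex_def pe.s_def)
    consider "x = ''p''" | "x = ''s''" | "x = ''e''" | "x = ''U1''" | "x = ''U2''"
      | "x \<notin> {''p'', ''s'', ''e'', ''U1'', ''U2''}" by blast
    then show "m0 x i \<le> B"
    proof cases
      case 6
      then show ?thesis using m0(6)[OF 6] by simp
    qed (use m0(1-5) p2B sB eB array_le[OF UM(1)] array_le[OF UM(2)] in simp_all)
  qed
  define m1 where "m1 = store ''w'' 0 1 m0"
  have b1: "bounded B m1" unfolding m1_def using b0 MB nM(1) by (intro bounded_store) auto
  have r1: "runs (Assign ''w'' (Lit 0) (Lit 1)) m0 (assign_weight (Lit 0) (Lit 1) * l) m1"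
    using runs_Assign[OF b0, of "''w''" "Lit 0" "Lit 1"] by (simp add: m1_def l_def)
  have "\<exists>k m'. runs bits_loop m1 (Suc (n + 1) * bits_weight * bit_length B) m' \<and> p < 2 ^ k \<and> 2 ^ k \<le> 2 * p \<and>
     m' ''kp'' 0 = k \<and> (\<forall>y. y \<notin> {''w'', ''kp''} \<longrightarrow> m' y = m1 y) \<and> bounded B m'"
  proof (rule runs_bits_loop[OF p2B b1, of 0])
    have "(2::nat) ^ n < 2 ^ (0 + (n + 1))" by simp
    then show "p < 2 ^ (0 + (n + 1))" using p_n by linarith
  qed (use m0 pe.p_gt_1 in \<open>auto simp: m1_def\<close>)
  then obtain kp m2 where r2: "runs bits_loop m1 ((n + 2) * bits_weight * l) m2"
    and kp: "p < 2 ^ kp" "2 ^ kp \<le> 2 * p" "m2 ''kp'' 0 = kp" and b2: "bounded B m2"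
    and f2: "\<And>y. y \<notin> {''w'', ''kp''} \<Longrightarrow> m2 y = m1 y"
    by (auto simp: l_def)
  define K where "K = kp * (?s * (?s + 1))"
  have "(2::nat) ^ kp \<le> 2 ^ (n + 1)" using kp(2) p_n by simp
  then have "kp \<le> n + 1" using power_le_imp_le_exp by (metis one_less_numeral_iff semiring_norm(76))
  moreover have "?s * (?s + 1) \<le> n * (n + 1)" using se en by (intro mult_le_mono) auto
  ultimately have "K \<le> (n + 1) * (n * (n + 1))" unfolding K_def by (rule mult_le_mono)
  then have KM: "K \<le> M" using nM(2) by linarith
  \<comment> \<open>Dropping the subtracted ones leaves \<open>p\<close> to the power
    \<open>2 + 4 + ... + 2 * s\<close>, that is \<open>s * (s + 1)\<close>.\<close>
  have expK: "pe.unit_exponent < 2 ^ K"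
  proof -
    have "pe.unit_exponent \<le> (\<Prod>i < ?s. (p ^ Suc i) ^ 2)"
      unfolding pe.unit_exponent_def by (intro prod_mono) (auto intro!: power_mono)
    also have "\<dots> = p ^ (\<Sum>i < ?s. Suc i * 2)" by (simp only: power_sum power_mult)
    also have "(\<Sum>i < ?s. Suc i * 2) = ?s * (?s + 1)"
    proof -
      have "(\<Sum>i < k. Suc i * 2) = k * (k + 1)" for k by (induction k) auto
      then show ?thesis .
    qed
    also have "p ^ (?s * (?s + 1)) < (2 ^ kp) ^ (?s * (?s + 1))"
      using kp(1) s1 by (intro power_strict_mono) auto
    finally show ?thesis by (simp add: K_def power_mult)
  qed
  interpret alg: algorithm p es u1 u2 B M K
  proof unfold_locales
    show "M \<le> B" by (rule MB)
    show "p ^ pe.ex i \<le> B" for i using pn[OF exe] nM(1) by (intro pow_B[of _ n]) auto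
    show "pe.unit_exponent \<le> B" using expK KM by (intro pow_B[of _ K]) auto
    show "p \<le> B" using p2B by simp
    show "?s * ?s \<le> M" using mult_le_mono[of ?s n ?s n] se en nM(3) by linarith
    show "K \<le> M" by (rule KM)
    show "pe.unit_exponent < 2 ^ K" by (rule expK)
    have "kp \<le> K" using s1 by (simp add: K_def)
    then show "p < 2 ^ K" using kp(1) power_increasing[of kp K "2::nat"] by linarith
  qed
  have init: "alg.initial m2" unfolding alg.initial_def
  proof (intro conjI)
    have hold: "alg.holds m2 x (pe.cor U)"
      if "x \<in> {''U1'', ''U2''}" "m0 x = mat_array U" "U \<in> M_set p es" for x U
    proof -
      have "m2 x = mat_array U" using f2[of x] that by (auto simp: m1_def)
      moreover have "int (mat_array U t) = ent (pe.cor U) (t div ?s) (t mod ?s)" if t: "t < ?s * ?s" for t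
        using array[OF \<open>U \<in> M_set p es\<close> t] pe.index_less[OF t] \<open>U \<in> M_set p es\<close>
        by (simp add: ent_corner pe.M_set_iff)
      ultimately show ?thesis unfolding alg.holds_def using pe.M_set_hom[OF that(3)] by simp
    qed
    show "alg.holds m2 ''U1'' u1" "alg.holds m2 ''U2'' u2"
      using hold m0 UM by (auto simp: u1_def u2_def)
    show "m2 ''p'' 0 = p" "m2 ''s'' 0 = ?s" "\<forall>i < ?s. m2 ''e'' i = pe.ex i"
      using f2[of "''p''"] f2[of "''s''"] f2[of "''e''"] m0 by (simp_all add: m1_def pe.s_def pe.ex_def)
    show "m2 ''kp'' 0 * (?s * (?s + 1)) = K" by (simp add: K_def kp(3))
    show "\<forall>x \<in> insert ''O'' regs. \<forall>i. m2 x i = 0"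
    proof (intro ballI allI)
      fix x i assume "x \<in> insert ''O'' regs"
      then have "x \<notin> {''w'', ''kp''}" "x \<notin> {''p'', ''s'', ''e'', ''U1'', ''U2''}" by (auto simp: regs_def)
      then show "m2 x i = 0" using f2[of x] m0(6)[of x] by (simp add: m1_def)
    qed
  qed
  have "p ^ ?s \<le> B" using pn[OF se] nM(1) by (intro pow_B[of _ n]) auto
  moreover have "pe.ex i \<le> M" for i using exe[of i] en nM(1) by linarith
  ultimately have w: "alg.wp conjugacy_prog (\<lambda>m'. \<exists>x z. pair.main_inv x z (?s * ?s) \<and> alg.holds m' ''U'' x \<and>
      alg.in_range m' ''U'' \<and> (m' ''found'' 0 \<noteq> 0 \<longleftrightarrow> 1 - z * x \<in> pe.rad_ideal)) m2"
    by (rule alg.wp_conjugacy_prog[OF b2 init])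
  define m3 where "m3 = sem conjugacy_prog m2"
  have safe: "safe B M conjugacy_prog m2" using w by (simp add: alg.wp_def)
  have "correct_answer p es U1 U2 (conjugacy_output (length es) m3)"
    using w alg.answer_correct[OF UR u1_def u2_def] unfolding alg.wp_def m3_def by blast
  moreover have "runs (Seq (Seq (Assign ''w'' (Lit 0) (Lit 1)) bits_loop) (compile conjugacy_prog)) m0
      (assign_weight (Lit 0) (Lit 1) * l + (n + 2) * bits_weight * l + weight conjugacy_prog M * l) m3"
    unfolding m3_def l_def
    by (rule runs_Seq[OF runs_Seq[OF r1[unfolded l_def] r2[unfolded l_def]]
          runs_compile[OF MB wf_conjugacy_prog safe b2]])
  moreover have "l \<le> M + 1"
    unfolding l_def by (rule bit_length_le) (simp_all add: B_def)
  then have "assign_weight (Lit 0) (Lit 1) * l + (n + 2) * bits_weight * l + weight conjugacy_prog M * l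
      \<le> (assign_weight (Lit 0) (Lit 1) + (n + 2) * bits_weight + weight conjugacy_prog M) * (M + 1)"
    unfolding add_mult_distrib[symmetric] by (rule mult_le_mono2)
  ultimately show ?thesis unfolding m0_def using runs_mono by blast
qed

theorem theorem4p2:
  shows "\<exists>(c :: com) (q :: real poly).
    \<forall>(p :: nat) (es :: nat list) (U1 :: int mat) (U2 :: int mat).
      conjugacy_instance p es U1 U2 \<longrightarrow>
      (\<exists>t m. exec c (conjugacy_input p es U1 U2) t m \<and>
             real t \<le> poly q (log 2 (real (Coset.order (abelian_p_group p es)))) \<and>
             correct_answer p es U1 U2 (conjugacy_output (length es) m))"
proof -
  obtain c d where cd: "\<And>M. M \<ge> 1 \<Longrightarrow> weight conjugacy_prog M \<le> c * M ^ d"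
    using weight_poly by blast
  let ?c = "Seq (Seq (Assign ''w'' (Lit 0) (Lit 1)) bits_loop) (compile conjugacy_prog)"
  \<comment> \<open>In terms of \<open>X = n + 2\<close>, the weight at loop bound
    \<open>X ^ 3\<close> gives degree \<open>3 * d\<close>, the bit count loop one more, and the
    factor \<open>X ^ 3 + 1\<close> another 3, its summand 1 being absorbed by the 2 in
    \<open>C\<close>. The root \<open>-3\<close> in \<open>q\<close> comes from
    \<open>X <= L + 3\<close>, where rounding up costs 1.\<close>
  define C where "C = 2 * (assign_weight (Lit 0) (Lit 1) + bits_weight + c)"
  define D where "D = 3 * d + 4"
  define q :: "real poly" where "q = smult (real C) ([:3, 1:] ^ D)"
  have "\<exists>t m. exec ?c (conjugacy_input p es U1 U2) t m \<and>
      real t \<le> poly q (log 2 (real (Coset.order (abelian_p_group p es)))) \<and>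
      correct_answer p es U1 U2 (conjugacy_output (length es) m)"
    if inst: "conjugacy_instance p es U1 U2" for p es U1 U2
  proof -
    interpret prime_exponents p es
      by unfold_locales (use inst in \<open>simp add: conjugacy_instance_def\<close>)
    define A where "A = Coset.order (abelian_p_group p es)"
    define L where "L = log 2 (real A)"
    define n where "n = nat \<lceil>L\<rceil>"
    define X where "X = n + 2"
    have A: "A = p ^ sum_list es" by (simp add: A_def order_abelian_p_group)
    have A1: "1 \<le> A" using p_gt_1 by (simp add: A)
    then have L0: "0 \<le> L" by (simp add: L_def)
    have "real A = 2 powr L" using A1 by (simp add: L_def)
    also have "\<dots> \<le> 2 powr real n" unfolding n_def by (intro powr_mono) (auto simp: real_nat_ceiling_ge)
    also have "\<dots> = real (2 ^ n)" by (simp add: powr_realpow)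
    finally have "p ^ sum_list es \<le> 2 ^ n" unfolding A using of_nat_le_iff by blast
    then obtain m t where t: "exec ?c (conjugacy_input p es U1 U2) t m"
      "t \<le> (assign_weight (Lit 0) (Lit 1) + X * bits_weight + weight conjugacy_prog (X ^ 3)) * (X ^ 3 + 1)"
      and ans: "correct_answer p es U1 U2 (conjugacy_output (length es) m)"
      using exec_conjugacy[OF inst] unfolding runs_def X_def by blast
    have X1: "1 \<le> X" by (simp add: X_def)
    have "assign_weight (Lit 0) (Lit 1) + X * bits_weight + weight conjugacy_prog (X ^ 3)
        \<le> (assign_weight (Lit 0) (Lit 1) + bits_weight + c) * X ^ (3 * d + 1)"
    proof -
      have "assign_weight (Lit 0) (Lit 1) * 1 \<le> assign_weight (Lit 0) (Lit 1) * X ^ (3 * d + 1)"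
        using X1 by (intro mult_le_mono2) simp
      moreover have "X ^ 1 \<le> X ^ (3 * d + 1)" using X1 by (intro power_increasing) auto
      then have "X * bits_weight \<le> bits_weight * X ^ (3 * d + 1)" by (simp add: mult.commute mult_le_mono)
      moreover have "weight conjugacy_prog (X ^ 3) \<le> c * X ^ (3 * d + 1)"
      proof -
        have "weight conjugacy_prog (X ^ 3) \<le> c * X ^ (3 * d)"
          using cd[of "X ^ 3"] X1 by (simp add: power_mult)
        also have "\<dots> \<le> c * X ^ (3 * d + 1)" using X1 by (intro mult_le_mono2 power_increasing) auto
        finally show ?thesis .
      qed
      ultimately show ?thesis by (simp only: add_mult_distrib mult_1_right)
    qed
    moreover have "X ^ 3 + 1 \<le> 2 * X ^ 3" using X1 by simp
    ultimately have "t \<le> (assign_weight (Lit 0) (Lit 1) + bits_weight + c) * X ^ (3 * d + 1) * (2 * X ^ 3)"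
      using t(2) mult_le_mono le_trans by blast
    also have "\<dots> = C * X ^ D"
    proof -
      have "X ^ D = X ^ (3 * d + 1) * X ^ 3" unfolding D_def power_add[symmetric] by (simp add: add.commute)
      then show ?thesis unfolding C_def by (simp only: ac_simps)
    qed
    finally have "real t \<le> real C * real X ^ D" by (metis of_nat_le_iff of_nat_mult of_nat_power)
    also have "\<dots> \<le> real C * (L + 3) ^ D"
    proof (intro mult_left_mono power_mono)
      have "real n \<le> L + 1" using L0 unfolding n_def by linarith
      then show "real X \<le> L + 3" by (simp add: X_def)
    qed auto
    also have "\<dots> = poly q L" by (simp add: q_def poly_power add.commute)
    finally show ?thesis using t(1) ans unfolding L_def A_def by blast
  qed
  then show ?thesis by blast
qed

end
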